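(* Let $\mu_1,\dots,\mu_N$ be absolutely continuous measures on $\mathbb{R}^n$, each with finite mass, with densities $g_1,\dots,g_N$. Let $\mu_\wedge$ be the absolutely continuous measure with density $g_\wedge:=\min_{1\le j\le N} g_j$, and fix some $m\ge 0$ satisfying $$\mathcal{M}(\mu_\wedge)\le m\le\min_{1\le j\le N}\mathcal{M}(\mu_j).$$ Then there exists a unique minimizer in $\mathcal{P}^m$ of $$\min_{\nu\in\mathcal{P}^m}\ \sum_{j=1}^N\mathcal{MK}^2_{2,m}(\mu_j,\nu).$$
   Context: "Measure" means positive Borel measure; every measure on $\mathbb{R}^n$ is assumed to have finite second moment. "Absolutely continuous" is with respect to Lebesgue measure. $\mathcal{M}(\mu)$ is the total mass of $\mu$. For measures, $\mu'\le\mu$ means $\mu'(E)\le\mu(E)$ for all measurable $E$. $\pi_j$ is projection onto the $j$th coordinate. $\mathcal{P}^m$ is the set of measures $\nu$ on $\mathbb{R}^n$ with $\mathcal{M}(\nu)=m$ and $\int|x|^2\,\nu(dx)<\infty$. $\Pi_{\le}(\mu,\nu)$ is the set of measures $\gamma$ on $\mathbb{R}^n\times\mathbb{R}^n$ with $(\pi_1)_\#\gamma\le\mu$ and $(\pi_2)_\#\gamma\le\nu$. For $0\le m\le\min\{\mathcal{M}(\mu),\mathcal{M}(\nu)\}$, $$\mathcal{MK}^2_{2,m}(\mu,\nu):=\min_{\gamma\in\Pi_{\le}(\mu,\nu),\ \mathcal{M}(\gamma)=m}\int|x-y|^2\,\gamma(dx,dy).$$ *)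

theory Defs
  imports "HOL-Analysis.Analysis"
begin

abbreviation total_mass :: "'a measure \<Rightarrow> ennreal" where
  "total_mass \<mu> \<equiv> emeasure \<mu> (space \<mu>)"

text \<open>The condition on \<^term>\<open>sets \<mu>\<close> says that \<^term>\<open>\<mu>\<close> is a Borel measure; it also makes equality of two
  such measures the same as agreement on all Borel sets.\<close>

definition finite_second_moment :: "(real^'n) measure \<Rightarrow> bool" where
  "finite_second_moment \<mu> \<longleftrightarrow>
     sets \<mu> = sets borel \<and> (\<integral>\<^sup>+ x. ennreal ((norm x)\<^sup>2) \<partial>\<mu>) < \<infinity>"

definition measures_of_mass :: "real \<Rightarrow> (real^'n) measure set" where
  "measures_of_mass m = {\<nu>. finite_second_moment \<nu> \<and> total_mass \<nu> = ennreal m}"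

definition partial_plans ::
  "(real^'n) measure \<Rightarrow> (real^'n) measure \<Rightarrow> ((real^'n) \<times> (real^'n)) measure set" where
  "partial_plans \<mu> \<nu> =
     {\<gamma>. sets \<gamma> = sets borel \<and>
         (\<forall>E\<in>sets borel. emeasure (distr \<gamma> borel fst) E \<le> emeasure \<mu> E) \<and>
         (\<forall>E\<in>sets borel. emeasure (distr \<gamma> borel snd) E \<le> emeasure \<nu> E)}"

text \<open>The squared partial transport distance. It is a minimum in the literature; here it is the infimum
  in \<^typ>\<open>ennreal\<close>, the same value whenever the minimum is attained. It is only meaningful for
  \<open>0 \<le> m \<le> min (total_mass \<mu>) (total_mass \<nu>)\<close>.\<close>

definition MK2_sq :: "real \<Rightarrow> (real^'n) measure \<Rightarrow> (real^'n) measure \<Rightarrow> ennreal" where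
  "MK2_sq m \<mu> \<nu> =
     (INF \<gamma>\<in>{\<gamma> \<in> partial_plans \<mu> \<nu>. total_mass \<gamma> = ennreal m}.
        \<integral>\<^sup>+ (x, y). ennreal ((norm (x - y))\<^sup>2) \<partial>\<gamma>)"

end

theory Submission imports Defs "HOL-Probability.Probability" begin

text \<open>Existence is by compactness: plans with bounded cost have bounded second moments, and weak limits of
  measures on a Euclidean space come from Helly's theorem on the line, pulled back along a space-filling curve.

  For uniqueness let \<open>\<nu>\<^sub>1\<close>, \<open>\<nu>\<^sub>2\<close> be minimizers with optimal plans \<open>\<gamma>\<^sub>1\<^sub>j\<close>, \<open>\<gamma>\<^sub>2\<^sub>j\<close>. By convexity the midpoints \<open>\<gamma>\<^sub>j\<close> are
  optimal too. Let \<open>S\<^sub>j\<close> be the support of the part of \<open>\<mu>\<^sub>j\<close> that \<open>\<gamma>\<^sub>j\<close> leaves unused. Swapping small pieces of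
  mass shows that the support of \<open>\<gamma>\<^sub>j\<close> together with the diagonal over \<open>S\<^sub>j\<close> is monotone, hence almost everywhere
  single-valued. So mass arriving outside \<open>S\<^sub>j\<close> starts outside \<open>S\<^sub>j\<close>, where \<open>\<gamma>\<^sub>1\<^sub>j\<close> and \<open>\<gamma>\<^sub>2\<^sub>j\<close> both use all of \<open>\<mu>\<^sub>j\<close> and
  follow the same map: \<open>\<nu>\<^sub>1\<close> and \<open>\<nu>\<^sub>2\<close> agree off every \<open>S\<^sub>j\<close>. If the \<open>S\<^sub>j\<close> have no common point this is everywhere.
  If they have one, moving a little mass of every marginal next to it forces the cost to vanish, so that \<open>\<nu>\<^sub>i\<close> lies
  below every \<open>\<mu>\<^sub>j\<close>, and the lower bound on \<open>m\<close> identifies it with \<open>\<mu>\<^sub>\<and>\<close>.\<close>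

section \<open>Borel measures and monotone relations\<close>

text \<open>Optimal plans for two minimizers may use different parts of \<open>\<mu> j\<close>, so
  their supports cannot be compared directly. The support of the midpoint contains both, and
  optimality of the midpoint makes it monotone: one monotone set governs both plans. Saturation
  passes on in the same way, since an average of two quantities below \<open>\<mu> j\<close> reaches
  it only if both do. Absolute continuity enters through the points where a monotone relation
  branches: they form a Lebesgue null set, which carries none of \<open>\<mu> j\<close>. The case
  distinction is exhaustive because the finitely many complements of the \<open>S j\<close> cover
  the space unless the \<open>S j\<close> meet. At a common point, rerouting a fraction \<epsilon>
  of the mass saves \<epsilon> times the optimal cost and pays only \<epsilon> times a multiple of
  \<open>r\<^sup>2\<close>, with \<open>r\<close> arbitrarily small. The space-filling curve has to
  run through every ball in bounded time, so that a tight family of measures in space becomes a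
  tight family on the line.\<close>

definition add_measure :: "'a measure \<Rightarrow> 'a measure \<Rightarrow> 'a measure" where
  "add_measure M N = measure_of (space M) (sets M) (\<lambda>A. emeasure M A + emeasure N A)"

lemma space_add_measure [simp]: "space (add_measure M N) = space M"
  and sets_add_measure [simp, measurable_cong]: "sets (add_measure M N) = sets M"
  by (simp_all add: add_measure_def)

text \<open>Outside the sigma-algebra both sides are 0 by convention, so the formula holds for
  arbitrary \<open>A\<close>.\<close>

lemma emeasure_add_measure:
  assumes "sets N = sets M"
  shows "emeasure (add_measure M N) A = emeasure M A + emeasure N A"
proof (cases "A \<in> sets M")
  case True
  show ?thesis
    unfolding add_measure_def
  proof (rule emeasure_measure_of_sigma[OF sets.sigma_algebra_axioms _ _ True])
    show "positive (sets M) (\<lambda>A. emeasure M A + emeasure N A)"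
      by (simp add: positive_def)
    show "countably_additive (sets M) (\<lambda>A. emeasure M A + emeasure N A)"
      by (rule countably_additiveI) (simp add: assms suminf_add[symmetric] suminf_emeasure image_subset_iff)
  qed
qed (use assms in \<open>simp add: emeasure_notin_sets\<close>)

lemma nn_integral_add_measure:
  assumes N: "sets N = sets M" and f: "f \<in> borel_measurable M"
  shows "nn_integral (add_measure M N) f = nn_integral M f + nn_integral N f"
  using f
proof induction
  case (cong f g)
  moreover have "space N = space M" using N by (rule sets_eq_imp_space_eq)
  ultimately show ?case by (simp cong: nn_integral_cong_simp)
next
  case (set A)
  then show ?case by (simp add: emeasure_add_measure[OF N] N)
next
  case (mult u c)
  moreover have "u \<in> borel_measurable N" "u \<in> borel_measurable (add_measure M N)"
    using mult by (simp_all cong: measurable_cong_sets add: N)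
  ultimately show ?case by (simp add: nn_integral_cmult distrib_left)
next
  case (add u v)
  moreover have "u \<in> borel_measurable N" "u \<in> borel_measurable (add_measure M N)"
    "v \<in> borel_measurable N" "v \<in> borel_measurable (add_measure M N)"
    using add by (simp_all cong: measurable_cong_sets add: N)
  ultimately show ?case by (simp add: nn_integral_add ac_simps)
next
  case (seq U)
  have meas: "U i \<in> borel_measurable M" "U i \<in> borel_measurable N" "U i \<in> borel_measurable (add_measure M N)" for i
    using seq by (simp_all cong: measurable_cong_sets add: N)
  have inc: "incseq U" using seq by simp
  have "nn_integral L (SUP i. U i) = (SUP i. nn_integral L (U i))" if "\<And>i. U i \<in> borel_measurable L" for L
    using nn_integral_monotone_convergence_SUP[OF inc, of L] that by (simp add: SUP_apply[abs_def])
  moreover have "incseq (\<lambda>i. nn_integral L (U i))" for L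
    using inc by (auto simp: incseq_def le_fun_def intro!: nn_integral_mono)
  ultimately show ?case
    using meas seq.IH by (simp only: ennreal_SUP_add)
qed

text \<open>If \<open>N\<close> gave \<open>A\<close> more than \<open>M\<close> does, the
  inequality on the complement would make the total mass of \<open>N\<close> larger too; finiteness
  of \<open>M\<close> allows the complement to be cancelled. This turns marginal inequalities
  between equal masses into equalities and identifies a minimizer of cost zero.\<close>

lemma measure_eqI_if_le:
  assumes sets: "sets M = sets N" and le: "\<And>A. A \<in> sets M \<Longrightarrow> emeasure M A \<le> emeasure N A"
    and mass: "total_mass N \<le> total_mass M" and fin: "total_mass M < \<infinity>"
  shows "M = N"
proof (rule measure_eqI[OF sets antisym[OF le]])
  have space: "space M = space N" using sets by (rule sets_eq_imp_space_eq)
  fix A assume A: "A \<in> sets M"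
  have "emeasure M (space M - A) \<noteq> \<infinity>"
    using emeasure_mono[of "space M - A" "space M" M] fin by (auto simp: top_unique)
  moreover have "emeasure M (space M - A) + emeasure N A \<le> emeasure M (space M - A) + emeasure M A"
  proof -
    have "emeasure M (space M - A) + emeasure N A \<le> emeasure N (space M - A) + emeasure N A"
      using A by (intro add_right_mono le) auto
    also have "\<dots> = total_mass N"
      using A sets sets.sets_into_space[OF A] by (subst plus_emeasure) (auto simp: space intro!: arg_cong[where f="emeasure N"])
    also have "\<dots> \<le> total_mass M" by (rule mass)
    also have "\<dots> = emeasure M (space M - A) + emeasure M A"
      using A sets.sets_into_space[OF A] by (subst plus_emeasure) (auto intro!: arg_cong[where f="emeasure M"])
    finally show ?thesis .
  qed
  ultimately show "emeasure N A \<le> emeasure M A"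
    by (auto simp: ennreal_add_left_cancel_le)
qed

section \<open>Topological supports of Borel measures\<close>

definition support :: "'a::topological_space measure \<Rightarrow> 'a set" where
  "support M = {x. \<forall>U. open U \<longrightarrow> x \<in> U \<longrightarrow> emeasure M U > 0}"

lemma closed_support: "closed (support M)"
proof -
  have "- support M = \<Union>{U. open U \<and> emeasure M U = 0}"
    by (auto simp: support_def)
  then show ?thesis
    unfolding closed_def by (simp only:) (rule open_Union, simp)
qed

text \<open>The complement is a union of open null sets, possibly uncountable; a countable base
  reduces it to a countable one.\<close>

lemma support_null:
  fixes M :: "'a::second_countable_topology measure"
  assumes M: "sets M = sets borel"
  shows "emeasure M (- support M) = 0"
proof -
  obtain B :: "'a set set" where B: "countable B" "\<And>U. U \<in> B \<Longrightarrow> open U"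
      "\<And>U. open U \<Longrightarrow> \<exists>B'\<subseteq>B. U = \<Union>B'"
    using univ_second_countable[where 'a='a] by metis
  define C where "C = {U \<in> B. emeasure M U = 0}"
  have op: "open U" if "U \<in> C" for U
    using that B(2)[of U] by (auto simp: C_def)
  have "- support M \<subseteq> \<Union>C"
  proof
    fix x assume "x \<in> - support M"
    then obtain U where U: "open U" "x \<in> U" "emeasure M U = 0"
      by (auto simp: support_def)
    then obtain V where V: "V \<in> B" "x \<in> V" "V \<subseteq> U"
      using B(3)[of U] by auto
    have "U \<in> sets M" using U M by simp
    then have "emeasure M V = 0"
      using V(3) U(3) emeasure_mono[of V U M] by auto
    then show "x \<in> \<Union>C" using V by (auto simp: C_def)
  qed
  moreover have "(\<Union>U\<in>C. U) \<in> null_sets M"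
  proof (rule null_sets_UN')
    show "countable C" using B(1) by (auto simp: C_def)
    show "U \<in> null_sets M" if "U \<in> C" for U
      using that op[OF that] M by (intro null_setsI) (auto simp: C_def)
  qed
  moreover have "- support M \<in> sets M" using closed_support[of M] M by (simp add: borel_open closed_def)
  ultimately show ?thesis
    using emeasure_mono[of "- support M" "\<Union>C" M] by (auto simp: null_setsD1 null_setsD2)
qed

lemma support_ball_pos:
  fixes x :: "'a::metric_space"
  shows "x \<in> support M \<Longrightarrow> 0 < r \<Longrightarrow> 0 < emeasure M (ball x r)"
  by (simp add: support_def)

text \<open>The translates of a bounded set by the infinitely many vectors \<open>(\<delta> / (k + 2)) *\<^sub>R e\<close> are disjoint,
  have the same Lebesgue measure and stay in a bounded set.\<close>

lemma compact_null_if_directionally_discrete: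
  fixes K :: "'a::euclidean_space set"
  assumes K: "compact K" and \<delta>: "0 < \<delta>"
    and disj: "\<And>x t. x \<in> K \<Longrightarrow> 0 < t \<Longrightarrow> t < \<delta> \<Longrightarrow> x + t *\<^sub>R e \<notin> K"
  shows "emeasure lborel K = 0"
proof -
  \<comment> \<open>All these numbers lie strictly between 0 and \<delta>, hence so do their
    positive differences, and that is the range in which \<open>disj\<close> applies.\<close>
  define t where "t k = \<delta> / (real k + 2)" for k :: nat
  have t: "0 < t k" "t k < \<delta>" for k
    using \<delta> by (auto simp: t_def field_simps intro: add_pos_nonneg)
  define S where "S k = (\<lambda>x. t k *\<^sub>R e + x) ` K" for k
  have Sm: "S k \<in> sets lborel" for k
    using K by (auto simp: S_def intro!: borel_compact compact_translation)
  have em: "emeasure lborel (S k) = emeasure lborel K" for k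
  proof -
    have "S k = (+) (- (t k *\<^sub>R e)) -` K"
      by (force simp: S_def)
    then have "emeasure lborel (S k) = emeasure (distr lborel borel ((+) (- (t k *\<^sub>R e)))) K"
      using K by (subst emeasure_distr) (simp_all add: borel_compact del: uminus_add_conv_diff)
    then show ?thesis by (simp add: lborel_distr_plus)
  qed
  have "disjoint_family S"
  proof -
    \<comment> \<open>A common point of two translates yields two points of \<open>K\<close> that
      differ by \<open>(t k - t l) *\<^sub>R e\<close>.\<close>
    have no: False if xS: "x \<in> S k" "x \<in> S l" and "k < l" for x k l
    proof -
      obtain y z where y: "y \<in> K" "x = t k *\<^sub>R e + y" and z: "z \<in> K" "x = t l *\<^sub>R e + z"
        using xS unfolding S_def by (elim imageE) metis
      have "t l < t k" using \<open>k < l\<close> \<delta> by (auto simp: t_def field_simps)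
      then have "y + (t k - t l) *\<^sub>R e \<notin> K"
        using disj[OF y(1), of "t k - t l"] t[of k] t[of l] by linarith
      moreover have "y + (t k - t l) *\<^sub>R e = z"
        using y z by (simp add: algebra_simps)
      ultimately show False using z by simp
    qed
    show ?thesis
      unfolding disjoint_family_on_def
      by (metis disjoint_iff linorder_neqE_nat no)
  qed
  obtain R where R: "\<And>x. x \<in> K \<Longrightarrow> norm x \<le> R"
    using compact_imp_bounded[OF K] by (auto simp: bounded_iff)
  have "(\<Union>k. S k) \<subseteq> cball 0 (R + \<delta> * norm e)"
  proof
    fix y assume "y \<in> (\<Union>k. S k)"
    then obtain k x where x: "x \<in> K" "y = t k *\<^sub>R e + x" by (auto simp: S_def)
    have "norm y \<le> t k * norm e + norm x"
      using norm_triangle_ineq[of "t k *\<^sub>R e" x] t[of k] x by simp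
    also have "\<dots> \<le> \<delta> * norm e + R"
      using t[of k] R[OF x(1)] by (intro add_mono mult_right_mono) auto
    finally show "y \<in> cball 0 (R + \<delta> * norm e)" by simp
  qed
  then have "emeasure lborel (\<Union>k. S k) \<le> emeasure lborel (cball (0::'a) (R + \<delta> * norm e))"
    by (intro emeasure_mono) auto
  also have "\<dots> < \<infinity>"
    by (intro emeasure_bounded_finite) auto
  finally have fin: "emeasure lborel (\<Union>k. S k) \<noteq> \<infinity>" by simp
  have "(\<Sum>k. emeasure lborel K) = emeasure lborel (\<Union>k. S k)"
    using suminf_emeasure[of S lborel] \<open>disjoint_family S\<close> Sm em by auto
  then obtain u where u: "0 \<le> u" "(\<Sum>k::nat. emeasure lborel K) = ennreal u"
    using fin by (cases "\<Sum>k::nat. emeasure lborel K" rule: ennreal_cases) auto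
  have "emeasure lborel K < \<infinity>"
    using K by (intro emeasure_bounded_finite compact_imp_bounded)
  then obtain c where c: "0 \<le> c" "emeasure lborel K = ennreal c"
    by (cases "emeasure lborel K" rule: ennreal_cases) auto
  have "real n * c \<le> u" for n
  proof -
    have "(\<Sum>k<n. emeasure lborel K) \<le> (\<Sum>k::nat. emeasure lborel K)"
      by (rule sum_le_suminf) auto
    then show ?thesis
      using u c by (simp add: ennreal_of_nat_eq_real_of_nat ennreal_mult[symmetric])
  qed
  then have "\<not> 0 < c"
    by (metis ex_less_of_nat_mult not_le)
  then show ?thesis
    using c by simp
qed

text \<open>Two values at the same point are separated in some coordinate \<open>e\<close> by
  rationals \<open>p < q\<close>. By monotonicity the points with such a separation cannot recur
  further along \<open>e\<close>, so they form a null set. Bounding points and values by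
  \<open>n\<close> makes these sets compact, and countably many parameters suffice.\<close>

lemma closed_monotone_ae_single_valued:
  fixes S :: "('a::euclidean_space \<times> 'a) set"
  assumes S: "closed S"
    and mono: "\<And>x y x' y'. (x, y) \<in> S \<Longrightarrow> (x', y') \<in> S \<Longrightarrow> (x - x') \<bullet> (y - y') \<ge> 0"
  obtains Z where "Z \<in> null_sets lborel"
    "\<And>x y y'. (x, y) \<in> S \<Longrightarrow> (x, y') \<in> S \<Longrightarrow> y \<noteq> y' \<Longrightarrow> x \<in> Z"
proof -
  define K where "K e p q n = fst ` (S \<inter> {z. norm (fst z) \<le> real n \<and> norm (snd z) \<le> real n \<and> snd z \<bullet> e \<le> p}) \<inter>
    fst ` (S \<inter> {z. norm (fst z) \<le> real n \<and> norm (snd z) \<le> real n \<and> q \<le> snd z \<bullet> e})"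
    for e :: 'a and p q :: real and n :: nat
  define I where "I = (Basis :: 'a set) \<times> {(p :: real, q). p \<in> \<rat> \<and> q \<in> \<rat> \<and> p < q} \<times> (UNIV :: nat set)"
  have K: "compact (K e p q n)" for e p q n
  proof -
    have "{z :: 'a \<times> 'a. norm (fst z) \<le> real n \<and> norm (snd z) \<le> real n} = cball 0 n \<times> cball 0 n"
      by auto
    then have c: "compact {z :: 'a \<times> 'a. norm (fst z) \<le> real n \<and> norm (snd z) \<le> real n}"
      by (simp add: compact_Times)
    have c1: "closed {z :: 'a \<times> 'a. snd z \<bullet> e \<le> p}" and c2: "closed {z :: 'a \<times> 'a. q \<le> snd z \<bullet> e}"
      by (intro closed_Collect_le continuous_intros)+
    have "S \<inter> {z. norm (fst z) \<le> real n \<and> norm (snd z) \<le> real n \<and> snd z \<bullet> e \<le> p} =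
        {z. norm (fst z) \<le> real n \<and> norm (snd z) \<le> real n} \<inter> (S \<inter> {z. snd z \<bullet> e \<le> p})"
      "S \<inter> {z. norm (fst z) \<le> real n \<and> norm (snd z) \<le> real n \<and> q \<le> snd z \<bullet> e} =
        {z. norm (fst z) \<le> real n \<and> norm (snd z) \<le> real n} \<inter> (S \<inter> {z. q \<le> snd z \<bullet> e})"
      by auto
    then show ?thesis
      unfolding K_def
      by (simp only:)
        (intro compact_Int compact_continuous_image compact_Int_closed c closed_Int S c1 c2 continuous_intros)
  qed
  have null: "K e p q n \<in> null_sets lborel" if "p < q" for e p q n
  proof (rule null_setsI)
    show "emeasure lborel (K e p q n) = 0"
    \<comment> \<open>The choice \<open>\<delta>=1\<close> is arbitrary: the argument excludes every
      positive \<open>t\<close>.\<close>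
    proof (rule compact_null_if_directionally_discrete[OF K, where \<delta>=1 and e=e])
      fix x :: 'a and t :: real assume x: "x \<in> K e p q n" and t: "0 < t" "t < 1"
      show "x + t *\<^sub>R e \<notin> K e p q n"
      proof
        assume x': "x + t *\<^sub>R e \<in> K e p q n"
        obtain y where y: "(x, y) \<in> S" "q \<le> y \<bullet> e" using x by (auto simp: K_def)
        obtain y' where y': "(x + t *\<^sub>R e, y') \<in> S" "y' \<bullet> e \<le> p" using x' by (auto simp: K_def)
        \<comment> \<open>Moving along \<open>e\<close> cannot decrease the
          \<open>e\<close>-component of a value, so the value above \<open>q\<close> at
          \<open>x\<close> excludes one below \<open>p\<close> at the shifted point.\<close>
        have "0 \<le> t * (e \<bullet> (y' - y))"
          using mono[OF y'(1) y(1)] by simp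
        then have "0 \<le> e \<bullet> (y' - y)" using t by (simp add: zero_le_mult_iff)
        then show False using y y' that by (simp add: inner_diff_right inner_commute)
      qed
    qed simp
    show "K e p q n \<in> sets lborel" using K by (simp add: borel_compact)
  qed
  define Z where "Z = (\<Union>(e, (p, q), n)\<in>I. K e p q n)"
  have "countable I" unfolding I_def
    by (intro countable_SIGMA countable_finite[OF finite_Basis] countable_subset[OF _ countable_SIGMA[OF countable_rat countable_rat], of "{(p, q). p \<in> \<rat> \<and> q \<in> \<rat> \<and> p < q}"])
       auto
  then have "Z \<in> null_sets lborel"
    unfolding Z_def by (intro null_sets_UN') (auto simp: I_def intro: null)
  moreover have "x \<in> Z" if xy: "(x, y) \<in> S" "(x, y') \<in> S" "y \<noteq> y'" for x y y'
  proof -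
    have *: "x \<in> Z" if xy: "(x, y) \<in> S" "(x, y') \<in> S" and e: "e \<in> Basis" "y \<bullet> e < y' \<bullet> e" for y y' e
    proof -
      obtain p where p: "p \<in> \<rat>" "y \<bullet> e < p" "p < y' \<bullet> e" using Rats_dense_in_real[OF e(2)] by auto
      obtain q where q: "q \<in> \<rat>" "p < q" "q < y' \<bullet> e" using Rats_dense_in_real[OF p(3)] by auto
      obtain n :: nat where n: "max (norm x) (max (norm y) (norm y')) \<le> real n" using real_arch_simple by blast
      have "x \<in> K e p q n"
        unfolding K_def
      proof (rule IntI; rule image_eqI)
        show "(x, y) \<in> S \<inter> {z. norm (fst z) \<le> real n \<and> norm (snd z) \<le> real n \<and> snd z \<bullet> e \<le> p}"
          "(x, y') \<in> S \<inter> {z. norm (fst z) \<le> real n \<and> norm (snd z) \<le> real n \<and> q \<le> snd z \<bullet> e}"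
          using xy p q n by auto
      qed simp_all
      then show ?thesis
        using e p q by (auto simp: Z_def I_def intro!: bexI[of _ "(e, (p, q), n)"])
    qed
    obtain e where "e \<in> Basis" "y \<bullet> e \<noteq> y' \<bullet> e"
      using xy(3) by (auto simp: euclidean_eq_iff[of y y'])
    then show ?thesis using *[OF xy(1,2)] *[OF xy(2,1)] by (meson linorder_neqE)
  qed
  ultimately show ?thesis using that by blast
qed

section \<open>A space-filling curve\<close>

lemma binary_expansion:
  fixes x :: real
  assumes "x \<in> {0..1}"
  obtains b :: "nat \<Rightarrow> real" where "\<And>k. b k \<in> {0, 1}" and "(\<lambda>k. b k / 2 ^ Suc k) sums x"
proof -
  \<comment> \<open>The remainder after \<open>k\<close> digits, rescaled to the unit interval. The
    endpoint 1 is a fixed point of the recursion and gets the expansion with all digits 1.\<close>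
  define r where "r = rec_nat x (\<lambda>_ u. if u \<ge> 1 / 2 then 2 * u - 1 else 2 * u)"
  define b where "b k = (if r k \<ge> 1 / 2 then 1 else 0 :: real)" for k
  have r0: "r 0 = x" and rS: "r (Suc k) = 2 * r k - b k" for k
    by (auto simp: r_def b_def)
  have r01: "r k \<in> {0..1}" for k
    by (induction k) (use assms in \<open>auto simp: r0 rS b_def\<close>)
  have part: "(\<Sum>k<n. b k / 2 ^ Suc k) = x - r n / 2 ^ n" for n
    by (induction n) (auto simp: r0 rS field_simps)
  have "(\<lambda>n. r n / 2 ^ n) \<longlonglongrightarrow> 0"
  proof (rule tendsto_sandwich[of "\<lambda>_. 0" _ _ "\<lambda>n. (1 / 2) ^ n"])
    show "(\<lambda>n. (1 / 2 :: real) ^ n) \<longlonglongrightarrow> 0"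
      by (rule LIMSEQ_power_zero) simp
    show "\<forall>\<^sub>F n in sequentially. r n / 2 ^ n \<le> (1 / 2) ^ n"
      using r01 by (auto simp: field_simps)
  qed (use r01 in auto)
  then have "(\<lambda>n. x - r n / 2 ^ n) \<longlonglongrightarrow> x - 0"
    by (intro tendsto_intros)
  then have "(\<lambda>k. b k / 2 ^ Suc k) sums x"
    unfolding sums_def part by simp
  then show ?thesis
    using that[of b] by (auto simp: b_def)
qed

text \<open>Schoenberg's curve: the wave has period 2, vanishes on \<open>[0, 1/3]\<close> and equals 1 on \<open>[2/3, 1]\<close>, so
  \<open>schoenberg_wave (3 ^ k * t)\<close> reads off a ternary digit of \<open>t\<close> if all its digits are 0 or 2.\<close>

definition schoenberg_wave :: "real \<Rightarrow> real" where
  "schoenberg_wave u = max 0 (min 1 (1 / 2 - cos (pi * u)))"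

lemma schoenberg_wave_bounds: "0 \<le> schoenberg_wave u" "schoenberg_wave u \<le> 1"
  by (auto simp: schoenberg_wave_def)

lemma continuous_on_schoenberg_wave [continuous_intros]:
  fixes f :: "real \<Rightarrow> real"
  assumes "continuous_on A f"
  shows "continuous_on A (\<lambda>x. schoenberg_wave (f x))"
  unfolding schoenberg_wave_def by (intro continuous_intros assms)

lemma schoenberg_wave_periodic: "schoenberg_wave (u + 2 * of_int n) = schoenberg_wave u"
proof -
  have "cos (pi * (u + 2 * of_int n)) = cos (pi * u)"
    using sin_cos_eq_iff[of "pi * u" "pi * (u + 2 * of_int n)"]
    by (metis (no_types, opaque_lifting) add.commute cos_int_2pin cos_add distrib_left mult.assoc mult.commute
        mult.right_neutral sin_int_2pin diff_zero mult_zero_right)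
  then show ?thesis
    by (simp add: schoenberg_wave_def)
qed

lemma schoenberg_wave_0:
  assumes "u \<in> {0..1/3}" shows "schoenberg_wave u = 0"
proof -
  have "cos (pi / 3) \<le> cos (pi * u)"
    using assms by (subst cos_mono_le_eq) auto
  then show ?thesis
    by (simp add: schoenberg_wave_def cos_60)
qed

lemma schoenberg_wave_1:
  assumes "u \<in> {2/3..1}" shows "schoenberg_wave u = 1"
proof -
  have "cos (pi * u) \<le> cos (2 * pi / 3)"
    using assms by (subst cos_mono_le_eq) (auto simp: field_simps)
  also have "\<dots> = - (1 / 2)"
    by (simp add: cos_120)
  finally show ?thesis
    by (simp add: schoenberg_wave_def)
qed

text \<open>The witness is the point of the Cantor set with ternary digits \<open>2 * a k\<close>.
  Multiplication by \<open>3 ^ k\<close> shifts the digits and creates an integer part that is even,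
  because all digits are; the period 2 removes it. The rest lies in the first or the last third of
  the unit interval according to \<open>a k\<close>.\<close>

lemma schoenberg_wave_digits:
  fixes a :: "nat \<Rightarrow> real"
  assumes a: "\<And>k. a k \<in> {0, 1}"
  obtains t where "t \<in> {0..1}" "\<And>k. schoenberg_wave (3 ^ k * t) = a k"
proof -
  define T where "T c = (\<Sum>j. 2 * c j / 3 ^ Suc j)" for c :: "nat \<Rightarrow> real"
  have geo: "(\<lambda>j. 2 * (1 / 3) ^ Suc j) sums (1 :: real)"
    using sums_mult[OF geometric_sums[of "1/3 :: real"], of "2/3"] by (simp add: field_simps)
  have summ: "summable (\<lambda>j. 2 * c j / 3 ^ Suc j)" if "\<And>k. c k \<in> {0, 1}" for c :: "nat \<Rightarrow> real"
  proof (rule summable_comparison_test'[OF sums_summable[OF geo]])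
    fix n show "norm (2 * c n / 3 ^ Suc n) \<le> 2 * (1 / 3) ^ Suc n"
      using that[of n] by (auto simp: field_simps)
  qed
  have T01: "T c \<in> {0..1}" if c: "\<And>k. c k \<in> {0, 1}" for c
  proof -
    have "0 \<le> c n" for n
      using c[of n] by auto
    then have "0 \<le> T c" unfolding T_def
      by (intro suminf_nonneg[OF summ[OF c]]) simp
    moreover have "T c \<le> (\<Sum>j. 2 * (1 / 3) ^ Suc j)" unfolding T_def
    proof (rule suminf_le[OF _ summ[OF c] sums_summable[OF geo]])
      fix n show "2 * c n / 3 ^ Suc n \<le> 2 * (1 / 3) ^ Suc n"
        using c[of n] by (auto simp: field_simps)
    qed
    ultimately show ?thesis
      using sums_unique[OF geo] by simp
  qed
  have Tshift: "3 * T c = 2 * c 0 + T (\<lambda>j. c (Suc j))" if c: "\<And>k. c k \<in> {0, 1}" for c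
  proof -
    have "T c = 2 * c 0 / 3 + (\<Sum>j. 2 * c (Suc j) / 3 ^ Suc (Suc j))"
      unfolding T_def using suminf_split_head[where f="\<lambda>j. 2 * c j / 3 ^ Suc j", OF summ[of c]] c by simp
    also have "(\<Sum>j. 2 * c (Suc j) / 3 ^ Suc (Suc j)) = (\<Sum>j. (2 * c (Suc j) / 3 ^ Suc j) / 3)"
      by (simp add: field_simps)
    also have "\<dots> = T (\<lambda>j. c (Suc j)) / 3"
      unfolding T_def by (rule suminf_divide) (use summ[of "\<lambda>j. c (Suc j)"] c in auto)
    finally show ?thesis by simp
  qed
  have shift: "\<exists>n::int. 3 ^ k * T a = 2 * of_int n + T (\<lambda>j. a (j + k))" for k
  proof (induction k)
    case 0 show ?case by (rule exI[of _ 0]) simp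
  next
    case (Suc k)
    then obtain n :: int where n: "3 ^ k * T a = 2 * of_int n + T (\<lambda>j. a (j + k))" by auto
    obtain e :: int where e: "a k = of_int e"
      using a[of k] by (auto intro: that[of 0] that[of 1])
    have "3 ^ Suc k * T a = 6 * of_int n + 3 * T (\<lambda>j. a (j + k))"
      using n by simp
    also have "\<dots> = 2 * of_int (3 * n + e) + T (\<lambda>j. a (j + Suc k))"
      using Tshift[of "\<lambda>j. a (j + k)"] a by (simp add: e)
    finally show ?case by blast
  qed
  have wave: "schoenberg_wave (T c) = c 0" if c: "\<And>k. c k \<in> {0, 1}" for c
  proof -
    have "T (\<lambda>j. c (Suc j)) \<in> {0..1}" using T01 c by auto
    then have "3 * T c \<in> {2 * c 0..2 * c 0 + 1}" using Tshift[OF c] by auto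
    then show ?thesis
      using c[of 0] schoenberg_wave_0[of "T c"] schoenberg_wave_1[of "T c"] by auto
  qed
  have "schoenberg_wave (3 ^ k * T a) = a k" for k
  proof -
    obtain n :: int where "3 ^ k * T a = 2 * of_int n + T (\<lambda>j. a (j + k))"
      using shift by blast
    then have "schoenberg_wave (3 ^ k * T a) = schoenberg_wave (T (\<lambda>j. a (j + k)))"
      using schoenberg_wave_periodic[of "T (\<lambda>j. a (j + k))" n] by (simp add: add.commute)
    then show ?thesis using wave[of "\<lambda>j. a (j + k)"] a by simp
  qed
  then show ?thesis using that T01 a by blast
qed

text \<open>Coordinate \<open>i\<close> of \<open>d\<close> takes its binary digits from the ternary
  positions congruent to \<open>i\<close> modulo \<open>d\<close>, so that the coordinates with
  \<open>i < d\<close> can be prescribed independently.\<close>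

definition schoenberg_coord :: "nat \<Rightarrow> nat \<Rightarrow> real \<Rightarrow> real" where
  "schoenberg_coord d i t = (\<Sum>k. schoenberg_wave (3 ^ (d * k + i) * t) / 2 ^ Suc k)"

lemma continuous_on_schoenberg_coord: "continuous_on UNIV (schoenberg_coord d i)"
proof -
  have "uniform_limit UNIV (\<lambda>n t. \<Sum>k<n. schoenberg_wave (3 ^ (d * k + i) * t) / 2 ^ Suc k)
      (schoenberg_coord d i) sequentially"
    unfolding schoenberg_coord_def
  proof (rule Weierstrass_m_test)
    show "summable (\<lambda>k. (1 / 2 :: real) ^ Suc k)"
      by (simp add: summable_geometric)
    fix n and t :: real
    show "norm (schoenberg_wave (3 ^ (d * n + i) * t) / 2 ^ Suc n) \<le> (1 / 2) ^ Suc n"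
      using schoenberg_wave_bounds[of "3 ^ (d * n + i) * t"] by (simp add: field_simps)
  qed
  then show ?thesis
    by (rule uniform_limit_theorem[rotated]) (auto intro!: always_eventually continuous_intros)
qed

lemma schoenberg_coord_periodic: "schoenberg_coord d i (t + 2 * of_int n) = schoenberg_coord d i t"
proof -
  have "schoenberg_wave (3 ^ k * (t + 2 * of_int n)) = schoenberg_wave (3 ^ k * t)" for k
    using schoenberg_wave_periodic[of "3 ^ k * t" "3 ^ k * n"] by (simp add: algebra_simps)
  then show ?thesis
    by (simp add: schoenberg_coord_def)
qed

lemma schoenberg_coord_surj:
  assumes x: "\<And>i. i < d \<Longrightarrow> x i \<in> {0..1}"
  obtains t where "t \<in> {0..1}" "\<And>i. i < d \<Longrightarrow> schoenberg_coord d i t = x i"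
proof -
  have "\<forall>i. \<exists>b. i < d \<longrightarrow> (\<forall>k. b k \<in> {0, 1::real}) \<and> (\<lambda>k. b k / 2 ^ Suc k) sums x i"
    using x binary_expansion by metis
  then obtain b where b: "\<And>i k. i < d \<Longrightarrow> b i k \<in> {0, 1::real}"
    "\<And>i. i < d \<Longrightarrow> (\<lambda>k. b i k / 2 ^ Suc k) sums x i"
    by metis
  \<comment> \<open>Digit \<open>k\<close> of \<open>x i\<close> goes to position
    \<open>d * k + i\<close>. The guard for \<open>d = 0\<close>, where there are no coordinates,
    only keeps the values in \<open>{0, 1}\<close>.\<close>
  define a where "a j = (if d = 0 then 0 else b (j mod d) (j div d))" for j
  have "a k \<in> {0, 1}" for k
    using b(1)[of "k mod d" "k div d"] by (auto simp: a_def)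
  then obtain t where t: "t \<in> {0..1}" "\<And>k. schoenberg_wave (3 ^ k * t) = a k"
    using schoenberg_wave_digits by metis
  have "schoenberg_coord d i t = x i" if "i < d" for i
    using that t(2) sums_unique[OF b(2)[OF that]] by (simp add: schoenberg_coord_def a_def)
  then show ?thesis using that t(1) by blast
qed

text \<open>Surjectivity is stated ball by ball with a time bound, because tightness on the line
  requires that a ball be visited within a bounded interval. The cube covered by the Schoenberg
  coordinates is stretched to the whole space.\<close>

lemma space_filling_curve:
  obtains \<Psi> :: "real \<Rightarrow> 'a::euclidean_space"
  where "continuous_on UNIV \<Psi>" "\<And>R. \<exists>T. cball 0 R \<subseteq> \<Psi> ` {0..T}"
proof -
  define d where "d = card (Basis :: 'a set)"
  obtain e where e: "bij_betw e (Basis :: 'a set) {..<d}"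
    using ex_bij_betw_finite_nat[OF finite_Basis[where ?'a='a]] by (auto simp: d_def atLeast0LessThan)
  define v where "v b t = 2 * schoenberg_coord d (e b) t - 1" for b t
  \<comment> \<open>\<open>u / (1 - \<bar>u\<bar>)\<close> stretches \<open>(-1, 1)\<close> to the line; the truncation, needed for continuity, is
    harmless for large \<open>t\<close>, and those suffice because \<open>v b\<close> is periodic.\<close>
  define \<Psi> where "\<Psi> t = (\<Sum>b\<in>Basis. (v b t / max (1 - \<bar>v b t\<bar>) (1 / (1 + \<bar>t\<bar>))) *\<^sub>R b)" for t :: real
  have pos: "max u (1 / (1 + \<bar>t\<bar>)) > 0" for u t :: real
    by (rule less_le_trans[OF _ max.cobounded2]) auto
  have v_cont: "continuous_on UNIV (v b)" for b
    unfolding v_def by (intro continuous_intros continuous_on_schoenberg_coord)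
  have "continuous_on UNIV \<Psi>"
    unfolding \<Psi>_def using pos
    by (intro continuous_intros v_cont ballI) (auto simp: less_imp_neq[symmetric] add_nonneg_eq_0_iff)
  moreover have "\<exists>T. cball 0 R \<subseteq> \<Psi> ` {0..T}" for R
  proof
    define n where "n = nat \<lceil>R\<rceil>"
    show "cball 0 R \<subseteq> \<Psi> ` {0..1 + 2 * real n}"
    proof
      fix x :: 'a assume "x \<in> cball 0 R"
      then have x: "norm x \<le> R" by simp
      \<comment> \<open>The inverse of the stretching
        \<open>u / (1 - \<bar>u\<bar>)\<close>.\<close>
      define w where "w y = y / (1 + \<bar>y\<bar>)" for y :: real
      have w1: "1 - \<bar>w y\<bar> = 1 / (1 + \<bar>y\<bar>)" and w2: "\<bar>w y\<bar> \<le> 1" for y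
      proof -
        have p: "0 < 1 + \<bar>y\<bar>" by linarith
        then have q: "\<bar>w y\<bar> = \<bar>y\<bar> / (1 + \<bar>y\<bar>)" by (simp add: w_def abs_divide)
        show "1 - \<bar>w y\<bar> = 1 / (1 + \<bar>y\<bar>)" "\<bar>w y\<bar> \<le> 1"
          unfolding q using p by (simp_all add: divide_simps)
      qed
      define ei where "ei = inv_into (Basis :: 'a set) e"
      have "(1 + w (x \<bullet> ei i)) / 2 \<in> {0..1}" for i
        using w2[of "x \<bullet> ei i"] by (auto simp: abs_le_iff)
      then obtain s where s: "s \<in> {0..1}"
        "\<And>i. i < d \<Longrightarrow> schoenberg_coord d i s = (1 + w (x \<bullet> ei i)) / 2"
        using schoenberg_coord_surj[of d "\<lambda>i. (1 + w (x \<bullet> ei i)) / 2"] by blast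
      \<comment> \<open>Shifting by \<open>n\<close> periods of length 2 leaves the coordinates
        unchanged and brings the time beyond \<open>R\<close>, where the truncation is
        inactive.\<close>
      define t where "t = s + 2 * real n"
      have vb: "v b t = w (x \<bullet> b)" if b: "b \<in> Basis" for b
      proof -
        have "schoenberg_coord d (e b) t = schoenberg_coord d (e b) s"
          using schoenberg_coord_periodic[of d "e b" s "int n"] by (simp add: t_def)
        moreover have "e b < d" "ei (e b) = b"
          using e b by (auto simp: bij_betw_def ei_def)
        ultimately show ?thesis
          using s(2) by (simp add: v_def)
      qed
      have "\<Psi> t = (\<Sum>b\<in>Basis. (x \<bullet> b) *\<^sub>R b)"
        unfolding \<Psi>_def
      proof (rule sum.cong[OF refl])
        fix b :: 'a assume b: "b \<in> Basis"
        have "\<bar>x \<bullet> b\<bar> \<le> R"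
          using Basis_le_norm[OF b, of x] x by linarith
        also have "R \<le> \<bar>t\<bar>"
          using s(1) by (simp add: t_def n_def) linarith
        finally have "1 / (1 + \<bar>t\<bar>) \<le> 1 / (1 + \<bar>x \<bullet> b\<bar>)"
          by (simp add: frac_le)
        then have "v b t / max (1 - \<bar>v b t\<bar>) (1 / (1 + \<bar>t\<bar>)) = w (x \<bullet> b) / (1 / (1 + \<bar>x \<bullet> b\<bar>))"
          by (simp only: vb[OF b] w1 max_absorb1)
        also have "\<dots> = x \<bullet> b"
          by (simp add: w_def add_nonneg_eq_0_iff)
        finally show "(v b t / max (1 - \<bar>v b t\<bar>) (1 / (1 + \<bar>t\<bar>))) *\<^sub>R b = (x \<bullet> b) *\<^sub>R b"
          by simp
      qed
      then have "\<Psi> t = x" by (simp add: euclidean_representation)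
      then show "x \<in> \<Psi> ` {0..1 + 2 * real n}"
        using s(1) by (intro image_eqI[of _ _ t]) (auto simp: t_def)
    qed
  qed
  ultimately show ?thesis using that by blast
qed

section \<open>Weak compactness\<close>

definition weakly_to :: "(nat \<Rightarrow> 'a::topological_space measure) \<Rightarrow> 'a measure \<Rightarrow> bool" where
  "weakly_to M L \<longleftrightarrow> (\<forall>f :: 'a \<Rightarrow> real. continuous_on UNIV f \<longrightarrow> (\<exists>B. \<forall>x. \<bar>f x\<bar> \<le> B) \<longrightarrow>
     (\<lambda>n. \<integral>x. f x \<partial>M n) \<longlonglongrightarrow> (\<integral>x. f x \<partial>L))"

lemma weakly_toD:
  fixes f :: "'a::topological_space \<Rightarrow> real"
  assumes "weakly_to M L" "continuous_on UNIV f" "\<And>x. \<bar>f x\<bar> \<le> B"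
  shows "(\<lambda>n. \<integral>x. f x \<partial>M n) \<longlonglongrightarrow> (\<integral>x. f x \<partial>L)"
  using assms unfolding weakly_to_def by blast

lemma weakly_to_subseq:
  assumes "weakly_to M L" "strict_mono r"
  shows "weakly_to (\<lambda>n. M (r n)) L"
  unfolding weakly_to_def
proof (intro allI impI)
  fix f :: "'a \<Rightarrow> real" assume "continuous_on UNIV f" "\<exists>B. \<forall>x. \<bar>f x\<bar> \<le> B"
  then have "(\<lambda>n. \<integral>x. f x \<partial>M n) \<longlonglongrightarrow> (\<integral>x. f x \<partial>L)"
    using assms(1) by (simp add: weakly_to_def)
  then show "(\<lambda>n. \<integral>x. f x \<partial>M (r n)) \<longlonglongrightarrow> (\<integral>x. f x \<partial>L)"
    using LIMSEQ_subseq_LIMSEQ[OF _ assms(2)] by (simp add: comp_def)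
qed

text \<open>The section is the first time at which the curve visits \<open>x\<close>. Its sublevel
  sets are images of compact intervals, hence compact, which gives measurability without a selection
  theorem; the same description of the sublevel sets translates balls into time intervals.\<close>

lemma borel_section_of_curve:
  fixes \<Psi> :: "real \<Rightarrow> 'a::euclidean_space"
  assumes cont: "continuous_on UNIV \<Psi>" and surj: "\<And>R. \<exists>T. cball 0 R \<subseteq> \<Psi> ` {0..T}"
  obtains s where "s \<in> borel_measurable borel" "\<And>x. \<Psi> (s x) = x"
    "\<And>x T. s x \<le> T \<longleftrightarrow> x \<in> \<Psi> ` {0..T}" "\<And>x. 0 \<le> s x"
proof -
  define s where "s x = Inf ({0..} \<inter> \<Psi> -` {x})" for x
  have ne: "{0..} \<inter> \<Psi> -` {x} \<noteq> {}" for x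
    using surj[of "norm x"] by (force simp: image_iff)
  have bdd: "bdd_below ({0..} \<inter> \<Psi> -` {x})" for x
    by (rule bdd_belowI[of _ 0]) auto
  have mem: "s x \<in> {0..} \<inter> \<Psi> -` {x}" for x
    unfolding s_def
    by (intro closed_contains_Inf ne bdd closed_Int closed_vimage cont) auto
  have le: "s x \<le> T \<longleftrightarrow> x \<in> \<Psi> ` {0..T}" for x T
  proof
    show "x \<in> \<Psi> ` {0..T}" if "s x \<le> T"
      using mem[of x] that by (intro image_eqI[of _ _ "s x"]) auto
    assume "x \<in> \<Psi> ` {0..T}"
    then obtain t where "0 \<le> t" "t \<le> T" "\<Psi> t = x" by auto
    moreover from this have "s x \<le> t" unfolding s_def by (intro cInf_lower bdd) auto
    ultimately show "s x \<le> T" by simp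
  qed
  have "s \<in> borel_measurable borel"
    unfolding borel_measurable_iff_le
  proof
    fix T
    have "compact (\<Psi> ` {0..T})"
      by (intro compact_continuous_image continuous_on_subset[OF cont]) auto
    then show "{x \<in> space borel. s x \<le> T} \<in> sets borel"
      by (simp add: le borel_compact)
  qed
  then show ?thesis using that[of s] mem le by auto
qed

lemma second_moment_tail:
  fixes M :: "'a::euclidean_space measure"
  assumes M: "sets M = sets borel" and "0 \<le> R"
  shows "ennreal (R\<^sup>2) * emeasure M (- cball 0 R) \<le> (\<integral>\<^sup>+x. ennreal ((norm x)\<^sup>2) \<partial>M)"
proof -
  have "ennreal (R\<^sup>2) * emeasure M (- cball 0 R) = (\<integral>\<^sup>+x. ennreal (R\<^sup>2) * indicator (- cball 0 R) x \<partial>M)"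
    by (rule nn_integral_cmult_indicator[symmetric]) (simp add: M)
  also have "\<dots> \<le> (\<integral>\<^sup>+x. ennreal ((norm x)\<^sup>2) \<partial>M)"
    using \<open>0 \<le> R\<close> by (intro nn_integral_mono) (auto simp: indicator_def intro!: ennreal_leI power_mono)
  finally show ?thesis .
qed

text \<open>A space-filling curve transports Helly's theorem from the line to higher dimensions.\<close>

lemma prob_subsequence_weakly_to:
  fixes M :: "nat \<Rightarrow> 'a::euclidean_space measure"
  assumes prob: "\<And>n. prob_space (M n)" and sets_M: "\<And>n. sets (M n) = sets borel"
    and moment: "\<And>n. (\<integral>\<^sup>+x. ennreal ((norm x)\<^sup>2) \<partial>M n) \<le> ennreal C"
  obtains r L where "strict_mono (r :: nat \<Rightarrow> nat)" "prob_space L" "sets L = sets borel"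
    "weakly_to (\<lambda>n. M (r n)) L"
proof -
  obtain \<Psi> :: "real \<Rightarrow> 'a" where \<Psi>: "continuous_on UNIV \<Psi>" "\<And>R. \<exists>T. cball 0 R \<subseteq> \<Psi> ` {0..T}"
    by (rule space_filling_curve) (rule that)
  obtain s where s: "s \<in> borel_measurable borel" "\<And>x. \<Psi> (s x) = x"
    "\<And>x T. s x \<le> T \<longleftrightarrow> x \<in> \<Psi> ` {0..T}" "\<And>x. 0 \<le> s x"
    by (rule borel_section_of_curve[OF \<Psi>]) (rule that)
  have sM: "s \<in> borel_measurable (M n)" for n
    using s(1) by (simp cong: measurable_cong_sets add: sets_M)
  have spM: "space (M n) = UNIV" for n
    using sets_eq_imp_space_eq[OF sets_M] by simp
  have \<Psi>m: "\<Psi> \<in> borel_measurable borel"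
    using \<Psi>(1) by (rule borel_measurable_continuous_onI)
  define N where "N n = distr (M n) borel s" for n
  have "tight N"
    unfolding tight_def
  proof (intro conjI allI impI)
    show "real_distribution (N n)" for n
      unfolding N_def by (rule prob_space.real_distribution_distr[OF prob sM])
    fix \<epsilon> :: real assume "0 < \<epsilon>"
    \<comment> \<open>The mass outside the ball is at most \<open>\<bar>C\<bar> / R\<^sup>2\<close>,
      and the added 1 makes this strictly less than \<epsilon>. The absolute value covers negative
      \<open>C\<close>, where \<open>ennreal C\<close> is 0.\<close>
    define R where "R = sqrt (\<bar>C\<bar> / \<epsilon> + 1)"
    have R: "R\<^sup>2 = \<bar>C\<bar> / \<epsilon> + 1" "0 < R"
      using \<open>0 < \<epsilon>\<close> by (auto simp: R_def add_nonneg_pos)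
    obtain T where T: "cball 0 R \<subseteq> \<Psi> ` {0..T}" using \<Psi>(2) by blast
    \<comment> \<open>The intervals in \<open>tight\<close> are open on the left, so the nonnegative
      values of \<open>s\<close> need a left end below 0; \<open>max T 0\<close> keeps the interval
      nonempty.\<close>
    have "1 - \<epsilon> < measure (N n) {-1<..max T 0}" for n
    proof -
      interpret prob_space "M n" by (rule prob)
      have "ennreal (R\<^sup>2) * emeasure (M n) (- cball 0 R) \<le> ennreal C"
        using second_moment_tail[OF sets_M[of n], of R] moment[of n] R(2) by simp
      also have "\<dots> \<le> ennreal \<bar>C\<bar>"
        by (intro ennreal_leI) simp
      finally have "R\<^sup>2 * prob (- cball 0 R) \<le> \<bar>C\<bar>"
        by (simp add: emeasure_eq_measure ennreal_mult[symmetric])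
      then have "prob (- cball 0 R) \<le> \<bar>C\<bar> / R\<^sup>2"
        using R(2) by (simp add: field_simps)
      also have "\<dots> < \<epsilon>"
        using \<open>0 < \<epsilon>\<close> by (simp add: R(1) field_simps add_nonneg_pos)
      finally have "1 - \<epsilon> < prob (cball 0 R)"
        using prob_compl[of "- cball 0 R"] by (simp add: spM sets_M Compl_eq_Diff_UNIV[symmetric])
      also have "\<dots> \<le> prob (s -` {-1<..max T 0} \<inter> space (M n))"
      proof (rule finite_measure_mono)
        show "cball 0 R \<subseteq> s -` {- 1<..max T 0} \<inter> space (M n)"
        proof
          fix x :: 'a assume "x \<in> cball 0 R"
          then have "s x \<le> T" using T s(3) by auto
          then show "x \<in> s -` {- 1<..max T 0} \<inter> space (M n)"
            using s(4)[of x] by (simp add: spM)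
        qed
        show "s -` {- 1<..max T 0} \<inter> space (M n) \<in> events"
          using sM[of n] by (rule measurable_sets) simp
      qed
      also have "\<dots> = measure (N n) {-1<..max T 0}"
        unfolding N_def by (rule measure_distr[symmetric]) (auto simp: sM)
      finally show ?thesis .
    qed
    then show "\<exists>a b. a < b \<and> (\<forall>n. 1 - \<epsilon> < measure (N n) {a<..b})"
      by (intro exI[of _ "-1"] exI[of _ "max T 0"]) auto
  qed
  have "strict_mono (id :: nat \<Rightarrow> nat)"
    by (simp add: strict_mono_def)
  with \<open>tight N\<close> obtain r L' where r: "strict_mono (r :: nat \<Rightarrow> nat)" and L': "real_distribution L'"
    and conv: "weak_conv_m (N \<circ> id \<circ> r) L'"
    using tight_imp_convergent_subsubsequence by blast
  interpret L': real_distribution L' by (rule L')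
  have dist: "real_distribution ((N \<circ> id \<circ> r) n)" for n
    using \<open>tight N\<close> by (simp add: tight_def)
  \<comment> \<open>The section \<open>s\<close> need not be continuous: it acts only before the
    limit, where \<Psi> cancels it. Only the composition of \<open>f\<close> with the continuous
    \<Psi> is tested in the limit.\<close>
  define L where "L = distr L' borel \<Psi>"
  have "prob_space L"
    unfolding L_def by (rule L'.prob_space_distr) (simp add: \<Psi>m)
  moreover have "weakly_to (\<lambda>n. M (r n)) L"
    unfolding weakly_to_def
  proof (intro allI impI)
    fix f :: "'a \<Rightarrow> real" assume f: "continuous_on UNIV f" and "\<exists>B. \<forall>x. \<bar>f x\<bar> \<le> B"
    then obtain B where B: "\<And>x. \<bar>f x\<bar> \<le> B" by blast
    have fm: "f \<in> borel_measurable borel"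
      using f by (rule borel_measurable_continuous_onI)
    have cont: "continuous_on UNIV (\<lambda>t. f (\<Psi> t))"
      by (rule continuous_on_compose2[OF f \<Psi>(1)]) auto
    have "(\<lambda>n. integral\<^sup>L ((N \<circ> id \<circ> r) n) (\<lambda>t. f (\<Psi> t))) \<longlonglongrightarrow> integral\<^sup>L L' (\<lambda>t. f (\<Psi> t))"
      by (rule weak_conv_imp_integral_bdd_continuous_conv[OF dist L' conv])
        (use B cont in \<open>auto simp: continuous_on_eq_continuous_at\<close>)
    moreover have "integral\<^sup>L ((N \<circ> id \<circ> r) n) (\<lambda>t. f (\<Psi> t)) = integral\<^sup>L (M (r n)) f" for n
      using fm \<Psi>m by (simp add: N_def integral_distr[OF sM] s(2))
    moreover have "integral\<^sup>L L' (\<lambda>t. f (\<Psi> t)) = integral\<^sup>L L f"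
      unfolding L_def by (rule integral_distr[symmetric]) (auto simp: \<Psi>m fm)
    ultimately show "(\<lambda>n. integral\<^sup>L (M (r n)) f) \<longlonglongrightarrow> integral\<^sup>L L f"
      by simp
  qed
  ultimately show ?thesis
    using that[OF r] by (simp add: L_def)
qed


lemma finite_measure_if_total_mass:
  "total_mass M = ennreal m \<Longrightarrow> finite_measure M"
  by (rule finite_measureI) simp

lemma subsequence_weakly_to:
  fixes M :: "nat \<Rightarrow> 'a::euclidean_space measure"
  assumes "0 < m" and mass: "\<And>n. total_mass (M n) = ennreal m"
    and sets_M: "\<And>n. sets (M n) = sets borel"
    and moment: "\<And>n. (\<integral>\<^sup>+x. ennreal ((norm x)\<^sup>2) \<partial>M n) \<le> ennreal C"
  obtains r L where "strict_mono (r :: nat \<Rightarrow> nat)" "total_mass L = ennreal m" "sets L = sets borel"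
    "weakly_to (\<lambda>n. M (r n)) L"
proof -
  define P where "P n = scale_measure (ennreal (1 / m)) (M n)" for n
  have P1: "prob_space (P n)" for n
    using \<open>0 < m\<close> by (intro prob_spaceI) (simp add: P_def space_scale_measure mass ennreal_mult[symmetric])
  have P2: "sets (P n) = sets borel" for n
    by (simp add: P_def sets_M)
  have P3: "(\<integral>\<^sup>+x. ennreal ((norm x)\<^sup>2) \<partial>P n) \<le> ennreal (\<bar>C\<bar> / m)" for n
  proof -
    have "(\<integral>\<^sup>+x. ennreal ((norm x)\<^sup>2) \<partial>P n) = ennreal (1 / m) * (\<integral>\<^sup>+x. ennreal ((norm x)\<^sup>2) \<partial>M n)"
      unfolding P_def
      by (rule nn_integral_scale_measure) (simp cong: measurable_cong_sets add: sets_M)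
    also have "\<dots> \<le> ennreal (1 / m) * ennreal \<bar>C\<bar>"
      by (intro mult_left_mono order_trans[OF moment] ennreal_leI) auto
    finally show ?thesis
      using \<open>0 < m\<close> by (simp add: ennreal_mult[symmetric])
  qed
  obtain r L where r: "strict_mono (r :: nat \<Rightarrow> nat)" and L: "prob_space L" "sets L = sets borel"
    and conv: "weakly_to (\<lambda>n. P (r n)) L"
    by (rule prob_subsequence_weakly_to[OF P1 P2 P3]) (rule that)
  have scaled: "(\<integral>x. f x \<partial>scale_measure (ennreal c) K) = c * (\<integral>x. f x \<partial>K)"
    if "0 \<le> c" "f \<in> borel_measurable K" for c and f :: "'a \<Rightarrow> real" and K
  proof -
    have "scale_measure (ennreal c) K = density K (\<lambda>_. ennreal c)"
      by (rule measure_eqI) (simp_all add: emeasure_density nn_integral_cmult_indicator)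
    then show ?thesis
      using integral_density[of f K "\<lambda>_. c"] that by simp
  qed
  have "weakly_to (\<lambda>n. M (r n)) (scale_measure (ennreal m) L)"
    unfolding weakly_to_def
  proof (intro allI impI)
    fix f :: "'a \<Rightarrow> real" assume f: "continuous_on UNIV f" and "\<exists>B. \<forall>x. \<bar>f x\<bar> \<le> B"
    then obtain B where B: "\<And>x. \<bar>f x\<bar> \<le> B" by blast
    have fm: "f \<in> borel_measurable K" if "sets K = sets borel" for K
      using borel_measurable_continuous_onI[OF f] by (simp cong: measurable_cong_sets add: that)
    have "(\<lambda>n. m * (\<integral>x. f x \<partial>P (r n))) \<longlonglongrightarrow> m * (\<integral>x. f x \<partial>L)"
      by (intro tendsto_intros weakly_toD[OF conv f B])
    moreover have "m * (\<integral>x. f x \<partial>P (r n)) = (\<integral>x. f x \<partial>M (r n))" for n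
      unfolding P_def using \<open>0 < m\<close> by (subst scaled) (simp_all add: fm sets_M)
    moreover have "m * (\<integral>x. f x \<partial>L) = (\<integral>x. f x \<partial>scale_measure (ennreal m) L)"
      using \<open>0 < m\<close> by (subst scaled) (simp_all add: fm L)
    ultimately show "(\<lambda>n. \<integral>x. f x \<partial>M (r n)) \<longlonglongrightarrow> (\<integral>x. f x \<partial>scale_measure (ennreal m) L)"
      by simp
  qed
  moreover have "total_mass (scale_measure (ennreal m) L) = ennreal m"
    by (simp add: space_scale_measure prob_space.emeasure_space_1[OF L(1)])
  ultimately show ?thesis
    using L(2) by (intro that[OF r, of "scale_measure (ennreal m) L"]) simp_all
qed

text \<open>Since \<open>J\<close> is finite, it suffices to refine the subsequence once for each
  index; earlier limits survive the refinement.\<close>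

lemma simultaneous_subsequence_weakly_to:
  fixes M :: "nat \<Rightarrow> 'i \<Rightarrow> 'a::euclidean_space measure"
  assumes "finite J" "0 < m"
    and mass: "\<And>n j. j \<in> J \<Longrightarrow> total_mass (M n j) = ennreal m"
    and sets_M: "\<And>n j. j \<in> J \<Longrightarrow> sets (M n j) = sets borel"
    and moment: "\<And>n j. j \<in> J \<Longrightarrow> (\<integral>\<^sup>+x. ennreal ((norm x)\<^sup>2) \<partial>M n j) \<le> ennreal C"
  shows "\<exists>r. strict_mono (r :: nat \<Rightarrow> nat) \<and> (\<forall>j\<in>J. \<exists>L. total_mass L = ennreal m \<and>
    sets L = sets borel \<and> weakly_to (\<lambda>n. M (r n) j) L)"
  using assms(1) mass sets_M moment
proof (induction J)
  case empty
  show ?case by (rule exI[of _ id]) (simp add: strict_mono_def)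
next
  case (insert i J)
  have "\<exists>r. strict_mono (r :: nat \<Rightarrow> nat) \<and> (\<forall>j\<in>J. \<exists>L. total_mass L = ennreal m \<and>
      sets L = sets borel \<and> weakly_to (\<lambda>n. M (r n) j) L)"
    by (rule insert.IH) (use insert.prems in simp_all)
  then obtain r where r: "strict_mono (r :: nat \<Rightarrow> nat)"
    and L: "\<And>j. j \<in> J \<Longrightarrow> \<exists>L. total_mass L = ennreal m \<and> sets L = sets borel \<and>
      weakly_to (\<lambda>n. M (r n) j) L"
    by blast
  have i: "total_mass (M (r n) i) = ennreal m" "sets (M (r n) i) = sets borel"
    "(\<integral>\<^sup>+x. ennreal ((norm x)\<^sup>2) \<partial>M (r n) i) \<le> ennreal C" for n
    using insert.prems by simp_all
  obtain q K where q: "strict_mono (q :: nat \<Rightarrow> nat)"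
    and K: "total_mass K = ennreal m" "sets K = sets borel" "weakly_to (\<lambda>n. M (r (q n)) i) K"
    by (rule subsequence_weakly_to[OF \<open>0 < m\<close>, of "\<lambda>n. M (r n) i", OF i]) (rule that)
  show ?case
  proof (rule exI[of _ "\<lambda>n. r (q n)"], intro conjI ballI)
    show "strict_mono (\<lambda>n. r (q n))"
      using r q by (simp add: strict_mono_def)
    fix j assume "j \<in> insert i J"
    then consider "j = i" | "j \<in> J" by blast
    then show "\<exists>L. total_mass L = ennreal m \<and> sets L = sets borel \<and> weakly_to (\<lambda>n. M (r (q n)) j) L"
    proof cases
      case 1
      then show ?thesis using K by blast
    next
      case 2
      then obtain L' where "total_mass L' = ennreal m" "sets L' = sets borel"
        and "weakly_to (\<lambda>n. M (r n) j) L'"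
        using L by blast
      then show ?thesis
        using weakly_to_subseq[of "\<lambda>n. M (r n) j", OF _ q] by blast
    qed
  qed
qed

section \<open>Integrals and inequalities under weak limits\<close>

lemma weakly_to_nn_integral:
  fixes f :: "'a::topological_space \<Rightarrow> real"
  assumes conv: "weakly_to M L" and f: "continuous_on UNIV f" and B: "\<And>x. 0 \<le> f x" "\<And>x. f x \<le> B"
    and M: "\<And>n. finite_measure (M n)" "\<And>n. sets (M n) = sets borel"
    and L: "finite_measure L" "sets L = sets borel"
  shows "(\<lambda>n. \<integral>\<^sup>+x. ennreal (f x) \<partial>M n) \<longlonglongrightarrow> (\<integral>\<^sup>+x. ennreal (f x) \<partial>L)"
proof -
  have "(\<integral>\<^sup>+x. ennreal (f x) \<partial>K) = ennreal (\<integral>x. f x \<partial>K)"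
    if "finite_measure K" "sets K = sets borel" for K
  proof (rule nn_integral_eq_integral)
    show "integrable K f"
    proof (rule finite_measure.integrable_const_bound[OF that(1)])
      show "AE x in K. norm (f x) \<le> B" using B by simp
      show "f \<in> borel_measurable K"
        using borel_measurable_continuous_onI[OF f] by (simp cong: measurable_cong_sets add: that)
    qed
  qed (use B in simp)
  moreover have "(\<lambda>n. ennreal (\<integral>x. f x \<partial>M n)) \<longlonglongrightarrow> ennreal (\<integral>x. f x \<partial>L)"
    by (intro tendsto_ennrealI weakly_toD[OF conv f, of B]) (use B in auto)
  ultimately show ?thesis
    using M L by simp
qed

text \<open>The truncations at height \<open>k\<close> are bounded and pass to the limit; they
  increase to \<open>f\<close>. Applied to the unbounded quadratic cost, this is its lower
  semicontinuity.\<close>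

lemma weakly_to_liminf:
  fixes f :: "'a::topological_space \<Rightarrow> real"
  assumes conv: "weakly_to M L" and f: "continuous_on UNIV f" and f0: "\<And>x. 0 \<le> f x"
    and M: "\<And>n. finite_measure (M n)" "\<And>n. sets (M n) = sets borel"
    and L: "finite_measure L" "sets L = sets borel"
  shows "(\<integral>\<^sup>+x. ennreal (f x) \<partial>L) \<le> liminf (\<lambda>n. \<integral>\<^sup>+x. ennreal (f x) \<partial>M n)"
proof -
  have fm: "f \<in> borel_measurable L"
    using borel_measurable_continuous_onI[OF f] by (simp cong: measurable_cong_sets add: L)
  have sup: "(SUP k. ennreal (min (f x) (real k))) = ennreal (f x)" for x
  proof (rule antisym)
    obtain k :: nat where "f x \<le> real k" using real_arch_simple by blast
    then show "ennreal (f x) \<le> (SUP k. ennreal (min (f x) (real k)))"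
      by (intro SUP_upper2[of k]) auto
  qed (auto intro!: SUP_least ennreal_leI)
  have "(\<integral>\<^sup>+x. ennreal (f x) \<partial>L) = (\<integral>\<^sup>+x. (SUP k. ennreal (min (f x) (real k))) \<partial>L)"
    by (simp add: sup)
  also have "\<dots> = (SUP k. \<integral>\<^sup>+x. ennreal (min (f x) (real k)) \<partial>L)"
    by (rule nn_integral_monotone_convergence_SUP)
      (use fm in \<open>auto simp: incseq_def le_fun_def intro!: ennreal_leI\<close>)
  also have "\<dots> \<le> liminf (\<lambda>n. \<integral>\<^sup>+x. ennreal (f x) \<partial>M n)"
  proof (rule SUP_least)
    fix k
    have "(\<lambda>n. \<integral>\<^sup>+x. ennreal (min (f x) (real k)) \<partial>M n) \<longlonglongrightarrow> (\<integral>\<^sup>+x. ennreal (min (f x) (real k)) \<partial>L)"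
      by (rule weakly_to_nn_integral[OF conv _ _ _ M L, where B="real k"])
        (use f0 in \<open>auto intro!: continuous_intros f\<close>)
    then have "(\<integral>\<^sup>+x. ennreal (min (f x) (real k)) \<partial>L) = liminf (\<lambda>n. \<integral>\<^sup>+x. ennreal (min (f x) (real k)) \<partial>M n)"
      using lim_imp_Liminf[of sequentially] by (metis trivial_limit_sequentially)
    also have "\<dots> \<le> liminf (\<lambda>n. \<integral>\<^sup>+x. ennreal (f x) \<partial>M n)"
      by (intro Liminf_mono always_eventually allI nn_integral_mono ennreal_leI) simp
    finally show "(\<integral>\<^sup>+x. ennreal (min (f x) (real k)) \<partial>L) \<le> liminf (\<lambda>n. \<integral>\<^sup>+x. ennreal (f x) \<partial>M n)" .
  qed
  finally show ?thesis .
qed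

text \<open>The indicator of a compact set is a decreasing limit of continuous functions built from
  the distance to the set; inner regularity extends the comparison from compact sets to Borel
  sets.\<close>

lemma emeasure_le_if_nn_integral_continuous_le:
  fixes A B :: "'a::{second_countable_topology, complete_space} measure"
  assumes A: "finite_measure A" "sets A = sets borel" and B: "finite_measure B" "sets B = sets borel"
    and le: "\<And>f :: 'a \<Rightarrow> real. continuous_on UNIV f \<Longrightarrow> (\<And>x. 0 \<le> f x) \<Longrightarrow> (\<And>x. f x \<le> 1) \<Longrightarrow>
      (\<integral>\<^sup>+x. ennreal (f x) \<partial>A) \<le> (\<integral>\<^sup>+x. ennreal (f x) \<partial>B)"
    and E: "E \<in> sets borel"
  shows "emeasure A E \<le> emeasure B E"
proof -
  have K: "emeasure A K \<le> emeasure B K" if K: "compact K" for K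
  proof (cases "K = {}")
    \<comment> \<open>The empty set is split off because \<open>infdist\<close> to it is 0 by
      convention, so the functions below would be constantly 1.\<close>
    case False
    define f where "f k x = max 0 (1 - real k * infdist x K)" for k x
    have fc: "continuous_on UNIV (f k)" for k
      unfolding f_def by (intro continuous_intros)
    have f01: "0 \<le> f k x" "f k x \<le> 1" for k x
      by (auto simp: f_def infdist_nonneg)
    have fK: "f k x = 1" if "x \<in> K" for k x
      using that by (simp add: f_def)
    have inf: "(INF k. ennreal (f k x)) = indicator K x" for x
    proof (cases "x \<in> K")
      case True then show ?thesis by (simp add: fK)
    next
      case x: False
      then have "0 < infdist x K"
        using compact_imp_closed[OF K] False by (simp add: infdist_pos_not_in_closed)
      then obtain k :: nat where "1 < real k * infdist x K"
        using reals_Archimedean3 by blast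
      then have "f k x = 0" by (simp add: f_def)
      then have "(INF k. ennreal (f k x)) \<le> 0"
        by (intro INF_lower2[of k]) auto
      then show ?thesis using x by simp
    qed
    have lim: "emeasure M K = (INF k. \<integral>\<^sup>+x. ennreal (f k x) \<partial>M)"
      if M: "finite_measure M" "sets M = sets borel" for M
    proof -
      have fm: "f k \<in> borel_measurable M" for k
        using borel_measurable_continuous_onI[OF fc] by (simp cong: measurable_cong_sets add: M)
      have "emeasure M K = (\<integral>\<^sup>+x. indicator K x \<partial>M)"
        using K by (simp add: M borel_compact)
      also have "\<dots> = (\<integral>\<^sup>+x. (INF k. ennreal (f k x)) \<partial>M)"
        by (simp add: inf)
      also have "\<dots> = (INF k. \<integral>\<^sup>+x. ennreal (f k x) \<partial>M)"
      proof (rule nn_integral_monotone_convergence_INF_decseq)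
        show "decseq (\<lambda>k x. ennreal (f k x))"
        proof (intro decseq_SucI le_funI ennreal_leI)
          fix k x
          have "real k * infdist x K \<le> real (Suc k) * infdist x K"
            by (intro mult_right_mono infdist_nonneg) simp
          then show "f (Suc k) x \<le> f k x"
            unfolding f_def by (intro max.mono) auto
        qed
        have "(\<integral>\<^sup>+x. ennreal (f 0 x) \<partial>M) \<le> (\<integral>\<^sup>+x. 1 \<partial>M)"
          by (intro nn_integral_mono) (simp add: f01)
        also have "\<dots> < \<infinity>"
          using finite_measure.emeasure_finite[OF M(1), of "space M"] by (simp add: less_top)
        finally show "(\<integral>\<^sup>+x. ennreal (f 0 x) \<partial>M) < \<infinity>" .
      qed (use fm in measurable)
      finally show ?thesis .
    qed
    show ?thesis
      unfolding lim[OF A] lim[OF B] by (intro INF_mono' le fc f01)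
  qed simp
  have "emeasure A E = (SUP K\<in>{K. K \<subseteq> E \<and> compact K}. emeasure A K)"
    by (rule inner_regular[OF A(2) _ E]) (use finite_measure.emeasure_finite[OF A(1)] in simp)
  also have "\<dots> \<le> emeasure B E"
    using E B by (intro SUP_least order_trans[OF K emeasure_mono]) auto
  finally show ?thesis .
qed

section \<open>Optimal partial plans\<close>

definition transport_cost :: "('a::euclidean_space \<times> 'a) measure \<Rightarrow> ennreal" where
  "transport_cost \<gamma> = (\<integral>\<^sup>+z. ennreal ((norm (fst z - snd z))\<^sup>2) \<partial>\<gamma>)"

definition mass_plans ::
  "real \<Rightarrow> (real^'n) measure \<Rightarrow> (real^'n) measure \<Rightarrow> ((real^'n) \<times> (real^'n)) measure set" where
  "mass_plans m \<mu> \<nu> = {\<gamma> \<in> partial_plans \<mu> \<nu>. total_mass \<gamma> = ennreal m}"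

lemma MK2_sq_eq_INF: "MK2_sq m \<mu> \<nu> = (INF \<gamma>\<in>mass_plans m \<mu> \<nu>. transport_cost \<gamma>)"
  by (simp add: MK2_sq_def mass_plans_def transport_cost_def case_prod_beta')

lemma sets_borel_space: "sets M = sets borel \<Longrightarrow> space M = UNIV"
  using sets_eq_imp_space_eq[of M borel] by simp

lemma measurable_if_sets_borel:
  "sets M = sets borel \<Longrightarrow> f \<in> borel \<rightarrow>\<^sub>M N \<Longrightarrow> f \<in> M \<rightarrow>\<^sub>M N"
  by (simp cong: measurable_cong_sets)

lemma vimage_fst_borel: "E \<in> sets borel \<Longrightarrow> (fst -` E :: ('a::topological_space \<times> 'b::topological_space) set) \<in> sets borel"
  and vimage_snd_borel: "F \<in> sets borel \<Longrightarrow> (snd -` F :: ('a::topological_space \<times> 'b::topological_space) set) \<in> sets borel"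
  using measurable_sets[OF borel_measurable_continuous_onI[OF continuous_on_fst[OF continuous_on_id]], of E]
    measurable_sets[OF borel_measurable_continuous_onI[OF continuous_on_snd[OF continuous_on_id]], of F]
  by simp_all

lemma fst_borel_measurable: "(fst :: 'a::topological_space \<times> 'b::topological_space \<Rightarrow> 'a) \<in> borel_measurable borel"
  and snd_borel_measurable: "(snd :: 'a::topological_space \<times> 'b::topological_space \<Rightarrow> 'b) \<in> borel_measurable borel"
  by (intro borel_measurable_continuous_onI continuous_intros)+

lemma emeasure_distr_fst:
  "sets \<gamma> = sets borel \<Longrightarrow> E \<in> sets borel \<Longrightarrow> emeasure (distr \<gamma> borel fst) E = emeasure \<gamma> (fst -` E)"
  and emeasure_distr_snd:
  "sets \<gamma> = sets borel \<Longrightarrow> F \<in> sets borel \<Longrightarrow> emeasure (distr \<gamma> borel snd) F = emeasure \<gamma> (snd -` F)"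
  by (simp_all add: emeasure_distr measurable_if_sets_borel fst_borel_measurable snd_borel_measurable sets_borel_space)

text \<open>A plan of mass \<open>m\<close> whose second marginal lies below a measure of the same
  mass exhausts it. Hence only the first marginal is genuinely partial.\<close>

lemma mass_plans_iff:
  assumes \<nu>: "\<nu> \<in> measures_of_mass m"
  shows "\<gamma> \<in> mass_plans m \<mu> \<nu> \<longleftrightarrow> sets \<gamma> = sets borel \<and>
    (\<forall>E\<in>sets borel. emeasure \<gamma> (fst -` E) \<le> emeasure \<mu> E) \<and> (\<forall>E\<in>sets borel. emeasure \<gamma> (snd -` E) = emeasure \<nu> E)"
    (is "?L \<longleftrightarrow> ?R")
proof
  have \<nu>': "sets \<nu> = sets borel" "emeasure \<nu> UNIV = ennreal m"
    using \<nu> sets_borel_space[of \<nu>] by (auto simp: measures_of_mass_def finite_second_moment_def)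
  assume ?L
  then have \<gamma>: "sets \<gamma> = sets borel" "total_mass \<gamma> = ennreal m"
    and fs: "\<forall>E\<in>sets borel. emeasure (distr \<gamma> borel fst) E \<le> emeasure \<mu> E"
    and sn: "\<forall>E\<in>sets borel. emeasure (distr \<gamma> borel snd) E \<le> emeasure \<nu> E"
    by (auto simp: mass_plans_def partial_plans_def)
  have mass: "emeasure \<gamma> UNIV = ennreal m"
    using \<gamma> by (simp add: sets_borel_space)
  have "distr \<gamma> borel snd = \<nu>"
    by (rule measure_eqI_if_le) (use sn \<nu>' mass \<gamma>(1) in
      \<open>simp_all add: sets_borel_space emeasure_distr_snd[of \<gamma> UNIV, simplified]\<close>)
  then have "emeasure \<gamma> (snd -` E) = emeasure \<nu> E" if "E \<in> sets borel" for E
    using emeasure_distr_snd[OF \<gamma>(1) that] by simp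
  with fs \<gamma>(1) show ?R by (simp add: emeasure_distr_fst)
next
  have \<nu>': "sets \<nu> = sets borel" "emeasure \<nu> UNIV = ennreal m"
    using \<nu> sets_borel_space[of \<nu>] by (auto simp: measures_of_mass_def finite_second_moment_def)
  assume R: ?R
  then have "emeasure \<gamma> (snd -` UNIV) = ennreal m" using \<nu>'(2) by (metis sets.top space_borel)
  with R show ?L
    by (simp add: mass_plans_def partial_plans_def emeasure_distr_fst emeasure_distr_snd sets_borel_space)
qed

lemma MK2_sq_le: "\<gamma> \<in> mass_plans m \<mu> \<nu> \<Longrightarrow> MK2_sq m \<mu> \<nu> \<le> transport_cost \<gamma>"
  unfolding MK2_sq_eq_INF by (rule INF_lower)

section \<open>Perturbations of optimal plans\<close>

lemma cost_borel_measurable: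
  "(\<lambda>z :: 'a::euclidean_space \<times> 'a. ennreal ((norm (fst z - snd z))\<^sup>2)) \<in> borel_measurable borel"
  by (intro measurable_compose[OF _ measurable_ennreal] borel_measurable_continuous_onI continuous_intros)

text \<open>The competitor is \<open>\<gamma> - \<sigma> + \<tau>\<close> with \<open>\<sigma> = density \<gamma> u\<close>.\<close>

lemma perturbed_plan_cost:
  fixes \<gamma> :: "((real^'n) \<times> (real^'n)) measure"
  assumes \<nu>: "\<nu> \<in> measures_of_mass m" and \<gamma>: "\<gamma> \<in> mass_plans m \<mu> \<nu>"
    and opt: "transport_cost \<gamma> = MK2_sq m \<mu> \<nu>" and fin: "transport_cost \<gamma> < \<infinity>"
    and u: "u \<in> borel_measurable borel" "\<And>z. u z \<le> 1" and \<tau>: "sets \<tau> = sets borel"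
    and snd_eq: "\<And>E. E \<in> sets borel \<Longrightarrow> emeasure \<tau> (snd -` E) = emeasure (density \<gamma> u) (snd -` E)"
    and fst_le: "\<And>E. E \<in> sets borel \<Longrightarrow>
      emeasure \<tau> (fst -` E) + emeasure \<gamma> (fst -` E) \<le> emeasure (density \<gamma> u) (fst -` E) + emeasure \<mu> E"
  shows "transport_cost (density \<gamma> u) \<le> transport_cost \<tau>"
proof -
  have \<gamma>': "sets \<gamma> = sets borel" "\<And>E. E \<in> sets borel \<Longrightarrow> emeasure \<gamma> (fst -` E) \<le> emeasure \<mu> E"
    "\<And>E. E \<in> sets borel \<Longrightarrow> emeasure \<gamma> (snd -` E) = emeasure \<nu> E"
    using \<gamma> mass_plans_iff[OF \<nu>] by auto
  have mass: "emeasure \<gamma> UNIV = ennreal m"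
    using \<gamma> \<gamma>'(1) sets_borel_space[of \<gamma>] by (simp add: mass_plans_def)
  \<comment> \<open>The density of the mass that stays in place; \<open>u z \<le> 1\<close> makes
    the truncating difference a true complement.\<close>
  define u' where "u' z = 1 - u z" for z
  have u': "u' \<in> borel_measurable borel" "\<And>z. u' z + u z = 1"
    unfolding u'_def using u by (auto intro!: borel_measurable_minus_ennreal diff_add_cancel_ennreal)
  have um: "u \<in> borel_measurable \<gamma>" "u' \<in> borel_measurable \<gamma>"
    using u(1) u'(1) \<gamma>'(1) by (auto intro: measurable_if_sets_borel)
  define \<gamma>n where "\<gamma>n = add_measure (density \<gamma> u') \<tau>"
  have sets_n: "sets \<gamma>n = sets borel" by (simp add: \<gamma>n_def \<gamma>'(1))
  have split: "emeasure (density \<gamma> u') A + emeasure (density \<gamma> u) A = emeasure \<gamma> A" if "A \<in> sets borel" for A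
  proof -
    have A: "A \<in> sets \<gamma>" using that \<gamma>'(1) by simp
    then have "emeasure (density \<gamma> u') A + emeasure (density \<gamma> u) A =
        (\<integral>\<^sup>+z. u' z * indicator A z + u z * indicator A z \<partial>\<gamma>)"
      using um by (simp add: emeasure_density nn_integral_add)
    also have "\<dots> = (\<integral>\<^sup>+z. indicator A z \<partial>\<gamma>)"
      by (simp add: distrib_right[symmetric] u'(2))
    finally show ?thesis using A by simp
  qed
  \<comment> \<open>Written additively, since subtraction in \<open>ennreal\<close> truncates; the
    finite removed measure is cancelled afterwards.\<close>
  have em: "emeasure \<gamma>n A + emeasure (density \<gamma> u) A = emeasure \<gamma> A + emeasure \<tau> A" if "A \<in> sets borel" for A
    using split[OF that] by (simp add: \<gamma>n_def emeasure_add_measure \<tau> \<gamma>'(1) ac_simps)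
  have \<sigma>_fin: "emeasure (density \<gamma> u) A \<noteq> \<infinity>" if "A \<in> sets borel" for A
  proof -
    have "emeasure (density \<gamma> u) A \<le> emeasure \<gamma> A"
      using split[OF that] by (metis add.commute le_iff_add)
    also have "\<dots> \<le> emeasure \<gamma> UNIV" by (rule emeasure_mono) (auto simp: \<gamma>'(1))
    finally show ?thesis using mass by (auto simp: top_unique)
  qed
  have "\<gamma>n \<in> mass_plans m \<mu> \<nu>"
    unfolding mass_plans_iff[OF \<nu>]
  proof (intro conjI ballI sets_n)
    fix E :: "(real^'n) set" assume E: "E \<in> sets borel"
    have "emeasure (density \<gamma> u) (fst -` E) + emeasure \<gamma>n (fst -` E) \<le> emeasure (density \<gamma> u) (fst -` E) + emeasure \<mu> E"
      using fst_le[OF E] em[OF vimage_fst_borel[OF E]] by (simp add: add.commute)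
    then show "emeasure \<gamma>n (fst -` E) \<le> emeasure \<mu> E"
      using \<sigma>_fin[OF vimage_fst_borel[OF E]] by (simp add: ennreal_add_left_cancel_le)
    have "emeasure (density \<gamma> u) (snd -` E) + emeasure \<gamma>n (snd -` E) = emeasure (density \<gamma> u) (snd -` E) + emeasure \<gamma> (snd -` E)"
      using snd_eq[OF E] em[OF vimage_snd_borel[OF E]] by (simp add: add.commute)
    then show "emeasure \<gamma>n (snd -` E) = emeasure \<nu> E"
      using \<sigma>_fin[OF vimage_snd_borel[OF E]] \<gamma>'(3)[OF E] by (simp add: ennreal_add_left_cancel)
  qed
  then have le: "transport_cost \<gamma> \<le> transport_cost \<gamma>n"
    unfolding opt by (rule MK2_sq_le)
  have cm: "(\<lambda>z. ennreal ((norm (fst z - snd z))\<^sup>2)) \<in> borel_measurable M" if "sets M = sets borel"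
    for M :: "((real^'n) \<times> (real^'n)) measure"
    using that cost_borel_measurable by (rule measurable_if_sets_borel)
  have "transport_cost (density \<gamma> u') + transport_cost (density \<gamma> u) = transport_cost \<gamma>"
  proof -
    have "transport_cost (density \<gamma> u') + transport_cost (density \<gamma> u) =
      (\<integral>\<^sup>+z. u' z * ennreal ((norm (fst z - snd z))\<^sup>2) + u z * ennreal ((norm (fst z - snd z))\<^sup>2) \<partial>\<gamma>)"
      using um cm[OF \<gamma>'(1)] by (simp add: transport_cost_def nn_integral_density nn_integral_add del: borel_measurable_ennreal_iff)
    also have "\<dots> = transport_cost \<gamma>"
      by (simp add: distrib_right[symmetric] u'(2) transport_cost_def)
    finally show ?thesis .
  qed
  moreover have "transport_cost \<gamma>n = transport_cost (density \<gamma> u') + transport_cost \<tau>"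
    unfolding transport_cost_def \<gamma>n_def by (rule nn_integral_add_measure) (simp_all add: \<tau> \<gamma>'(1) cm del: borel_measurable_ennreal_iff)
  ultimately have "transport_cost \<gamma> + transport_cost (density \<gamma> u) \<le> transport_cost \<gamma> + transport_cost \<tau>"
    using le add_right_mono[OF le, of "transport_cost (density \<gamma> u)"] by (metis (no_types, opaque_lifting) add.assoc add.commute)
  then show ?thesis
    using fin unfolding ennreal_add_left_cancel_le by (metis infinity_ennreal_def less_irrefl)
qed


lemma emeasure_density_indicator:
  "A \<in> sets M \<Longrightarrow> B \<in> sets M \<Longrightarrow> emeasure (density M (indicator A)) B = emeasure M (A \<inter> B)"
  by (simp add: emeasure_density indicator_inter_arith[symmetric])

text \<open>The product couples a piece of mass in \<open>U\<close> with one in \<open>V\<close>.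
  Its marginals are multiples of the two restrictions, so pieces of different mass can be exchanged
  without first being matched.\<close>

lemma restricted_product:
  fixes M :: "'a::second_countable_topology measure" and N :: "'b::second_countable_topology measure"
  assumes M: "finite_measure M" "sets M = sets borel" and N: "finite_measure N" "sets N = sets borel"
    and U: "U \<in> sets borel" and V: "V \<in> sets borel"
  obtains \<kappa> :: "('a \<times> 'b) measure" where "sets \<kappa> = sets borel"
    "\<And>A B. A \<in> sets borel \<Longrightarrow> B \<in> sets borel \<Longrightarrow>
      emeasure \<kappa> (A \<times> B) = emeasure M (U \<inter> A) * emeasure N (V \<inter> B)"
    "AE z in \<kappa>. z \<in> U \<times> V"
proof -
  define P where "P = density M (indicator U)"
  define Q where "Q = density N (indicator V)"
  have PQ: "sets P = sets borel" "sets Q = sets borel"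
    by (simp_all add: P_def Q_def M N)
  have emP: "emeasure P A = emeasure M (U \<inter> A)" if "A \<in> sets borel" for A
    using that U M(2) by (simp add: P_def emeasure_density_indicator)
  have emQ: "emeasure Q A = emeasure N (V \<inter> A)" if "A \<in> sets borel" for A
    using that V N(2) by (simp add: Q_def emeasure_density_indicator)
  have "finite_measure Q"
    using finite_measure.emeasure_finite[OF N(1), of "V \<inter> UNIV"] emQ[of UNIV] PQ(2)
    by (intro finite_measureI) (simp add: sets_borel_space)
  then interpret Q: sigma_finite_measure Q by (rule finite_measure.axioms(1))
  have setsPQ: "sets (P \<Otimes>\<^sub>M Q) = sets borel"
    unfolding sets_pair_measure_cong[OF PQ] borel_prod ..
  have em: "emeasure (P \<Otimes>\<^sub>M Q) (A \<times> B) = emeasure M (U \<inter> A) * emeasure N (V \<inter> B)"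
    if "A \<in> sets borel" "B \<in> sets borel" for A B
    using that by (subst Q.emeasure_pair_measure_Times) (simp_all add: PQ emP emQ)
  have "AE z in P \<Otimes>\<^sub>M Q. z \<in> U \<times> V"
  proof (rule AE_I)
    have "- (U \<times> V) = (- U) \<times> UNIV \<union> UNIV \<times> (- V)" by auto
    then have "emeasure (P \<Otimes>\<^sub>M Q) (- (U \<times> V)) \<le> emeasure (P \<Otimes>\<^sub>M Q) ((- U) \<times> UNIV) + emeasure (P \<Otimes>\<^sub>M Q) (UNIV \<times> (- V))"
      using U V by (simp only:) (intro emeasure_subadditive; simp add: PQ)
    then show "emeasure (P \<Otimes>\<^sub>M Q) (- (U \<times> V)) = 0"
      using U V by (simp add: em)
    show "- (U \<times> V) \<in> sets (P \<Otimes>\<^sub>M Q)"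
      unfolding \<open>- (U \<times> V) = (- U) \<times> UNIV \<union> UNIV \<times> (- V)\<close> using U V by (intro sets.Un pair_measureI) (simp_all add: PQ)
  qed auto
  with that[OF setsPQ em] show ?thesis by blast
qed

text \<open>Cyclical monotonicity for two points. If exchanging the targets of \<open>z\<close> and
  \<open>z'\<close> were strictly cheaper, it would be cheaper by a uniform amount on a
  neighbourhood \<open>U \<times> V\<close>. Both neighbourhoods carry mass, so exchanging targets
  there would improve the optimal plan.\<close>

lemma support_cost_le:
  fixes \<gamma> :: "((real^'n) \<times> (real^'n)) measure"
  assumes \<nu>: "\<nu> \<in> measures_of_mass m" and \<gamma>: "\<gamma> \<in> mass_plans m \<mu> \<nu>"
    and opt: "transport_cost \<gamma> = MK2_sq m \<mu> \<nu>" and fin: "transport_cost \<gamma> < \<infinity>"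
    and z: "z \<in> support \<gamma>" and z': "z' \<in> support \<gamma>"
  shows "(norm (fst z - snd z))\<^sup>2 + (norm (fst z' - snd z'))\<^sup>2 \<le>
    (norm (fst z - snd z'))\<^sup>2 + (norm (fst z' - snd z))\<^sup>2"
proof (rule ccontr)
  define c where "c w w' = (norm (fst w - snd w'))\<^sup>2" for w w' :: "(real^'n) \<times> (real^'n)"
  assume "\<not> ?thesis"
  \<comment> \<open>Two thresholds leave a strict gap between \<alpha> and \<beta> after
    integration, where only weak inequalities survive.\<close>
  then obtain \<alpha> where \<alpha>: "c z z' + c z' z < \<alpha>" "\<alpha> < c z z + c z' z'"
    using dense[of "c z z' + c z' z" "c z z + c z' z'"] by (auto simp: c_def)
  then obtain \<beta> where \<beta>: "\<alpha> < \<beta>" "\<beta> < c z z + c z' z'" using dense by blast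
  have \<alpha>0: "0 < \<alpha>"
    using \<alpha>(1) by (rule le_less_trans[rotated]) (simp add: c_def)
  define W where "W = {p. c (fst p) (snd p) + c (snd p) (fst p) < \<alpha> \<and> \<beta> < c (fst p) (fst p) + c (snd p) (snd p)}"
  have "open W"
    unfolding W_def c_def by (intro open_Collect_conj open_Collect_less continuous_intros)
  moreover have "(z, z') \<in> W" using \<alpha> \<beta> by (simp add: W_def)
  ultimately obtain U V where UV: "open U" "open V" "(z, z') \<in> U \<times> V" "U \<times> V \<subseteq> W"
    by (rule open_prod_elim)
  have U: "U \<in> sets borel" and V: "V \<in> sets borel" using UV by auto
  have \<gamma>s: "sets \<gamma> = sets borel" and \<gamma>m: "total_mass \<gamma> = ennreal m"
    using \<gamma> by (auto simp: mass_plans_def partial_plans_def)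
  have \<gamma>f: "finite_measure \<gamma>" using finite_measure_if_total_mass[OF \<gamma>m] .
  have \<gamma>fin: "emeasure \<gamma> A < \<infinity>" for A
    using finite_measure.emeasure_finite[OF \<gamma>f, of A] by (simp add: less_top)
  have pos: "0 < emeasure \<gamma> U" "0 < emeasure \<gamma> V"
    using z z' UV by (auto simp: support_def)
  obtain \<kappa> :: "(((real^'n) \<times> (real^'n)) \<times> ((real^'n) \<times> (real^'n))) measure" where \<kappa>: "sets \<kappa> = sets borel"
    "\<And>A B. A \<in> sets borel \<Longrightarrow> B \<in> sets borel \<Longrightarrow>
      emeasure \<kappa> (A \<times> B) = emeasure \<gamma> (U \<inter> A) * emeasure \<gamma> (V \<inter> B)"
    "AE p in \<kappa>. p \<in> U \<times> V"
    by (rule restricted_product[OF \<gamma>f \<gamma>s \<gamma>f \<gamma>s U V]) (rule that)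
  obtain a where a: "emeasure \<gamma> U = ennreal a" "0 < a"
    using \<gamma>fin[of U] pos(1) by (cases "emeasure \<gamma> U" rule: ennreal_cases) auto
  obtain b where b: "emeasure \<gamma> V = ennreal b" "0 < b"
    using \<gamma>fin[of V] pos(2) by (cases "emeasure \<gamma> V" rule: ennreal_cases) auto
  \<comment> \<open>Since \<open>U\<close> and \<open>V\<close> may overlap, the removed density can
    be as large as \<epsilon> times the sum of both masses; this choice keeps it at most 1.\<close>
  define \<epsilon> where "\<epsilon> = ennreal (1 / (a + b))"
  have \<epsilon>: "0 < \<epsilon>" "\<epsilon> < \<infinity>" "\<epsilon> * (emeasure \<gamma> V + emeasure \<gamma> U) = 1"
    using a b by (auto simp: \<epsilon>_def ennreal_plus[symmetric] ennreal_mult[symmetric] simp del: ennreal_plus)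
  define u where "u w = \<epsilon> * (emeasure \<gamma> V * indicator U w + emeasure \<gamma> U * indicator V w)" for w
  \<comment> \<open>A point of the coupling is a pair of source-target pairs; the two swaps form the
    pairs with exchanged targets.\<close>
  define swap1 where "swap1 p = (fst (fst p), snd (snd p))" for p :: "((real^'n) \<times> (real^'n)) \<times> ((real^'n) \<times> (real^'n))"
  define swap2 where "swap2 p = (fst (snd p), snd (fst p))" for p :: "((real^'n) \<times> (real^'n)) \<times> ((real^'n) \<times> (real^'n))"
  have meas: "swap1 \<in> borel_measurable \<kappa>" "swap2 \<in> borel_measurable \<kappa>"
    "fst \<in> borel_measurable \<kappa>" "snd \<in> borel_measurable \<kappa>"
    unfolding swap1_def swap2_def
    by (intro measurable_if_sets_borel[OF \<kappa>(1)] borel_measurable_continuous_onI continuous_intros)+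
  define \<tau> where "\<tau> = scale_measure \<epsilon> (add_measure (distr \<kappa> borel swap1) (distr \<kappa> borel swap2))"
  define \<sigma> where "\<sigma> = scale_measure \<epsilon> (add_measure (distr \<kappa> borel fst) (distr \<kappa> borel snd))"
  have \<kappa>_fst: "emeasure \<kappa> (fst -` A) = emeasure \<gamma> (U \<inter> A) * emeasure \<gamma> V" if "A \<in> sets borel" for A
    using \<kappa>(2)[OF that, of UNIV] by (simp add: vimage_fst)
  have \<kappa>_snd: "emeasure \<kappa> (snd -` A) = emeasure \<gamma> U * emeasure \<gamma> (V \<inter> A)" if "A \<in> sets borel" for A
    using \<kappa>(2)[of UNIV, OF _ that] by (simp add: vimage_snd)
  have em_\<tau>: "emeasure \<tau> A = \<epsilon> * (emeasure \<kappa> (swap1 -` A) + emeasure \<kappa> (swap2 -` A))" if "A \<in> sets borel" for A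
    using that meas by (simp add: \<tau>_def emeasure_add_measure emeasure_distr sets_borel_space[OF \<kappa>(1)])
  have em_\<sigma>: "emeasure \<sigma> A = \<epsilon> * (emeasure \<kappa> (fst -` A) + emeasure \<kappa> (snd -` A))" if "A \<in> sets borel" for A
    using that meas by (simp add: \<sigma>_def emeasure_add_measure emeasure_distr sets_borel_space[OF \<kappa>(1)])
  have u: "u \<in> borel_measurable borel"
    using U V by (simp add: u_def[abs_def])
  have \<sigma>: "density \<gamma> u = \<sigma>"
  proof (rule measure_eqI)
    show "sets (density \<gamma> u) = sets \<sigma>" by (simp add: \<gamma>s \<sigma>_def)
    fix A assume "A \<in> sets (density \<gamma> u)"
    then have A: "A \<in> sets borel" "A \<in> sets \<gamma>" "U \<in> sets \<gamma>" "V \<in> sets \<gamma>" using \<gamma>s U V by auto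
    have "emeasure (density \<gamma> u) A = (\<integral>\<^sup>+w. \<epsilon> * (emeasure \<gamma> V * indicator (U \<inter> A) w + emeasure \<gamma> U * indicator (V \<inter> A) w) \<partial>\<gamma>)"
      using A by (subst emeasure_density[OF measurable_if_sets_borel[OF \<gamma>s u]])
        (auto simp: u_def indicator_def intro!: nn_integral_cong)
    also have "\<dots> = \<epsilon> * (emeasure \<gamma> V * emeasure \<gamma> (U \<inter> A) + emeasure \<gamma> U * emeasure \<gamma> (V \<inter> A))"
      using A by (simp add: nn_integral_cmult nn_integral_add nn_integral_cmult_indicator)
    finally show "emeasure (density \<gamma> u) A = emeasure \<sigma> A"
      using A by (simp add: em_\<sigma> \<kappa>_fst \<kappa>_snd mult.commute)
  qed
  have cm: "(\<lambda>z. ennreal ((norm (fst z - snd z))\<^sup>2)) \<in> borel_measurable M" if "sets M = sets borel"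
    for M :: "((real^'n) \<times> (real^'n)) measure"
    using that cost_borel_measurable by (rule measurable_if_sets_borel)
  have cost: "transport_cost (scale_measure \<epsilon> (add_measure (distr \<kappa> borel f) (distr \<kappa> borel g))) =
      \<epsilon> * (\<integral>\<^sup>+p. ennreal ((norm (fst (f p) - snd (f p)))\<^sup>2 + (norm (fst (g p) - snd (g p)))\<^sup>2) \<partial>\<kappa>)"
    if "f \<in> borel_measurable \<kappa>" "g \<in> borel_measurable \<kappa>" for f g
    unfolding transport_cost_def using that
    by (simp add: nn_integral_scale_measure nn_integral_add_measure cm nn_integral_distr nn_integral_add ennreal_plus
        measurable_compose[OF _ cost_borel_measurable] del: borel_measurable_ennreal_iff)
  have le: "transport_cost \<sigma> \<le> transport_cost \<tau>"
    unfolding \<sigma>[symmetric]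
  proof (rule perturbed_plan_cost[OF \<nu> \<gamma> opt fin])
    show "u \<in> borel_measurable borel" by (rule u)
    show "u w \<le> 1" for w
    proof -
      have "u w \<le> \<epsilon> * (emeasure \<gamma> V + emeasure \<gamma> U)"
        unfolding u_def by (intro mult_left_mono add_mono) (auto simp: indicator_def)
      then show ?thesis using \<epsilon> by simp
    qed
    show "sets \<tau> = sets borel" by (simp add: \<tau>_def)
    fix E :: "(real^'n) set" assume E: "E \<in> sets borel"
    note E' = vimage_fst_borel[OF E] vimage_snd_borel[OF E]
    have "swap1 -` fst -` E = fst -` fst -` E" "swap1 -` snd -` E = snd -` snd -` E"
      "swap2 -` fst -` E = snd -` fst -` E" "swap2 -` snd -` E = fst -` snd -` E"
      by (auto simp: swap1_def swap2_def)
    note swap_vimage = this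
    \<comment> \<open>The exchange only permutes the two sources and the two targets, so the
      marginals of \<tau> and \<sigma> coincide.\<close>
    have eq: "emeasure \<tau> (fst -` E) = emeasure \<sigma> (fst -` E)" "emeasure \<tau> (snd -` E) = emeasure \<sigma> (snd -` E)"
      unfolding em_\<tau>[OF E'(1)] em_\<sigma>[OF E'(1)] em_\<tau>[OF E'(2)] em_\<sigma>[OF E'(2)] swap_vimage
      by (simp_all only: add.commute)
    show "emeasure \<tau> (snd -` E) = emeasure (density \<gamma> u) (snd -` E)"
      by (simp add: \<sigma> eq)
    show "emeasure \<tau> (fst -` E) + emeasure \<gamma> (fst -` E) \<le> emeasure (density \<gamma> u) (fst -` E) + emeasure \<mu> E"
      unfolding \<sigma> eq using \<gamma> mass_plans_iff[OF \<nu>] E by (intro add_left_mono) auto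
  qed
  have UVmass: "emeasure \<kappa> (space \<kappa>) = emeasure \<gamma> U * emeasure \<gamma> V"
    using \<kappa>(2)[of UNIV UNIV] by (simp add: sets_borel_space[OF \<kappa>(1)])
  have W: "\<beta> \<le> c (fst p) (fst p) + c (snd p) (snd p)" "c (fst p) (snd p) + c (snd p) (fst p) \<le> \<alpha>"
    if "p \<in> U \<times> V" for p
    using that UV(4) by (auto simp: W_def)
  have "AE p in \<kappa>. ennreal \<beta> \<le> ennreal (c (fst p) (fst p) + c (snd p) (snd p))"
    "AE p in \<kappa>. ennreal (c (fst p) (snd p) + c (snd p) (fst p)) \<le> ennreal \<alpha>"
    using \<kappa>(3) by (eventually_elim, use W in \<open>auto intro: ennreal_leI\<close>)+
  note W_int = this[THEN nn_integral_mono_AE]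
  have "\<epsilon> * (ennreal \<beta> * (emeasure \<gamma> U * emeasure \<gamma> V)) = \<epsilon> * (\<integral>\<^sup>+p. ennreal \<beta> \<partial>\<kappa>)"
    by (simp add: UVmass)
  also have "\<dots> \<le> transport_cost \<sigma>"
    unfolding \<sigma>_def cost[OF meas(3,4)] using W_int(1) by (intro mult_left_mono) (auto simp: c_def)
  also note le
  also have "transport_cost \<tau> \<le> \<epsilon> * (\<integral>\<^sup>+p. ennreal \<alpha> \<partial>\<kappa>)"
    unfolding \<tau>_def cost[OF meas(1,2)] using W_int(2)
    by (intro mult_left_mono) (simp_all only: swap1_def swap2_def c_def fst_conv snd_conv zero_le)
  also have "\<dots> = \<epsilon> * (ennreal \<alpha> * (emeasure \<gamma> U * emeasure \<gamma> V))"
    by (simp add: UVmass)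
  finally have "ennreal \<beta> * (\<epsilon> * (emeasure \<gamma> U * emeasure \<gamma> V)) \<le> ennreal \<alpha> * (\<epsilon> * (emeasure \<gamma> U * emeasure \<gamma> V))"
    by (simp add: ac_simps)
  moreover have "0 < \<epsilon> * (emeasure \<gamma> U * emeasure \<gamma> V)" "\<epsilon> * (emeasure \<gamma> U * emeasure \<gamma> V) < \<infinity>"
    using \<epsilon> pos \<gamma>fin[of U] \<gamma>fin[of V] by (auto simp: ennreal_zero_less_mult_iff ennreal_mult_less_top)
  ultimately have "ennreal \<beta> \<le> ennreal \<alpha>"
    by (metis (no_types, lifting) ennreal_mult_le_mult_iff infinity_ennreal_def less_irrefl mult.commute not_less top_greatest)
  then show False using \<beta>(1) \<alpha>0 by (simp add: ennreal_le_iff)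
qed

text \<open>If \<open>p\<close> were strictly closer to the target of \<open>z\<close> than its
  source is, a little mass near \<open>z\<close> could be released and the same targets be served
  from the free mass near \<open>p\<close>, at lower cost.\<close>

lemma support_nearest:
  fixes \<gamma> :: "((real^'n) \<times> (real^'n)) measure"
  assumes \<nu>: "\<nu> \<in> measures_of_mass m" and \<gamma>: "\<gamma> \<in> mass_plans m \<mu> \<nu>"
    and opt: "transport_cost \<gamma> = MK2_sq m \<mu> \<nu>" and fin: "transport_cost \<gamma> < \<infinity>"
    and f: "finite_measure f" "sets f = sets borel"
      "\<And>E. E \<in> sets borel \<Longrightarrow> emeasure f E + emeasure \<gamma> (fst -` E) \<le> emeasure \<mu> E"
    and z: "z \<in> support \<gamma>" and p: "p \<in> support f"
  shows "norm (fst z - snd z) \<le> norm (p - snd z)"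
proof (rule ccontr)
  assume "\<not> ?thesis"
  then have "(norm (p - snd z))\<^sup>2 < (norm (fst z - snd z))\<^sup>2"
    by (intro power_strict_mono) auto
  then obtain \<alpha> where \<alpha>: "(norm (p - snd z))\<^sup>2 < \<alpha>" "\<alpha> < (norm (fst z - snd z))\<^sup>2"
    using dense by blast
  then obtain \<beta> where \<beta>: "\<alpha> < \<beta>" "\<beta> < (norm (fst z - snd z))\<^sup>2" using dense by blast
  have \<alpha>0: "0 < \<alpha>"
    using \<alpha>(1) by (rule le_less_trans[rotated]) simp
  define W where "W = {q :: ((real^'n) \<times> (real^'n)) \<times> (real^'n).
    (norm (snd q - snd (fst q)))\<^sup>2 < \<alpha> \<and> \<beta> < (norm (fst (fst q) - snd (fst q)))\<^sup>2}"
  have "open W"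
    unfolding W_def by (intro open_Collect_conj open_Collect_less continuous_intros)
  moreover have "(z, p) \<in> W" using \<alpha> \<beta> by (simp add: W_def)
  ultimately obtain U V where UV: "open U" "open V" "(z, p) \<in> U \<times> V" "U \<times> V \<subseteq> W"
    by (rule open_prod_elim)
  have U: "U \<in> sets borel" and V: "V \<in> sets borel" using UV by auto
  have \<gamma>s: "sets \<gamma> = sets borel" and \<gamma>m: "total_mass \<gamma> = ennreal m"
    using \<gamma> by (auto simp: mass_plans_def partial_plans_def)
  have \<gamma>f: "finite_measure \<gamma>" using finite_measure_if_total_mass[OF \<gamma>m] .
  have fin': "emeasure \<gamma> A < \<infinity>" "emeasure f B < \<infinity>" for A B
    using finite_measure.emeasure_finite[OF \<gamma>f, of A] finite_measure.emeasure_finite[OF f(1), of B]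
    by (simp_all add: less_top)
  have pos: "0 < emeasure \<gamma> U" "0 < emeasure f V"
    using z p UV by (auto simp: support_def)
  obtain \<kappa> :: "(((real^'n) \<times> (real^'n)) \<times> (real^'n)) measure" where \<kappa>: "sets \<kappa> = sets borel"
    "\<And>A B. A \<in> sets borel \<Longrightarrow> B \<in> sets borel \<Longrightarrow>
      emeasure \<kappa> (A \<times> B) = emeasure \<gamma> (U \<inter> A) * emeasure f (V \<inter> B)"
    "AE p in \<kappa>. p \<in> U \<times> V"
    by (rule restricted_product[OF \<gamma>f \<gamma>s f(1,2) U V]) (rule that)
  obtain a where a: "emeasure \<gamma> U = ennreal a" "0 < a"
    using fin'(1)[of U] pos(1) by (cases "emeasure \<gamma> U" rule: ennreal_cases) auto
  obtain b where b: "emeasure f V = ennreal b" "0 < b"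
    using fin'(2)[of V] pos(2) by (cases "emeasure f V" rule: ennreal_cases) auto
  \<comment> \<open>One factor serves two bounds: the removed density must not exceed 1, and the
    newly used mass must not exceed \<open>f\<close>.\<close>
  define \<epsilon> where "\<epsilon> = ennreal (1 / (a + b))"
  have \<epsilon>: "0 < \<epsilon>" "\<epsilon> < \<infinity>" "\<epsilon> * emeasure f V \<le> 1" "\<epsilon> * emeasure \<gamma> U \<le> 1"
    using a b by (auto simp: \<epsilon>_def ennreal_mult[symmetric])
  define u where "u w = \<epsilon> * emeasure f V * indicator U w" for w :: "(real^'n) \<times> (real^'n)"
  have u: "u \<in> borel_measurable borel"
    using U by (simp add: u_def[abs_def])
  \<comment> \<open>The target is kept and its source replaced by the point of free mass.\<close>
  define swap where "swap q = (snd q, snd (fst q))" for q :: "((real^'n) \<times> (real^'n)) \<times> (real^'n)"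
  have meas: "swap \<in> borel_measurable \<kappa>" "fst \<in> borel_measurable \<kappa>"
    unfolding swap_def
    by (intro measurable_if_sets_borel[OF \<kappa>(1)] borel_measurable_continuous_onI continuous_intros)+
  define \<tau> where "\<tau> = scale_measure \<epsilon> (distr \<kappa> borel swap)"
  define \<sigma> where "\<sigma> = scale_measure \<epsilon> (distr \<kappa> borel fst)"
  have \<kappa>_fst: "emeasure \<kappa> (fst -` A) = emeasure \<gamma> (U \<inter> A) * emeasure f V" if "A \<in> sets borel" for A
    using \<kappa>(2)[OF that, of UNIV] by (simp add: vimage_fst)
  have \<kappa>_snd: "emeasure \<kappa> (snd -` A) = emeasure \<gamma> U * emeasure f (V \<inter> A)" if "A \<in> sets borel" for A
    using \<kappa>(2)[of UNIV, OF _ that] by (simp add: vimage_snd)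
  have em_\<tau>: "emeasure \<tau> A = \<epsilon> * emeasure \<kappa> (swap -` A)" if "A \<in> sets borel" for A
    using that meas by (simp add: \<tau>_def emeasure_distr sets_borel_space[OF \<kappa>(1)])
  have em_\<sigma>: "emeasure \<sigma> A = \<epsilon> * emeasure \<kappa> (fst -` A)" if "A \<in> sets borel" for A
    using that meas by (simp add: \<sigma>_def emeasure_distr sets_borel_space[OF \<kappa>(1)])
  have \<sigma>: "density \<gamma> u = \<sigma>"
  proof (rule measure_eqI)
    show "sets (density \<gamma> u) = sets \<sigma>" by (simp add: \<gamma>s \<sigma>_def)
    fix A assume "A \<in> sets (density \<gamma> u)"
    then have A: "A \<in> sets borel" "A \<in> sets \<gamma>" "U \<in> sets \<gamma>" using \<gamma>s U by auto
    have "emeasure (density \<gamma> u) A = (\<integral>\<^sup>+w. \<epsilon> * emeasure f V * indicator (U \<inter> A) w \<partial>\<gamma>)"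
      using A by (subst emeasure_density[OF measurable_if_sets_borel[OF \<gamma>s u]])
        (auto simp: u_def indicator_def intro!: nn_integral_cong)
    also have "\<dots> = \<epsilon> * emeasure f V * emeasure \<gamma> (U \<inter> A)"
      using A by (intro nn_integral_cmult_indicator) auto
    finally show "emeasure (density \<gamma> u) A = emeasure \<sigma> A"
      using A by (simp add: em_\<sigma> \<kappa>_fst ac_simps)
  qed
  have cm: "(\<lambda>z. ennreal ((norm (fst z - snd z))\<^sup>2)) \<in> borel_measurable M" if "sets M = sets borel"
    for M :: "((real^'n) \<times> (real^'n)) measure"
    using that cost_borel_measurable by (rule measurable_if_sets_borel)
  have cost: "transport_cost (scale_measure \<epsilon> (distr \<kappa> borel h)) =
      \<epsilon> * (\<integral>\<^sup>+q. ennreal ((norm (fst (h q) - snd (h q)))\<^sup>2) \<partial>\<kappa>)"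
    if "h \<in> borel_measurable \<kappa>" for h :: "((real^'n) \<times> (real^'n)) \<times> (real^'n) \<Rightarrow> (real^'n) \<times> (real^'n)"
    unfolding transport_cost_def
    by (subst nn_integral_scale_measure[OF cm]) (simp_all add: nn_integral_distr[OF that] cm del: borel_measurable_ennreal_iff)
  have le: "transport_cost \<sigma> \<le> transport_cost \<tau>"
    unfolding \<sigma>[symmetric]
  proof (rule perturbed_plan_cost[OF \<nu> \<gamma> opt fin])
    show "u \<in> borel_measurable borel" by (rule u)
    show "u w \<le> 1" for w
      using \<epsilon>(3) by (auto simp: u_def indicator_def)
    show "sets \<tau> = sets borel" by (simp add: \<tau>_def)
    fix E :: "(real^'n) set" assume E: "E \<in> sets borel"
    note E' = vimage_fst_borel[OF E] vimage_snd_borel[OF E]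
    have sv: "swap -` fst -` E = snd -` E" "swap -` snd -` E = fst -` snd -` E"
      by (auto simp: swap_def)
    show "emeasure \<tau> (snd -` E) = emeasure (density \<gamma> u) (snd -` E)"
      unfolding \<sigma> em_\<tau>[OF E'(2)] em_\<sigma>[OF E'(2)] sv ..
    \<comment> \<open>The new sources cost at most \<open>f\<close>, which fits beside all of
      \<gamma>; the mass that is released need not be counted.\<close>
    have "emeasure \<tau> (fst -` E) = \<epsilon> * emeasure \<gamma> U * emeasure f (V \<inter> E)"
      unfolding em_\<tau>[OF E'(1)] sv \<kappa>_snd[OF E] by (simp add: mult.assoc)
    also have "\<dots> \<le> 1 * emeasure f E"
      using E f(2) \<epsilon>(4) by (intro mult_mono emeasure_mono) auto
    finally have "emeasure \<tau> (fst -` E) + emeasure \<gamma> (fst -` E) \<le> emeasure \<mu> E"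
      using f(3)[OF E] by (simp add: order_trans[OF add_right_mono])
    also have "\<dots> \<le> emeasure (density \<gamma> u) (fst -` E) + emeasure \<mu> E" by simp
    finally show "emeasure \<tau> (fst -` E) + emeasure \<gamma> (fst -` E) \<le> emeasure (density \<gamma> u) (fst -` E) + emeasure \<mu> E" .
  qed
  have UVmass: "emeasure \<kappa> (space \<kappa>) = emeasure \<gamma> U * emeasure f V"
    using \<kappa>(2)[of UNIV UNIV] by (simp add: sets_borel_space[OF \<kappa>(1)])
  have W: "\<beta> \<le> (norm (fst (fst q) - snd (fst q)))\<^sup>2" "(norm (snd q - snd (fst q)))\<^sup>2 \<le> \<alpha>"
    if "q \<in> U \<times> V" for q
    using that UV(4) by (auto simp: W_def)
  have "AE q in \<kappa>. ennreal \<beta> \<le> ennreal ((norm (fst (fst q) - snd (fst q)))\<^sup>2)"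
    "AE q in \<kappa>. ennreal ((norm (snd q - snd (fst q)))\<^sup>2) \<le> ennreal \<alpha>"
    using \<kappa>(3) by (eventually_elim, use W in \<open>auto intro: ennreal_leI\<close>)+
  note W_int = this[THEN nn_integral_mono_AE]
  have "\<epsilon> * (ennreal \<beta> * (emeasure \<gamma> U * emeasure f V)) = \<epsilon> * (\<integral>\<^sup>+q. ennreal \<beta> \<partial>\<kappa>)"
    by (simp add: UVmass)
  also have "\<dots> \<le> transport_cost \<sigma>"
    unfolding \<sigma>_def cost[OF meas(2)] using W_int(1) by (intro mult_left_mono) auto
  also note le
  also have "transport_cost \<tau> \<le> \<epsilon> * (\<integral>\<^sup>+q. ennreal \<alpha> \<partial>\<kappa>)"
    unfolding \<tau>_def cost[OF meas(1)] using W_int(2)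
    by (intro mult_left_mono) (simp_all only: swap_def fst_conv snd_conv zero_le)
  also have "\<dots> = \<epsilon> * (ennreal \<alpha> * (emeasure \<gamma> U * emeasure f V))"
    by (simp add: UVmass)
  finally have "ennreal \<beta> * (\<epsilon> * (emeasure \<gamma> U * emeasure f V)) \<le> ennreal \<alpha> * (\<epsilon> * (emeasure \<gamma> U * emeasure f V))"
    by (simp add: ac_simps)
  moreover have "0 < \<epsilon> * (emeasure \<gamma> U * emeasure f V)" "\<epsilon> * (emeasure \<gamma> U * emeasure f V) < \<infinity>"
    using \<epsilon>(1,2) pos fin'(1)[of U] fin'(2)[of V] by (auto simp: ennreal_zero_less_mult_iff ennreal_mult_less_top)
  ultimately have "ennreal \<beta> \<le> ennreal \<alpha>"
    by (metis (no_types, lifting) ennreal_mult_le_mult_iff infinity_ennreal_def less_irrefl mult.commute not_less top_greatest)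
  then show False using \<beta>(1) \<alpha>0 by (simp add: ennreal_le_iff)
qed

text \<open>Adjoining the diagonal over the unused mass keeps the support monotone.\<close>

lemma support_ae_single_valued:
  fixes \<gamma> :: "((real^'n) \<times> (real^'n)) measure"
  assumes \<nu>: "\<nu> \<in> measures_of_mass m" and \<gamma>: "\<gamma> \<in> mass_plans m \<mu> \<nu>"
    and opt: "transport_cost \<gamma> = MK2_sq m \<mu> \<nu>" and fin: "transport_cost \<gamma> < \<infinity>"
    and f: "finite_measure f" "sets f = sets borel"
      "\<And>E. E \<in> sets borel \<Longrightarrow> emeasure f E + emeasure \<gamma> (fst -` E) \<le> emeasure \<mu> E"
  obtains Z where "Z \<in> null_sets lborel"
    "\<And>x y y'. (x, y) \<in> support \<gamma> \<Longrightarrow> (x, y') \<in> support \<gamma> \<Longrightarrow> y \<noteq> y' \<Longrightarrow> x \<in> Z"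
    "\<And>x y. (x, y) \<in> support \<gamma> \<Longrightarrow> x \<in> support f \<Longrightarrow> y \<noteq> x \<Longrightarrow> x \<in> Z"
proof -
  define S where "S = support \<gamma> \<union> (\<lambda>x. (x, x)) ` support f"
  have diag: "(\<lambda>x. (x, x)) ` support f = {z. fst z = snd z} \<inter> fst -` support f"
    by force
  have S_closed: "closed S"
    unfolding S_def diag
    by (intro closed_Un closed_support closed_Int closed_Collect_eq closed_vimage continuous_intros)
  have S_mono: "(x - x') \<bullet> (y - y') \<ge> 0" if S: "(x, y) \<in> S" "(x', y') \<in> S" for x y x' y'
  proof -
    have expand: "(norm (a - b))\<^sup>2 = a \<bullet> a - 2 * (a \<bullet> b) + b \<bullet> b" for a b :: "real^'n"
      by (simp add: power2_norm_eq_inner inner_diff_left inner_diff_right inner_commute)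
    have 1: "(x - x') \<bullet> (y - y') \<ge> 0" if "(x, y) \<in> support \<gamma>" "(x', y') \<in> support \<gamma>" for x y x' y'
      using support_cost_le[OF \<nu> \<gamma> opt fin that]
      by (simp add: expand inner_diff_left inner_diff_right inner_commute)
    \<comment> \<open>Expanding the squares shows that the inner product is at least half of
      \<open>(norm (x - p))\<^sup>2\<close>.\<close>
    have 2: "(x - p) \<bullet> (y - p) \<ge> 0" if "(x, y) \<in> support \<gamma>" "p \<in> support f" for x y p
    proof -
      have "(norm (x - y))\<^sup>2 \<le> (norm (p - y))\<^sup>2"
        using support_nearest[OF \<nu> \<gamma> opt fin f that] by (intro power_mono) auto
      moreover have "0 \<le> (norm (x - p))\<^sup>2" by simp
      ultimately show ?thesis
        by (simp add: expand inner_diff_left inner_diff_right inner_commute)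
    qed
    have 3: "(p - x) \<bullet> (p - y) \<ge> 0" if "(x, y) \<in> support \<gamma>" "p \<in> support f" for x y p
      using 2[OF that] by (simp add: inner_diff_left inner_diff_right)
    show ?thesis
      using S 1 2 3 by (auto simp: S_def)
  qed
  obtain Z where "Z \<in> null_sets lborel"
    "\<And>x y y'. (x, y) \<in> S \<Longrightarrow> (x, y') \<in> S \<Longrightarrow> y \<noteq> y' \<Longrightarrow> x \<in> Z"
    by (rule closed_monotone_ae_single_valued[OF S_closed S_mono]) (assumption, assumption, rule that)
  then show ?thesis
    using that[of Z] by (auto simp: S_def)
qed

section \<open>Existence\<close>

definition fst_marginal_le :: "((real^'n) \<times> (real^'n)) measure \<Rightarrow> (real^'n) measure \<Rightarrow> bool" where
  "fst_marginal_le \<gamma> \<mu> \<longleftrightarrow> (\<forall>E\<in>sets borel. emeasure \<gamma> (fst -` E) \<le> emeasure \<mu> E)"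

lemma nn_integral_fst_le:
  assumes \<gamma>: "sets \<gamma> = sets borel" "fst_marginal_le \<gamma> \<mu>" and \<mu>: "sets \<mu> = sets borel"
    and f: "f \<in> borel_measurable borel"
  shows "(\<integral>\<^sup>+z. f (fst z) \<partial>\<gamma>) \<le> (\<integral>\<^sup>+x. f x \<partial>\<mu>)"
proof -
  have "distr \<gamma> borel fst \<le> \<mu>"
    using \<gamma>(2) by (subst le_measure) (auto simp: fst_marginal_le_def emeasure_distr_fst \<gamma>(1) \<mu>)
  then have "(\<integral>\<^sup>+x. f x \<partial>distr \<gamma> borel fst) \<le> (\<integral>\<^sup>+x. f x \<partial>\<mu>)"
    by (intro nn_integral_mono_measure) (simp_all add: \<mu>)
  then show ?thesis
    using f by (simp add: nn_integral_distr measurable_if_sets_borel[OF \<gamma>(1)] fst_borel_measurable)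
qed

lemma norm_sq_borel_measurable: "(\<lambda>x :: real^'n. ennreal ((norm x)\<^sup>2)) \<in> borel_measurable borel"
  by (intro measurable_compose[OF _ measurable_ennreal] borel_measurable_continuous_onI continuous_intros)

text \<open>Moments of a plan, and hence of its target, are controlled by the fixed \<mu> and the
  cost. This gives compactness although the targets vary along a minimizing sequence.\<close>

lemma plan_moment_bounds:
  fixes \<gamma> :: "((real^'n) \<times> (real^'n)) measure"
  assumes \<gamma>: "sets \<gamma> = sets borel" "fst_marginal_le \<gamma> \<mu>" and \<mu>: "sets \<mu> = sets borel"
  shows "(\<integral>\<^sup>+z. ennreal ((norm z)\<^sup>2) \<partial>\<gamma>) \<le> 3 * (\<integral>\<^sup>+x. ennreal ((norm x)\<^sup>2) \<partial>\<mu>) + 2 * transport_cost \<gamma>" (is ?th1)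
    and "(\<integral>\<^sup>+z. ennreal ((norm (snd z))\<^sup>2) \<partial>\<gamma>) \<le> 3 * (\<integral>\<^sup>+x. ennreal ((norm x)\<^sup>2) \<partial>\<mu>) + 2 * transport_cost \<gamma>" (is ?th2)
proof -
  have fm: "(\<lambda>z. ennreal ((norm (fst z))\<^sup>2)) \<in> borel_measurable \<gamma>"
    by (intro measurable_if_sets_borel[OF \<gamma>(1)] measurable_compose[OF fst_borel_measurable norm_sq_borel_measurable])
  have cm: "(\<lambda>z. ennreal ((norm (fst z - snd z))\<^sup>2)) \<in> borel_measurable \<gamma>"
    by (intro measurable_if_sets_borel[OF \<gamma>(1)] cost_borel_measurable)
  have le: "ennreal ((norm z)\<^sup>2) \<le> 3 * ennreal ((norm (fst z))\<^sup>2) + 2 * ennreal ((norm (fst z - snd z))\<^sup>2)"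
    "ennreal ((norm (snd z))\<^sup>2) \<le> ennreal ((norm z)\<^sup>2)"
    for z :: "(real^'n) \<times> (real^'n)"
  proof -
    have n: "(norm z)\<^sup>2 = (norm (fst z))\<^sup>2 + (norm (snd z))\<^sup>2"
      by (simp add: norm_prod_def)
    \<comment> \<open>This square is exactly the difference of the two sides of the next inequality,
      which explains the constants 3 and 2.\<close>
    have "0 \<le> (norm (2 *\<^sub>R fst z - snd z))\<^sup>2" by simp
    then have "(norm z)\<^sup>2 \<le> 3 * (norm (fst z))\<^sup>2 + 2 * (norm (fst z - snd z))\<^sup>2"
      unfolding n by (simp add: power2_norm_eq_inner inner_diff_left inner_diff_right inner_commute)
    then show "ennreal ((norm z)\<^sup>2) \<le> 3 * ennreal ((norm (fst z))\<^sup>2) + 2 * ennreal ((norm (fst z - snd z))\<^sup>2)"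
      using ennreal_leI[of "(norm z)\<^sup>2" "3 * (norm (fst z))\<^sup>2 + 2 * (norm (fst z - snd z))\<^sup>2"]
      by (simp add: ennreal_mult)
    show "ennreal ((norm (snd z))\<^sup>2) \<le> ennreal ((norm z)\<^sup>2)"
      unfolding n by (intro ennreal_leI) simp
  qed
  have "(\<integral>\<^sup>+z. ennreal ((norm z)\<^sup>2) \<partial>\<gamma>) \<le>
      (\<integral>\<^sup>+z. 3 * ennreal ((norm (fst z))\<^sup>2) + 2 * ennreal ((norm (fst z - snd z))\<^sup>2) \<partial>\<gamma>)"
    by (intro nn_integral_mono le)
  also have "\<dots> = 3 * (\<integral>\<^sup>+z. ennreal ((norm (fst z))\<^sup>2) \<partial>\<gamma>) + 2 * transport_cost \<gamma>"
    using fm cm by (simp add: nn_integral_add nn_integral_cmult transport_cost_def del: borel_measurable_ennreal_iff)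
  also have "\<dots> \<le> 3 * (\<integral>\<^sup>+x. ennreal ((norm x)\<^sup>2) \<partial>\<mu>) + 2 * transport_cost \<gamma>"
    by (intro add_right_mono mult_left_mono nn_integral_fst_le[OF \<gamma> \<mu> norm_sq_borel_measurable]) simp
  finally show ?th1 .
  then show ?th2
    by (rule order_trans[rotated]) (intro nn_integral_mono le)
qed

lemma weakly_to_fst_marginal_le:
  fixes L :: "((real^'n) \<times> (real^'n)) measure"
  assumes \<mu>: "sets \<mu> = sets borel" "finite_measure \<mu>"
    and \<gamma>: "\<And>n. sets (\<gamma> n) = sets borel" "\<And>n. finite_measure (\<gamma> n)" "\<And>n. fst_marginal_le (\<gamma> n) \<mu>"
    and L: "sets L = sets borel" "finite_measure L" and conv: "weakly_to \<gamma> L"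
  shows "fst_marginal_le L \<mu>"
proof -
  have fmL: "finite_measure (distr L borel fst)"
    by (intro finite_measure.finite_measure_distr L measurable_if_sets_borel[OF L(1)] fst_borel_measurable)
  have "emeasure (distr L borel fst) E \<le> emeasure \<mu> E" if "E \<in> sets borel" for E
  proof (rule emeasure_le_if_nn_integral_continuous_le[OF fmL _ \<mu>(2,1) _ that])
    fix f :: "real^'n \<Rightarrow> real"
    assume f: "continuous_on UNIV f" and f01: "\<And>x. 0 \<le> f x" "\<And>x. f x \<le> 1"
    have fm: "(\<lambda>x. ennreal (f x)) \<in> borel_measurable borel"
      using borel_measurable_continuous_onI[OF f] by simp
    have fst: "continuous_on UNIV (\<lambda>z :: (real^'n) \<times> (real^'n). f (fst z))"
      by (rule continuous_on_compose2[OF f]) (auto intro: continuous_intros)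
    have "(\<lambda>n. \<integral>\<^sup>+z. ennreal (f (fst z)) \<partial>\<gamma> n) \<longlonglongrightarrow> (\<integral>\<^sup>+z. ennreal (f (fst z)) \<partial>L)"
      by (rule weakly_to_nn_integral[OF conv fst f01(1) f01(2) \<gamma>(2,1) L(2,1)])
    moreover have "(\<integral>\<^sup>+z. ennreal (f (fst z)) \<partial>\<gamma> n) \<le> (\<integral>\<^sup>+x. ennreal (f x) \<partial>\<mu>)" for n
      by (rule nn_integral_fst_le[OF \<gamma>(1,3) \<mu>(1) fm])
    ultimately have "(\<integral>\<^sup>+z. ennreal (f (fst z)) \<partial>L) \<le> (\<integral>\<^sup>+x. ennreal (f x) \<partial>\<mu>)"
      by (intro LIMSEQ_le_const2) auto
    then show "(\<integral>\<^sup>+x. ennreal (f x) \<partial>distr L borel fst) \<le> (\<integral>\<^sup>+x. ennreal (f x) \<partial>\<mu>)"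
      using fm by (simp add: nn_integral_distr measurable_if_sets_borel[OF L(1)] fst_borel_measurable)
  qed simp
  then show ?thesis
    by (simp add: fst_marginal_le_def emeasure_distr_fst L(1))
qed

text \<open>Test functions of the second coordinate have equal integrals along both sequences, hence
  in the limits. A constant comparison sequence fixes a prescribed target; two varying sequences
  keep the target common to different indices.\<close>

lemma weakly_to_snd_marginal_eq:
  fixes L L' :: "((real^'n) \<times> (real^'n)) measure"
  assumes \<gamma>: "\<And>n. sets (\<gamma> n) = sets borel" "\<And>n. finite_measure (\<gamma> n)"
    and \<gamma>': "\<And>n. sets (\<gamma>' n) = sets borel" "\<And>n. finite_measure (\<gamma>' n)"
    and L: "sets L = sets borel" "finite_measure L" "weakly_to \<gamma> L"
    and L': "sets L' = sets borel" "finite_measure L'" "weakly_to \<gamma>' L'"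
    and eq: "\<And>n. distr (\<gamma> n) borel snd = distr (\<gamma>' n) borel snd"
  shows "distr L borel snd = distr L' borel snd"
proof -
  have dist: "(\<integral>\<^sup>+x. ennreal (f x) \<partial>distr K borel snd) = (\<integral>\<^sup>+z. ennreal (f (snd z)) \<partial>K)"
    if "sets K = sets borel" "continuous_on UNIV f"
    for K :: "((real^'n) \<times> (real^'n)) measure" and f :: "real^'n \<Rightarrow> real"
    using borel_measurable_continuous_onI[OF that(2)]
    by (simp add: nn_integral_distr measurable_if_sets_borel[OF that(1)] snd_borel_measurable)
  have int: "(\<integral>\<^sup>+x. ennreal (f x) \<partial>distr L borel snd) = (\<integral>\<^sup>+x. ennreal (f x) \<partial>distr L' borel snd)"
    if f: "continuous_on UNIV f" and f01: "\<And>x. 0 \<le> f x" "\<And>x. f x \<le> 1" for f :: "real^'n \<Rightarrow> real"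
  proof -
    have snd: "continuous_on UNIV (\<lambda>z :: (real^'n) \<times> (real^'n). f (snd z))"
      by (rule continuous_on_compose2[OF f]) (auto intro: continuous_intros)
    have "(\<lambda>n. \<integral>\<^sup>+z. ennreal (f (snd z)) \<partial>\<gamma> n) \<longlonglongrightarrow> (\<integral>\<^sup>+z. ennreal (f (snd z)) \<partial>L)"
      "(\<lambda>n. \<integral>\<^sup>+z. ennreal (f (snd z)) \<partial>\<gamma>' n) \<longlonglongrightarrow> (\<integral>\<^sup>+z. ennreal (f (snd z)) \<partial>L')"
      by (rule weakly_to_nn_integral[OF L(3) snd f01(1) f01(2) \<gamma>(2,1) L(2,1)],
          rule weakly_to_nn_integral[OF L'(3) snd f01(1) f01(2) \<gamma>'(2,1) L'(2,1)])
    moreover have "(\<integral>\<^sup>+z. ennreal (f (snd z)) \<partial>\<gamma> n) = (\<integral>\<^sup>+z. ennreal (f (snd z)) \<partial>\<gamma>' n)" for n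
      using eq[of n] dist[OF \<gamma>(1) f, of n] dist[OF \<gamma>'(1) f, of n] by simp
    ultimately have "(\<integral>\<^sup>+z. ennreal (f (snd z)) \<partial>L) = (\<integral>\<^sup>+z. ennreal (f (snd z)) \<partial>L')"
      using LIMSEQ_unique by simp
    then show ?thesis
      using dist[OF L(1) f] dist[OF L'(1) f] by simp
  qed
  have fm: "finite_measure (distr L borel snd)" "finite_measure (distr L' borel snd)"
    by (intro finite_measure.finite_measure_distr L L' measurable_if_sets_borel[OF L(1)]
        measurable_if_sets_borel[OF L'(1)] snd_borel_measurable)+
  show ?thesis
  proof (rule measure_eqI)
    fix E assume "E \<in> sets (distr L borel snd)"
    then have E: "E \<in> sets borel" by simp
    show "emeasure (distr L borel snd) E = emeasure (distr L' borel snd) E"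
      by (rule antisym; rule emeasure_le_if_nn_integral_continuous_le[OF _ _ _ _ _ E])
        (simp_all add: fm int)
  qed simp
qed

text \<open>The moment bounds prevent loss of mass, the constraint on the first marginal is closed
  under weak limits, and the cost can only drop.\<close>

lemma compact_plans:
  fixes \<gamma> :: "nat \<Rightarrow> 'i \<Rightarrow> ((real^'n) \<times> (real^'n)) measure"
  assumes J: "finite J" and m: "0 < m"
    and \<mu>: "\<And>j. j \<in> J \<Longrightarrow> finite_second_moment (\<mu> j)" "\<And>j. j \<in> J \<Longrightarrow> finite_measure (\<mu> j)"
    and \<gamma>: "\<And>n j. j \<in> J \<Longrightarrow> sets (\<gamma> n j) = sets borel" "\<And>n j. j \<in> J \<Longrightarrow> total_mass (\<gamma> n j) = ennreal m"
      "\<And>n j. j \<in> J \<Longrightarrow> fst_marginal_le (\<gamma> n j) (\<mu> j)"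
    and C: "\<And>n j. j \<in> J \<Longrightarrow> transport_cost (\<gamma> n j) \<le> C" "C < \<infinity>"
  shows "\<exists>r. strict_mono (r :: nat \<Rightarrow> nat) \<and> (\<forall>j\<in>J. \<exists>L. total_mass L = ennreal m \<and> sets L = sets borel \<and>
    weakly_to (\<lambda>n. \<gamma> (r n) j) L \<and> fst_marginal_le L (\<mu> j) \<and>
    transport_cost L \<le> liminf (\<lambda>n. transport_cost (\<gamma> (r n) j)))"
proof -
  have \<mu>s: "sets (\<mu> j) = sets borel" if "j \<in> J" for j
    using \<mu>(1)[OF that] by (simp add: finite_second_moment_def)
  define B where "B = (\<Sum>j\<in>J. 3 * (\<integral>\<^sup>+x. ennreal ((norm x)\<^sup>2) \<partial>\<mu> j)) + 2 * C"
  have "B < \<infinity>"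
    using \<mu>(1) C(2) by (auto simp: B_def finite_second_moment_def ennreal_mult_less_top J)
  then obtain b where b: "B = ennreal b" by (cases B rule: ennreal_cases) auto
  have moment: "(\<integral>\<^sup>+z. ennreal ((norm z)\<^sup>2) \<partial>\<gamma> n j) \<le> ennreal b" if j: "j \<in> J" for n j
  proof -
    have "(\<integral>\<^sup>+z. ennreal ((norm z)\<^sup>2) \<partial>\<gamma> n j) \<le>
        3 * (\<integral>\<^sup>+x. ennreal ((norm x)\<^sup>2) \<partial>\<mu> j) + 2 * transport_cost (\<gamma> n j)"
      using plan_moment_bounds(1)[OF \<gamma>(1)[OF j] \<gamma>(3)[OF j] \<mu>s[OF j]] .
    also have "\<dots> \<le> B"
      unfolding B_def using j J C(1)[OF j]
      by (intro add_mono mult_left_mono member_le_sum) auto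
    finally show ?thesis by (simp add: b)
  qed
  obtain r where r: "strict_mono (r :: nat \<Rightarrow> nat)"
    and L: "\<forall>j\<in>J. \<exists>L. total_mass L = ennreal m \<and> sets L = sets borel \<and> weakly_to (\<lambda>n. \<gamma> (r n) j) L"
    using simultaneous_subsequence_weakly_to[of J m \<gamma> b, OF J m \<gamma>(2) \<gamma>(1) moment] by blast
  show ?thesis
  proof (rule exI[of _ r], intro conjI r ballI)
    fix j assume j: "j \<in> J"
    then obtain L where L: "total_mass L = ennreal m" "sets L = sets borel" "weakly_to (\<lambda>n. \<gamma> (r n) j) L"
      using L by blast
    have f: "finite_measure L" "finite_measure (\<gamma> (r n) j)" for n
      using finite_measure_if_total_mass L(1) \<gamma>(2)[OF j] by blast+
    have "fst_marginal_le L (\<mu> j)"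
      by (rule weakly_to_fst_marginal_le[OF \<mu>s[OF j] \<mu>(2)[OF j] \<gamma>(1)[OF j] f(2) \<gamma>(3)[OF j] L(2) f(1) L(3)])
    moreover have "transport_cost L \<le> liminf (\<lambda>n. transport_cost (\<gamma> (r n) j))"
      unfolding transport_cost_def
      by (rule weakly_to_liminf[OF L(3) _ _ f(2) \<gamma>(1)[OF j] f(1) L(2)]) (auto intro!: continuous_intros)
    ultimately show "\<exists>L. total_mass L = ennreal m \<and> sets L = sets borel \<and>
        weakly_to (\<lambda>n. \<gamma> (r n) j) L \<and> fst_marginal_le L (\<mu> j) \<and>
        transport_cost L \<le> liminf (\<lambda>n. transport_cost (\<gamma> (r n) j))"
      using L by blast
  qed
qed

section \<open>Attainment of the infima\<close>

lemma mass_plans_eq: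
  assumes \<nu>: "\<nu> \<in> measures_of_mass m"
  shows "\<gamma> \<in> mass_plans m \<mu> \<nu> \<longleftrightarrow> sets \<gamma> = sets borel \<and> fst_marginal_le \<gamma> \<mu> \<and> distr \<gamma> borel snd = \<nu>"
proof -
  have \<nu>': "sets \<nu> = sets borel"
    using \<nu> by (simp add: measures_of_mass_def finite_second_moment_def)
  have "(\<forall>E\<in>sets borel. emeasure \<gamma> (snd -` E) = emeasure \<nu> E) \<longleftrightarrow> distr \<gamma> borel snd = \<nu>"
    if "sets \<gamma> = sets borel"
  proof
    assume "\<forall>E\<in>sets borel. emeasure \<gamma> (snd -` E) = emeasure \<nu> E"
    then show "distr \<gamma> borel snd = \<nu>"
      by (intro measure_eqI) (simp_all add: \<nu>' emeasure_distr_snd that)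
  next
    assume "distr \<gamma> borel snd = \<nu>"
    then show "\<forall>E\<in>sets borel. emeasure \<gamma> (snd -` E) = emeasure \<nu> E"
      by (auto simp: emeasure_distr_snd[OF that, symmetric])
  qed
  then show ?thesis
    unfolding mass_plans_iff[OF \<nu>] fst_marginal_le_def by blast
qed

text \<open>The direct method: it turns the infimum in \<open>MK2_sq\<close> into a minimum whenever
  it is finite.\<close>

lemma MK2_sq_attained:
  fixes \<mu> :: "(real^'n) measure"
  assumes m: "0 < m" and \<nu>: "\<nu> \<in> measures_of_mass m"
    and \<mu>: "finite_second_moment \<mu>" "finite_measure \<mu>" and fin: "MK2_sq m \<mu> \<nu> < \<infinity>"
  obtains \<gamma> where "\<gamma> \<in> mass_plans m \<mu> \<nu>" "transport_cost \<gamma> = MK2_sq m \<mu> \<nu>"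
proof -
  define A where "A = transport_cost ` mass_plans m \<mu> \<nu>"
  have InfA: "MK2_sq m \<mu> \<nu> = Inf A" by (simp add: A_def MK2_sq_eq_INF)
  have "A \<noteq> {}" using fin InfA by auto
  then obtain f :: "nat \<Rightarrow> ennreal" where f: "decseq f" "range f \<subseteq> A" "Inf A = (INF i. f i)"
    using ennreal_Inf_countable_INF by blast
  have lim: "f \<longlonglongrightarrow> MK2_sq m \<mu> \<nu>"
    unfolding InfA f(3) by (rule LIMSEQ_INF[OF f(1)])
  have "(INF i. f i) < \<infinity>" using fin InfA f(3) by simp
  \<comment> \<open>Early costs may be infinite; from index \<open>k\<close> on, \<open>f k\<close>
    is a finite uniform bound.\<close>
  then obtain k where k: "f k < \<infinity>"
    unfolding INF_less_iff by blast
  have "\<forall>n. \<exists>\<gamma>. \<gamma> \<in> mass_plans m \<mu> \<nu> \<and> transport_cost \<gamma> = f (n + k)"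
  proof
    fix n
    have "f (n + k) \<in> A" using f(2) by blast
    then show "\<exists>\<gamma>. \<gamma> \<in> mass_plans m \<mu> \<nu> \<and> transport_cost \<gamma> = f (n + k)" by (auto simp: A_def)
  qed
  then obtain \<gamma> where "\<forall>n. \<gamma> n \<in> mass_plans m \<mu> \<nu> \<and> transport_cost (\<gamma> n) = f (n + k)"
    by (rule choice[THEN exE])
  then have \<gamma>: "\<And>n. \<gamma> n \<in> mass_plans m \<mu> \<nu>" "\<And>n. transport_cost (\<gamma> n) = f (n + k)" by auto
  have \<gamma>': "sets (\<gamma> n) = sets borel" "fst_marginal_le (\<gamma> n) \<mu>" "distr (\<gamma> n) borel snd = \<nu>"
    "total_mass (\<gamma> n) = ennreal m" "transport_cost (\<gamma> n) \<le> f k" for n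
    using \<gamma>(1)[of n] mass_plans_eq[OF \<nu>] decseqD[OF f(1), of k "n + k"] \<gamma>(2)[of n] by (auto simp: mass_plans_def)
  \<comment> \<open>A one-element index set reduces the single marginal to the statement for
    families.\<close>
  have "\<exists>r. strict_mono (r :: nat \<Rightarrow> nat) \<and> (\<forall>j\<in>{()}. \<exists>L. total_mass L = ennreal m \<and> sets L = sets borel \<and>
    weakly_to (\<lambda>n. \<gamma> (r n)) L \<and> fst_marginal_le L \<mu> \<and>
    transport_cost L \<le> liminf (\<lambda>n. transport_cost (\<gamma> (r n))))"
    by (rule compact_plans[where \<gamma>="\<lambda>n _. \<gamma> n" and \<mu>="\<lambda>_. \<mu>" and C="f k"]) (use k in \<open>simp_all add: m \<mu> \<gamma>'\<close>)
  then obtain r L where r: "strict_mono (r :: nat \<Rightarrow> nat)"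
    and L: "total_mass L = ennreal m" "sets L = sets borel"
      "weakly_to (\<lambda>n. \<gamma> (r n)) L" "fst_marginal_le L \<mu>"
      "transport_cost L \<le> liminf (\<lambda>n. transport_cost (\<gamma> (r n)))" by auto
  have fm: "finite_measure L" "finite_measure (\<gamma> n)" for n
    using finite_measure_if_total_mass L(1) \<gamma>'(4) by blast+
  \<comment> \<open>The comparison sequence is constantly \<open>\<gamma> 0\<close> and converges to
    itself.\<close>
  have "distr L borel snd = distr (\<gamma> 0) borel snd"
    by (rule weakly_to_snd_marginal_eq[where \<gamma>="\<lambda>n. \<gamma> (r n)" and \<gamma>'="\<lambda>_. \<gamma> 0"])
      (simp_all add: \<gamma>' L fm weakly_to_def[of "\<lambda>_. \<gamma> 0"])
  then have Lp: "L \<in> mass_plans m \<mu> \<nu>"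
    unfolding mass_plans_eq[OF \<nu>] using L \<gamma>'(3)[of 0] by simp
  have "strict_mono (\<lambda>n. r n + k)" using r by (simp add: strict_mono_def)
  from LIMSEQ_subseq_LIMSEQ[OF lim this]
  have "(\<lambda>n. transport_cost (\<gamma> (r n))) \<longlonglongrightarrow> MK2_sq m \<mu> \<nu>"
    by (simp add: \<gamma>(2) comp_def)
  then have "liminf (\<lambda>n. transport_cost (\<gamma> (r n))) = MK2_sq m \<mu> \<nu>"
    by (intro lim_imp_Liminf) simp_all
  then have "transport_cost L = MK2_sq m \<mu> \<nu>"
    using L(5) MK2_sq_le[OF Lp] by simp
  then show ?thesis using that Lp by blast
qed

lemma concentrated_plan:
  fixes \<beta> :: "(real^'n) measure" and p :: "real^'n"
  assumes \<beta>: "sets \<beta> = sets borel"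
  defines "\<gamma> \<equiv> distr \<beta> borel (\<lambda>x. (x, p))"
  shows "sets \<gamma> = sets borel"
    and "E \<in> sets borel \<Longrightarrow> emeasure \<gamma> (fst -` E) = emeasure \<beta> E"
    and "E \<in> sets borel \<Longrightarrow> emeasure \<gamma> (snd -` E) = total_mass \<beta> * indicator E p"
    and "transport_cost \<gamma> = (\<integral>\<^sup>+x. ennreal ((norm (x - p))\<^sup>2) \<partial>\<beta>)"
proof -
  have meas: "(\<lambda>x. (x, p)) \<in> borel_measurable \<beta>"
    by (intro measurable_if_sets_borel[OF \<beta>] borel_measurable_continuous_onI continuous_intros)
  show "sets \<gamma> = sets borel" by (simp add: \<gamma>_def)
  show "emeasure \<gamma> (fst -` E) = emeasure \<beta> E" if "E \<in> sets borel"
  proof -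
    have "(\<lambda>x. (x, p)) -` fst -` E = E" by auto
    then show ?thesis
      using vimage_fst_borel[OF that] meas unfolding \<gamma>_def
      by (subst emeasure_distr) (simp_all only: sets_borel_space[OF \<beta>] Int_UNIV_right)
  qed
  show "emeasure \<gamma> (snd -` E) = total_mass \<beta> * indicator E p" if "E \<in> sets borel"
  proof -
    have vim: "(\<lambda>x. (x, p)) -` snd -` E = (if p \<in> E then UNIV else {})" by auto
    show ?thesis
      unfolding \<gamma>_def emeasure_distr[OF meas vimage_snd_borel[OF that]] vim
      by (simp add: sets_borel_space[OF \<beta>])
  qed
  show "transport_cost \<gamma> = (\<integral>\<^sup>+x. ennreal ((norm (x - p))\<^sup>2) \<partial>\<beta>)"
    unfolding \<gamma>_def transport_cost_def
    by (subst nn_integral_distr[OF meas]) (use cost_borel_measurable in \<open>simp_all del: borel_measurable_ennreal_iff\<close>)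
qed

text \<open>Sending everything to the origin costs a fraction of the second moment of each
  \<open>\<mu> j\<close>, which is finite.\<close>

lemma finite_cost_candidate:
  fixes \<mu> :: "'i \<Rightarrow> (real^'n) measure"
  assumes m: "0 < m" and \<mu>: "\<And>j. j \<in> J \<Longrightarrow> finite_second_moment (\<mu> j)" "\<And>j. j \<in> J \<Longrightarrow> finite_measure (\<mu> j)"
    and mass: "\<And>j. j \<in> J \<Longrightarrow> ennreal m \<le> total_mass (\<mu> j)"
  obtains \<nu> where "\<nu> \<in> measures_of_mass m" "\<And>j. j \<in> J \<Longrightarrow> MK2_sq m (\<mu> j) \<nu> < \<infinity>"
proof -
  define \<nu> :: "(real^'n) measure" where "\<nu> = scale_measure (ennreal m) (return borel 0)"
  have "(\<integral>\<^sup>+x. ennreal ((norm x)\<^sup>2) \<partial>\<nu>) = ennreal m * (\<integral>\<^sup>+x. ennreal ((norm x)\<^sup>2) \<partial>return borel (0 :: real^'n))"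
    unfolding \<nu>_def by (rule nn_integral_scale_measure) simp
  also have "\<dots> = 0"
    by (subst nn_integral_return) simp_all
  finally have \<nu>: "\<nu> \<in> measures_of_mass m"
    by (simp add: measures_of_mass_def finite_second_moment_def \<nu>_def space_scale_measure)
  moreover have "MK2_sq m (\<mu> j) \<nu> < \<infinity>" if j: "j \<in> J" for j
  proof -
    have \<mu>s: "sets (\<mu> j) = sets borel" and \<mu>2: "(\<integral>\<^sup>+x. ennreal ((norm x)\<^sup>2) \<partial>\<mu> j) < \<infinity>"
      using \<mu>(1)[OF j] by (simp_all add: finite_second_moment_def)
    obtain M where M: "total_mass (\<mu> j) = ennreal M" "0 \<le> M"
      using finite_measure.emeasure_finite[OF \<mu>(2)[OF j], of "space (\<mu> j)"]
      by (cases "total_mass (\<mu> j)" rule: ennreal_cases) auto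
    have mM: "m \<le> M" using mass[OF j] M by (simp add: ennreal_le_iff)
    \<comment> \<open>Rescaling all of \<open>\<mu> j\<close> by the factor \<open>m / M\<close>
      gives the required mass; \<open>m \<le> M\<close> keeps it below
      \<open>\<mu> j\<close>.\<close>
    define \<beta> where "\<beta> = scale_measure (ennreal (m / M)) (\<mu> j)"
    have \<beta>: "sets \<beta> = sets borel" "total_mass \<beta> = ennreal m"
      using M mM m by (simp_all add: \<beta>_def \<mu>s space_scale_measure ennreal_mult[symmetric])
    have \<beta>le: "emeasure \<beta> E \<le> emeasure (\<mu> j) E" for E
      using mult_right_mono[of "ennreal (m / M)" 1 "emeasure (\<mu> j) E"] m mM
      by (simp add: \<beta>_def)
    define \<gamma> where "\<gamma> = distr \<beta> borel (\<lambda>x. (x, 0 :: real^'n))"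
    note c = concentrated_plan[OF \<beta>(1), where p=0, folded \<gamma>_def]
    have "\<gamma> \<in> mass_plans m (\<mu> j) \<nu>"
      unfolding mass_plans_iff[OF \<nu>]
    proof (intro conjI ballI c(1))
      fix E :: "(real^'n) set" assume E: "E \<in> sets borel"
      show "emeasure \<gamma> (fst -` E) \<le> emeasure (\<mu> j) E"
        unfolding c(2)[OF E] by (rule \<beta>le)
      show "emeasure \<gamma> (snd -` E) = emeasure \<nu> E"
        unfolding c(3)[OF E] \<beta>(2) using E by (simp add: \<nu>_def)
    qed
    then have "MK2_sq m (\<mu> j) \<nu> \<le> transport_cost \<gamma>" by (rule MK2_sq_le)
    also have "transport_cost \<gamma> = ennreal (m / M) * (\<integral>\<^sup>+x. ennreal ((norm x)\<^sup>2) \<partial>\<mu> j)"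
      unfolding c \<beta>_def
      by (subst nn_integral_scale_measure)
        (use norm_sq_borel_measurable in \<open>auto simp: \<mu>s cong: measurable_cong_sets\<close>)
    also have "\<dots> < \<infinity>" using \<mu>2 by (auto simp: ennreal_mult_less_top)
    finally show ?thesis .
  qed
  ultimately show ?thesis using that by blast
qed

text \<open>Fatou's lemma for the counting measure.\<close>

lemma sum_liminf_le:
  fixes u :: "'i \<Rightarrow> nat \<Rightarrow> ennreal"
  assumes "finite J"
  shows "(\<Sum>j\<in>J. liminf (u j)) \<le> liminf (\<lambda>n. \<Sum>j\<in>J. u j n)"
  using nn_integral_liminf[of "\<lambda>n j. u j n" "count_space J"] assms
  by (simp add: nn_integral_count_space_finite)

text \<open>Compactness is applied to the families of optimal plans rather than to the targets:
  their limits yield the target, its second moment and the cost estimate together.\<close>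

lemma barycenter_exists:
  fixes \<mu> :: "'i \<Rightarrow> (real^'n) measure"
  assumes J: "finite J" "J \<noteq> {}" and m: "0 < m"
    and \<mu>: "\<And>j. j \<in> J \<Longrightarrow> finite_second_moment (\<mu> j)" "\<And>j. j \<in> J \<Longrightarrow> finite_measure (\<mu> j)"
    and mass: "\<And>j. j \<in> J \<Longrightarrow> ennreal m \<le> total_mass (\<mu> j)"
  obtains \<nu> where "\<nu> \<in> measures_of_mass m" "(\<Sum>j\<in>J. MK2_sq m (\<mu> j) \<nu>) < \<infinity>"
    "\<And>\<nu>'. \<nu>' \<in> measures_of_mass m \<Longrightarrow> (\<Sum>j\<in>J. MK2_sq m (\<mu> j) \<nu>) \<le> (\<Sum>j\<in>J. MK2_sq m (\<mu> j) \<nu>')"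
proof -
  define F where "F \<nu> = (\<Sum>j\<in>J. MK2_sq m (\<mu> j) \<nu>)" for \<nu>
  have \<mu>s: "sets (\<mu> j) = sets borel" if "j \<in> J" for j
    using \<mu>(1)[OF that] by (simp add: finite_second_moment_def)
  obtain \<nu>0 where \<nu>0: "\<nu>0 \<in> measures_of_mass m" "\<And>j. j \<in> J \<Longrightarrow> MK2_sq m (\<mu> j) \<nu>0 < \<infinity>"
    by (rule finite_cost_candidate[OF m \<mu> mass]) (assumption, assumption, assumption, rule that)
  have F0: "F \<nu>0 < \<infinity>" using \<nu>0(2) by (simp add: F_def J less_top)
  define A where "A = F ` measures_of_mass m"
  have "A \<noteq> {}" using \<nu>0(1) by (auto simp: A_def)
  then obtain f :: "nat \<Rightarrow> ennreal" where f: "decseq f" "range f \<subseteq> A" "Inf A = (INF i. f i)"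
    using ennreal_Inf_countable_INF by blast
  have lim: "f \<longlonglongrightarrow> Inf A"
    unfolding f(3) by (rule LIMSEQ_INF[OF f(1)])
  have "Inf A \<le> F \<nu>0" using \<nu>0(1) by (auto simp: A_def intro: INF_lower)
  then have InfA: "Inf A < \<infinity>" using F0 by (rule le_less_trans)
  then have "(INF i. f i) < \<infinity>" using f(3) by simp
  then obtain k where k: "f k < \<infinity>"
    unfolding INF_less_iff by blast
  have "\<forall>n. \<exists>\<nu>. \<nu> \<in> measures_of_mass m \<and> F \<nu> = f (n + k)"
  proof
    fix n
    have "f (n + k) \<in> A" using f(2) by blast
    then show "\<exists>\<nu>. \<nu> \<in> measures_of_mass m \<and> F \<nu> = f (n + k)" by (auto simp: A_def)
  qed
  then obtain \<nu> where "\<forall>n. \<nu> n \<in> measures_of_mass m \<and> F (\<nu> n) = f (n + k)"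
    by (rule choice[THEN exE])
  then have \<nu>: "\<And>n. \<nu> n \<in> measures_of_mass m" "\<And>n. F (\<nu> n) = f (n + k)" by auto
  have fk: "f (n + k) \<le> f k" for n using decseqD[OF f(1), of k "n + k"] by simp
  have MK_le: "MK2_sq m (\<mu> j) (\<nu> n) \<le> f k" if "j \<in> J" for n j
    using member_le_sum[OF that, of "\<lambda>j. MK2_sq m (\<mu> j) (\<nu> n)"] J fk[of n] \<nu>(2)[of n] by (simp add: F_def)
  have "\<forall>n. \<exists>\<gamma>. \<forall>j\<in>J. \<gamma> j \<in> mass_plans m (\<mu> j) (\<nu> n) \<and> transport_cost (\<gamma> j) = MK2_sq m (\<mu> j) (\<nu> n)"
  proof (intro allI bchoice ballI)
    fix n j assume j: "j \<in> J"
    show "\<exists>\<gamma>. \<gamma> \<in> mass_plans m (\<mu> j) (\<nu> n) \<and> transport_cost \<gamma> = MK2_sq m (\<mu> j) (\<nu> n)"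
      by (rule MK2_sq_attained[OF m \<nu>(1)[of n] \<mu>(1)[OF j] \<mu>(2)[OF j] le_less_trans[OF MK_le[OF j] k]]) blast
  qed
  then obtain \<gamma> where "\<forall>n. \<forall>j\<in>J. \<gamma> n j \<in> mass_plans m (\<mu> j) (\<nu> n) \<and> transport_cost (\<gamma> n j) = MK2_sq m (\<mu> j) (\<nu> n)"
    by (rule choice[THEN exE])
  then have \<gamma>: "\<And>n j. j \<in> J \<Longrightarrow> \<gamma> n j \<in> mass_plans m (\<mu> j) (\<nu> n)"
    "\<And>n j. j \<in> J \<Longrightarrow> transport_cost (\<gamma> n j) = MK2_sq m (\<mu> j) (\<nu> n)" by auto
  have \<gamma>': "sets (\<gamma> n j) = sets borel" "fst_marginal_le (\<gamma> n j) (\<mu> j)" "distr (\<gamma> n j) borel snd = \<nu> n"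
    "total_mass (\<gamma> n j) = ennreal m" "transport_cost (\<gamma> n j) \<le> f k" if "j \<in> J" for n j
    using \<gamma>(1)[OF that, of n] mass_plans_eq[OF \<nu>(1)[of n]] \<gamma>(2)[OF that, of n] MK_le[OF that, of n]
    by (auto simp: mass_plans_def)
  obtain r where r: "strict_mono (r :: nat \<Rightarrow> nat)" and L_ex: "\<forall>j\<in>J. \<exists>L. total_mass L = ennreal m \<and> sets L = sets borel \<and>
    weakly_to (\<lambda>n. \<gamma> (r n) j) L \<and> fst_marginal_le L (\<mu> j) \<and>
    transport_cost L \<le> liminf (\<lambda>n. transport_cost (\<gamma> (r n) j))"
    using compact_plans[of J m \<mu> \<gamma> "f k", OF J(1) m \<mu> \<gamma>'(1) \<gamma>'(4) \<gamma>'(2) \<gamma>'(5) k] by blast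
  from L_ex obtain L where "\<forall>j\<in>J. total_mass (L j) = ennreal m \<and> sets (L j) = sets borel \<and>
    weakly_to (\<lambda>n. \<gamma> (r n) j) (L j) \<and> fst_marginal_le (L j) (\<mu> j) \<and>
    transport_cost (L j) \<le> liminf (\<lambda>n. transport_cost (\<gamma> (r n) j))"
    by (rule bchoice[THEN exE])
  then have L: "\<And>j. j \<in> J \<Longrightarrow> total_mass (L j) = ennreal m" "\<And>j. j \<in> J \<Longrightarrow> sets (L j) = sets borel"
    "\<And>j. j \<in> J \<Longrightarrow> weakly_to (\<lambda>n. \<gamma> (r n) j) (L j)" "\<And>j. j \<in> J \<Longrightarrow> fst_marginal_le (L j) (\<mu> j)"
    "\<And>j. j \<in> J \<Longrightarrow> transport_cost (L j) \<le> liminf (\<lambda>n. transport_cost (\<gamma> (r n) j))" by auto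
  obtain i where i: "i \<in> J" using J(2) by blast
  \<comment> \<open>Any index will do: before the limit all plans share the target
    \<open>\<nu> n\<close>, so their limits share one too.\<close>
  define \<rho> where "\<rho> = distr (L i) borel snd"
  have snd_L: "distr (L j) borel snd = \<rho>" if "j \<in> J" for j
    unfolding \<rho>_def
    by (rule weakly_to_snd_marginal_eq[where \<gamma>="\<lambda>n. \<gamma> (r n) j" and \<gamma>'="\<lambda>n. \<gamma> (r n) i"])
      (use L that i \<gamma>' in \<open>auto intro!: finite_measure_if_total_mass\<close>)
  have "(\<Sum>j\<in>J. transport_cost (L j)) \<le> (\<Sum>j\<in>J. liminf (\<lambda>n. transport_cost (\<gamma> (r n) j)))"
    by (intro sum_mono L)
  also have "\<dots> \<le> liminf (\<lambda>n. \<Sum>j\<in>J. transport_cost (\<gamma> (r n) j))"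
    by (rule sum_liminf_le[OF J(1)])
  also have "(\<lambda>n. \<Sum>j\<in>J. transport_cost (\<gamma> (r n) j)) = (\<lambda>n. f (r n + k))"
    using \<gamma>(2) \<nu>(2) by (simp add: F_def)
  also have "liminf (\<lambda>n. f (r n + k)) = Inf A"
  proof (rule lim_imp_Liminf)
    have "strict_mono (\<lambda>n. r n + k)" using r by (simp add: strict_mono_def)
    from LIMSEQ_subseq_LIMSEQ[OF lim this] show "(\<lambda>n. f (r n + k)) \<longlonglongrightarrow> Inf A" by (simp add: comp_def)
  qed simp
  finally have cost: "(\<Sum>j\<in>J. transport_cost (L j)) \<le> Inf A" .
  \<comment> \<open>Weak convergence does not bound the second moment of \<rho> by itself; the
    finite cost of \<open>L i\<close> and the moment of \<open>\<mu> i\<close> do.\<close>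
  have "\<rho> \<in> measures_of_mass m"
  proof -
    have "total_mass \<rho> = ennreal m"
      using L(1,2)[OF i] emeasure_distr_snd[OF L(2)[OF i], of UNIV] by (simp add: \<rho>_def sets_borel_space[OF L(2)[OF i]])
    moreover have "(\<integral>\<^sup>+x. ennreal ((norm x)\<^sup>2) \<partial>\<rho>) < \<infinity>"
    proof -
      have "(\<integral>\<^sup>+x. ennreal ((norm x)\<^sup>2) \<partial>\<rho>) = (\<integral>\<^sup>+z. ennreal ((norm (snd z))\<^sup>2) \<partial>L i)"
        unfolding \<rho>_def
        by (rule nn_integral_distr) (simp_all add: measurable_if_sets_borel[OF L(2)[OF i]] snd_borel_measurable)
      also have "\<dots> \<le> 3 * (\<integral>\<^sup>+x. ennreal ((norm x)\<^sup>2) \<partial>\<mu> i) + 2 * transport_cost (L i)"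
        by (rule plan_moment_bounds(2)[OF L(2)[OF i] L(4)[OF i] \<mu>s[OF i]])
      also have "\<dots> < \<infinity>"
      proof -
        have "transport_cost (L i) \<le> (\<Sum>j\<in>J. transport_cost (L j))"
          using i J by (intro member_le_sum) auto
        then have "transport_cost (L i) < \<infinity>" using cost InfA by order
        then show ?thesis
          using \<mu>(1)[OF i] by (auto simp: finite_second_moment_def ennreal_mult_less_top)
      qed
      finally show ?thesis .
    qed
    ultimately show ?thesis
      by (simp add: measures_of_mass_def finite_second_moment_def) (simp add: \<rho>_def)
  qed
  note \<rho> = this
  have "F \<rho> \<le> (\<Sum>j\<in>J. transport_cost (L j))"
    unfolding F_def
  proof (intro sum_mono MK2_sq_le)
    fix j assume "j \<in> J"
    then show "L j \<in> mass_plans m (\<mu> j) \<rho>"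
      unfolding mass_plans_eq[OF \<rho>] using L snd_L by blast
  qed
  then have F\<rho>: "F \<rho> \<le> Inf A" using cost by (rule order_trans)
  show ?thesis
  proof (rule that[OF \<rho>])
    show "(\<Sum>j\<in>J. MK2_sq m (\<mu> j) \<rho>) < \<infinity>"
      using F\<rho> InfA unfolding F_def by (rule le_less_trans)
    show "(\<Sum>j\<in>J. MK2_sq m (\<mu> j) \<rho>) \<le> (\<Sum>j\<in>J. MK2_sq m (\<mu> j) \<nu>')" if "\<nu>' \<in> measures_of_mass m" for \<nu>'
      using F\<rho> that unfolding F_def A_def by (meson INF_lower order_trans)
  qed
qed

section \<open>Uniqueness\<close>

definition average :: "'a measure \<Rightarrow> 'a measure \<Rightarrow> 'a measure" where
  "average M N = scale_measure (inverse 2) (add_measure M N)"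

lemma sets_average [simp]: "sets (average M N) = sets M"
  by (simp add: average_def)

lemma emeasure_average:
  "sets N = sets M \<Longrightarrow> emeasure (average M N) A = (emeasure M A + emeasure N A) / 2"
  by (simp add: average_def emeasure_add_measure divide_ennreal_def mult.commute)

lemma nn_integral_average:
  "sets N = sets M \<Longrightarrow> f \<in> borel_measurable M \<Longrightarrow>
    nn_integral (average M N) f = (nn_integral M f + nn_integral N f) / 2"
  unfolding average_def
  by (subst nn_integral_scale_measure) (auto simp: nn_integral_add_measure divide_ennreal_def mult.commute cong: measurable_cong_sets)

lemma half_double: "(a + a) / 2 = (a :: ennreal)"
  by (simp add: mult_2_right[symmetric] mult_divide_eq_ennreal)

lemma average_measures_of_mass:
  assumes "\<nu>1 \<in> measures_of_mass m" "\<nu>2 \<in> measures_of_mass m"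
  shows "average \<nu>1 \<nu>2 \<in> measures_of_mass m"
proof -
  have s: "sets \<nu>1 = sets borel" "sets \<nu>2 = sets borel"
    and f: "(\<integral>\<^sup>+x. ennreal ((norm x)\<^sup>2) \<partial>\<nu>1) < \<infinity>" "(\<integral>\<^sup>+x. ennreal ((norm x)\<^sup>2) \<partial>\<nu>2) < \<infinity>"
    and t: "emeasure \<nu>1 UNIV = ennreal m" "emeasure \<nu>2 UNIV = ennreal m"
    using assms sets_borel_space[of \<nu>1] sets_borel_space[of \<nu>2]
    by (auto simp: measures_of_mass_def finite_second_moment_def)
  have "(\<integral>\<^sup>+x. ennreal ((norm x)\<^sup>2) \<partial>average \<nu>1 \<nu>2) < \<infinity>"
    using f by (subst nn_integral_average)
      (auto simp: s less_top[symmetric] ennreal_divide_eq_top_iff simp del: borel_measurable_ennreal_iff intro!: measurable_if_sets_borel[OF s(1)] norm_sq_borel_measurable)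
  moreover have "total_mass (average \<nu>1 \<nu>2) = ennreal m"
    using sets_borel_space[of "average \<nu>1 \<nu>2"] by (simp add: s emeasure_average t half_double)
  ultimately show ?thesis
    by (simp add: measures_of_mass_def finite_second_moment_def s)
qed

lemma average_mass_plans:
  assumes \<nu>: "\<nu>1 \<in> measures_of_mass m" "\<nu>2 \<in> measures_of_mass m"
    and \<gamma>: "\<gamma>1 \<in> mass_plans m \<mu> \<nu>1" "\<gamma>2 \<in> mass_plans m \<mu> \<nu>2"
  shows "average \<gamma>1 \<gamma>2 \<in> mass_plans m \<mu> (average \<nu>1 \<nu>2)"
    and "transport_cost (average \<gamma>1 \<gamma>2) = (transport_cost \<gamma>1 + transport_cost \<gamma>2) / 2"
proof -
  have s: "sets \<nu>1 = sets borel" "sets \<nu>2 = sets borel" "sets \<gamma>1 = sets borel" "sets \<gamma>2 = sets borel"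
    using \<nu> \<gamma> by (auto simp: measures_of_mass_def finite_second_moment_def mass_plans_def partial_plans_def)
  show "average \<gamma>1 \<gamma>2 \<in> mass_plans m \<mu> (average \<nu>1 \<nu>2)"
    unfolding mass_plans_iff[OF average_measures_of_mass[OF \<nu>]]
  proof (intro conjI ballI)
    show "sets (average \<gamma>1 \<gamma>2) = sets borel" by (simp add: s)
    fix E :: "(real^'a) set" assume E: "E \<in> sets borel"
    have le: "emeasure \<gamma>1 (fst -` E) \<le> emeasure \<mu> E" "emeasure \<gamma>2 (fst -` E) \<le> emeasure \<mu> E"
      and eq: "emeasure \<gamma>1 (snd -` E) = emeasure \<nu>1 E" "emeasure \<gamma>2 (snd -` E) = emeasure \<nu>2 E"
      using \<gamma> E unfolding mass_plans_iff[OF \<nu>(1)] mass_plans_iff[OF \<nu>(2)] by blast+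
    have "emeasure (average \<gamma>1 \<gamma>2) (fst -` E) \<le> (emeasure \<mu> E + emeasure \<mu> E) / 2"
      unfolding emeasure_average[OF trans[OF s(4) s(3)[symmetric]]] by (intro divide_right_mono_ennreal add_mono le)
    then show "emeasure (average \<gamma>1 \<gamma>2) (fst -` E) \<le> emeasure \<mu> E"
      by (simp only: half_double)
    show "emeasure (average \<gamma>1 \<gamma>2) (snd -` E) = emeasure (average \<nu>1 \<nu>2) E"
      unfolding emeasure_average[OF trans[OF s(4) s(3)[symmetric]]] emeasure_average[OF trans[OF s(2) s(1)[symmetric]]] eq ..
  qed
  show "transport_cost (average \<gamma>1 \<gamma>2) = (transport_cost \<gamma>1 + transport_cost \<gamma>2) / 2"
    unfolding transport_cost_def
    by (rule nn_integral_average[OF _ measurable_if_sets_borel[OF s(3) cost_borel_measurable]]) (simp add: s)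
qed

text \<open>This is how saturation of \<mu> descends from the midpoint plan to the two plans it
  averages.\<close>

lemma ennreal_average_eq:
  assumes "a \<le> c" "b \<le> c" "c < \<infinity>" "(a + b) / 2 = c"
  shows "a = c" "b = (c :: ennreal)"
proof -
  obtain x y z where "a = ennreal x" "0 \<le> x" "b = ennreal y" "0 \<le> y" "c = ennreal z" "0 \<le> z"
    using assms(1-3) by (cases a; cases b; cases c) (auto simp: top_unique)
  then show "a = c" "b = c"
    using assms by (auto simp: ennreal_plus[symmetric] ennreal_divide_numeral simp del: ennreal_plus)
qed

definition unused :: "(real^'n) measure \<Rightarrow> ((real^'n) \<times> (real^'n)) measure \<Rightarrow> (real^'n) measure" where
  "unused \<mu> \<gamma> = diff_measure \<mu> (distr \<gamma> borel fst)"

text \<open>\<open>diff_measure\<close> subtracts in \<open>ennreal\<close>; domination and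
  finiteness turn it into a genuine remainder, recorded in additive form.\<close>

lemma unused:
  assumes \<mu>: "sets \<mu> = sets borel" "finite_measure \<mu>"
    and \<gamma>: "sets \<gamma> = sets borel" "finite_measure \<gamma>" "fst_marginal_le \<gamma> \<mu>"
  shows "sets (unused \<mu> \<gamma>) = sets borel" and "finite_measure (unused \<mu> \<gamma>)"
    and "E \<in> sets borel \<Longrightarrow> emeasure (unused \<mu> \<gamma>) E + emeasure \<gamma> (fst -` E) = emeasure \<mu> E"
proof -
  have fm: "finite_measure (distr \<gamma> borel fst)"
    by (intro finite_measure.finite_measure_distr \<gamma> measurable_if_sets_borel[OF \<gamma>(1)] fst_borel_measurable)
  have em: "emeasure (unused \<mu> \<gamma>) E = emeasure \<mu> E - emeasure \<gamma> (fst -` E)" if E: "E \<in> sets borel" for E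
    unfolding unused_def emeasure_distr_fst[OF \<gamma>(1) E, symmetric]
    using \<gamma>(3) by (intro emeasure_diff_measure \<mu> fm)
      (auto simp: \<mu> E emeasure_distr_fst[OF \<gamma>(1)] fst_marginal_le_def)
  show s: "sets (unused \<mu> \<gamma>) = sets borel" by (simp add: unused_def \<mu>)
  show add: "emeasure (unused \<mu> \<gamma>) E + emeasure \<gamma> (fst -` E) = emeasure \<mu> E" if E: "E \<in> sets borel" for E
    using \<gamma>(3) E by (simp add: em[OF E] fst_marginal_le_def diff_add_cancel_ennreal)
  show "finite_measure (unused \<mu> \<gamma>)"
  proof (rule finite_measureI)
    have "emeasure (unused \<mu> \<gamma>) UNIV \<le> emeasure \<mu> UNIV"
      using add[of UNIV] by (metis le_iff_add sets.top space_borel)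
    then show "total_mass (unused \<mu> \<gamma>) \<noteq> \<infinity>"
      using finite_measure.emeasure_finite[OF \<mu>(2), of UNIV] sets_borel_space[OF s] by (auto simp: top_unique)
  qed
qed

text \<open>The projection is a countable union of projections of compact pieces. It makes the set
  of sources that a plan sends into \<open>K\<close> measurable.\<close>

lemma Borel_image_fst_closed_compact:
  fixes S :: "('a::euclidean_space \<times> 'a) set"
  assumes S: "closed S" and K: "compact K"
  shows "fst ` (S \<inter> UNIV \<times> K) \<in> sets borel"
proof -
  have "compact (fst ` (S \<inter> cball 0 (real k) \<times> K))" for k
    using S K by (intro compact_continuous_image continuous_intros closed_Int_compact compact_Times) auto
  then have "(\<Union>k. fst ` (S \<inter> cball 0 (real k) \<times> K)) \<in> sets borel"
    by (intro sets.countable_UN) (auto simp: borel_compact)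
  moreover have "(\<Union>k. fst ` (S \<inter> cball 0 (real k) \<times> K)) = fst ` (S \<inter> UNIV \<times> K)"
  proof (intro equalityI subsetI)
    fix x assume "x \<in> fst ` (S \<inter> UNIV \<times> K)"
    then obtain y where y: "(x, y) \<in> S" "y \<in> K" by auto
    obtain k :: nat where "norm x \<le> real k" using real_arch_simple by blast
    then have "(x, y) \<in> S \<inter> cball 0 (real k) \<times> K" using y by simp
    then show "x \<in> (\<Union>k. fst ` (S \<inter> cball 0 (real k) \<times> K))" by force
  qed auto
  ultimately show ?thesis by simp
qed

lemma emeasure_eq_if_compact_eq:
  fixes A B :: "'a::{second_countable_topology, complete_space} measure"
  assumes A: "finite_measure A" "sets A = sets borel" and B: "finite_measure B" "sets B = sets borel"
    and eq: "\<And>K. compact K \<Longrightarrow> K \<subseteq> E \<Longrightarrow> emeasure A K = emeasure B K" and E: "E \<in> sets borel"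
  shows "emeasure A E = emeasure B E"
proof -
  have "emeasure A E = (SUP K\<in>{K. K \<subseteq> E \<and> compact K}. emeasure A K)"
    by (rule inner_regular[OF A(2) _ E]) (use finite_measure.emeasure_finite[OF A(1)] in simp)
  also have "\<dots> = (SUP K\<in>{K. K \<subseteq> E \<and> compact K}. emeasure B K)"
    by (rule SUP_cong) (auto simp: eq)
  also have "\<dots> = emeasure B E"
    by (rule inner_regular[symmetric, OF B(2) _ E]) (use finite_measure.emeasure_finite[OF B(1)] in simp)
  finally show ?thesis .
qed

text \<open>Away from the unused mass of the midpoint plan, both plans exhaust \<open>\<mu>\<close> and follow the same map.\<close>

lemma targets_agree_off_unused:
  fixes \<mu> :: "(real^'n) measure"
  assumes \<mu>: "sets \<mu> = sets borel" "finite_measure \<mu>" "absolutely_continuous lborel \<mu>"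
    and \<nu>: "\<nu>1 \<in> measures_of_mass m" "\<nu>2 \<in> measures_of_mass m"
    and \<gamma>: "\<gamma>1 \<in> mass_plans m \<mu> \<nu>1" "\<gamma>2 \<in> mass_plans m \<mu> \<nu>2"
    and opt: "transport_cost (average \<gamma>1 \<gamma>2) = MK2_sq m \<mu> (average \<nu>1 \<nu>2)"
    and fin: "transport_cost (average \<gamma>1 \<gamma>2) < \<infinity>"
    and E: "E \<in> sets borel" "E \<inter> support (unused \<mu> (average \<gamma>1 \<gamma>2)) = {}"
  shows "emeasure \<nu>1 E = emeasure \<nu>2 E"
proof -
  define \<gamma> where "\<gamma> = average \<gamma>1 \<gamma>2"
  define f where "f = unused \<mu> \<gamma>"
  note \<nu>a = average_measures_of_mass[OF \<nu>]
  have \<gamma>p: "\<gamma> \<in> mass_plans m \<mu> (average \<nu>1 \<nu>2)"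
    unfolding \<gamma>_def by (rule average_mass_plans[OF \<nu> \<gamma>])
  then have \<gamma>s: "sets \<gamma> = sets borel" and \<gamma>le: "fst_marginal_le \<gamma> \<mu>" and \<gamma>f: "finite_measure \<gamma>"
    unfolding mass_plans_eq[OF \<nu>a] using \<gamma>p by (auto simp: mass_plans_def intro: finite_measure_if_total_mass)
  have s: "sets \<gamma>1 = sets borel" "sets \<gamma>2 = sets borel" "sets \<nu>1 = sets borel" "sets \<nu>2 = sets borel"
    using \<nu> \<gamma> by (auto simp: measures_of_mass_def finite_second_moment_def mass_plans_def partial_plans_def)
  have \<nu>f: "finite_measure \<nu>1" "finite_measure \<nu>2"
    using \<nu> by (auto simp: measures_of_mass_def intro: finite_measure_if_total_mass)
  note f = unused[OF \<mu>(1,2) \<gamma>s \<gamma>f \<gamma>le, folded f_def]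
  obtain Z where Z: "Z \<in> null_sets lborel"
    "\<And>x y y'. (x, y) \<in> support \<gamma> \<Longrightarrow> (x, y') \<in> support \<gamma> \<Longrightarrow> y \<noteq> y' \<Longrightarrow> x \<in> Z"
    "\<And>x y. (x, y) \<in> support \<gamma> \<Longrightarrow> x \<in> support f \<Longrightarrow> y \<noteq> x \<Longrightarrow> x \<in> Z"
    by (rule support_ae_single_valued[OF \<nu>a \<gamma>p opt[folded \<gamma>_def] fin[folded \<gamma>_def] f(2,1) eq_refl[OF f(3)]])
      (assumption, rule that)
  have Z\<mu>: "emeasure \<mu> Z = 0" and Zb: "Z \<in> sets borel"
    using Z(1) \<mu>(3) by (auto simp: absolutely_continuous_def null_sets_def)
  \<comment> \<open>The right-hand side does not mention \<open>\<gamma>i\<close>, so both targets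
    give \<open>K\<close> the same mass. \<open>abs\<close> and \<open>sat\<close> are what a plan
    inherits from the midpoint: its null sets, and saturation of \<mu>.\<close>
  have cancel: "emeasure \<nu>i K = emeasure \<mu> (fst ` (support \<gamma> \<inter> UNIV \<times> K) - support f)"
    if K: "compact K" "K \<subseteq> E" and i: "\<nu>i \<in> measures_of_mass m" "\<gamma>i \<in> mass_plans m \<mu> \<nu>i"
      and abs: "\<And>A. emeasure \<gamma> A = 0 \<Longrightarrow> emeasure \<gamma>i A = 0"
      and sat: "\<And>B. B \<in> sets borel \<Longrightarrow> emeasure \<gamma> (fst -` B) = emeasure \<mu> B \<Longrightarrow> emeasure \<gamma>i (fst -` B) = emeasure \<mu> B"
    for K \<nu>i \<gamma>i
  proof -
    define B where "B = fst ` (support \<gamma> \<inter> UNIV \<times> K) - support f"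
    have B: "B \<in> sets borel"
      unfolding B_def
      by (intro sets.Diff Borel_image_fst_closed_compact closed_support K borel_closed)
    have i_sets: "sets \<gamma>i = sets borel" and ifst: "\<And>B. B \<in> sets borel \<Longrightarrow> emeasure \<gamma>i (fst -` B) \<le> emeasure \<mu> B"
      and isnd: "\<And>B. B \<in> sets borel \<Longrightarrow> emeasure \<gamma>i (snd -` B) = emeasure \<nu>i B"
      using i(2) unfolding mass_plans_iff[OF i(1)] by blast+
    have "emeasure \<gamma>i (- support \<gamma>) = 0"
      by (rule abs[OF support_null[OF \<gamma>s]])
    moreover have "- support \<gamma> \<in> sets borel"
      using closed_support[of \<gamma>] by (simp add: borel_closed)
    ultimately have ae1: "AE z in \<gamma>i. z \<in> support \<gamma>"
      by (intro AE_I[of _ _ "- support \<gamma>"]) (auto simp: i_sets)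
    \<comment> \<open>The branching points form a Lebesgue null set, hence a \<mu>-null set, and the
      first marginal lies below \<mu>.\<close>
    have "emeasure \<gamma>i (fst -` Z) = 0"
      using ifst[OF Zb] Z\<mu> by simp
    then have ae2: "AE z in \<gamma>i. fst z \<notin> Z"
      using vimage_fst_borel[OF Zb] by (intro AE_I[of _ _ "fst -` Z"]) (auto simp: i_sets)
    have "AE z in \<gamma>i. z \<in> snd -` K \<longleftrightarrow> z \<in> fst -` B"
      using ae1 ae2
    proof eventually_elim
      fix z assume z: "z \<in> support \<gamma>" "fst z \<notin> Z"
      show "z \<in> snd -` K \<longleftrightarrow> z \<in> fst -` B"
      proof
        assume "z \<in> snd -` K"
        then have "snd z \<in> K" by simp
        moreover from this have "snd z \<notin> support f"
          using K(2) E(2) by (auto simp: f_def \<gamma>_def)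
        \<comment> \<open>A source in \<open>support f\<close> with its target outside would differ
          from that target, and then \<open>Z(3)\<close> would place it in \<open>Z\<close>.\<close>
        moreover have "fst z \<notin> support f"
          using z Z(3)[of "fst z" "snd z"] \<open>snd z \<notin> support f\<close> by (metis prod.collapse)
        ultimately show "z \<in> fst -` B"
          using z(1) by (auto simp: B_def mem_Times_iff intro!: image_eqI[of _ _ z])
      next
        assume "z \<in> fst -` B"
        then obtain y where y: "(fst z, y) \<in> support \<gamma>" "y \<in> K" by (auto simp: B_def)
        then have "y = snd z" using z Z(2)[of "fst z" y "snd z"] by auto
        then show "z \<in> snd -` K" using y by simp
      qed
    qed
    then have "emeasure \<gamma>i (snd -` K) = emeasure \<gamma>i (fst -` B)"
      using vimage_fst_borel[OF B] vimage_snd_borel[OF borel_compact[OF K(1)]]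
      by (intro emeasure_eq_AE) (simp_all only: i_sets)
    moreover have "emeasure \<gamma>i (fst -` B) = emeasure \<mu> B"
    proof (rule sat[OF B])
      have "emeasure f B \<le> emeasure f (- support f)"
        using closed_support[of f] by (intro emeasure_mono) (auto simp: B_def f(1) borel_closed)
      then have "emeasure f B = 0" using support_null[OF f(1)] by simp
      then show "emeasure \<gamma> (fst -` B) = emeasure \<mu> B" using f(3)[OF B] by simp
    qed
    ultimately show ?thesis
      using isnd[OF borel_compact[OF K(1)]] by (simp add: B_def)
  qed
  have s12: "sets \<gamma>2 = sets \<gamma>1" by (simp add: s)
  have abs: "emeasure \<gamma>1 A = 0" "emeasure \<gamma>2 A = 0" if "emeasure \<gamma> A = 0" for A
    using that by (auto simp: \<gamma>_def emeasure_average[OF s12])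
  have sat: "emeasure \<gamma>1 (fst -` B) = emeasure \<mu> B" "emeasure \<gamma>2 (fst -` B) = emeasure \<mu> B"
    if B: "B \<in> sets borel" and eq: "emeasure \<gamma> (fst -` B) = emeasure \<mu> B" for B
  proof -
    have le: "emeasure \<gamma>1 (fst -` B) \<le> emeasure \<mu> B" "emeasure \<gamma>2 (fst -` B) \<le> emeasure \<mu> B"
      using \<gamma> B unfolding mass_plans_iff[OF \<nu>(1)] mass_plans_iff[OF \<nu>(2)] by blast+
    have "emeasure \<mu> B < \<infinity>"
      using finite_measure.emeasure_finite[OF \<mu>(2), of B] by (simp add: less_top)
    from ennreal_average_eq[OF le this eq[unfolded \<gamma>_def emeasure_average[OF s12]]]
    show "emeasure \<gamma>1 (fst -` B) = emeasure \<mu> B" "emeasure \<gamma>2 (fst -` B) = emeasure \<mu> B" .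
  qed
  show ?thesis
  proof (rule emeasure_eq_if_compact_eq[OF \<nu>f(1) s(3) \<nu>f(2) s(4) _ E(1)])
    fix K assume K: "compact K" "K \<subseteq> E"
    have "emeasure \<nu>1 K = emeasure \<mu> (fst ` (support \<gamma> \<inter> UNIV \<times> K) - support f)"
      by (rule cancel[OF K \<nu>(1) \<gamma>(1)]) (erule abs(1), erule (1) sat(1))
    also have "\<dots> = emeasure \<nu>2 K"
      by (rule cancel[OF K \<nu>(2) \<gamma>(2), symmetric]) (erule abs(2), erule (1) sat(2))
    finally show "emeasure \<nu>1 K = emeasure \<nu>2 K" .
  qed
qed

text \<open>Replacing a fraction \<open>\<epsilon>\<close> of every plan by unused mass from \<open>ball p r\<close> sent to \<open>p\<close> is admissible, and costs at
  most \<open>\<epsilon> * m * r\<^sup>2\<close> for each marginal.\<close>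

lemma free_common_point_imp_zero_cost:
  fixes \<mu> :: "'i \<Rightarrow> (real^'n) measure"
  assumes J: "finite J" "J \<noteq> {}" and m: "0 < m"
    and \<mu>: "\<And>j. j \<in> J \<Longrightarrow> sets (\<mu> j) = sets borel" "\<And>j. j \<in> J \<Longrightarrow> finite_measure (\<mu> j)"
    and \<nu>: "\<nu> \<in> measures_of_mass m" and \<gamma>: "\<And>j. j \<in> J \<Longrightarrow> \<gamma> j \<in> mass_plans m (\<mu> j) \<nu>"
    and fin: "(\<Sum>j\<in>J. transport_cost (\<gamma> j)) < \<infinity>"
    and opt: "\<And>\<nu>'. \<nu>' \<in> measures_of_mass m \<Longrightarrow> (\<Sum>j\<in>J. transport_cost (\<gamma> j)) \<le> (\<Sum>j\<in>J. MK2_sq m (\<mu> j) \<nu>')"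
    and p: "\<And>j. j \<in> J \<Longrightarrow> p \<in> support (unused (\<mu> j) (\<gamma> j))"
  shows "(\<Sum>j\<in>J. transport_cost (\<gamma> j)) = 0"
proof -
  obtain t where t: "(\<Sum>j\<in>J. transport_cost (\<gamma> j)) = ennreal t" "0 \<le> t"
    using fin by (cases "\<Sum>j\<in>J. transport_cost (\<gamma> j)" rule: ennreal_cases) auto
  have \<gamma>': "sets (\<gamma> j) = sets borel" "fst_marginal_le (\<gamma> j) (\<mu> j)" "finite_measure (\<gamma> j)" if "j \<in> J" for j
    using \<gamma>[OF that] mass_plans_eq[OF \<nu>] by (auto simp: mass_plans_def intro: finite_measure_if_total_mass)
  have \<nu>': "sets \<nu> = sets borel" "emeasure \<nu> UNIV = ennreal m" "(\<integral>\<^sup>+x. ennreal ((norm x)\<^sup>2) \<partial>\<nu>) < \<infinity>"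
    using \<nu> sets_borel_space[of \<nu>] by (auto simp: measures_of_mass_def finite_second_moment_def)
  have f: "sets (unused (\<mu> j) (\<gamma> j)) = sets borel" "finite_measure (unused (\<mu> j) (\<gamma> j))"
    "E \<in> sets borel \<Longrightarrow> emeasure (unused (\<mu> j) (\<gamma> j)) E + emeasure (\<gamma> j) (fst -` E) = emeasure (\<mu> j) E"
    if "j \<in> J" for j E
    using unused[OF \<mu>(1)[OF that] \<mu>(2)[OF that] \<gamma>'(1)[OF that] \<gamma>'(3)[OF that] \<gamma>'(2)[OF that]] by auto
  have bound: "t \<le> real (card J) * m * r\<^sup>2" if r: "0 < r" for r
  proof -
    define V where "V = ball p r"
    have V: "V \<in> sets borel" by (simp add: V_def)
    have "\<forall>j\<in>J. \<exists>b. emeasure (unused (\<mu> j) (\<gamma> j)) V = ennreal b \<and> 0 < b"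
    proof
      fix j assume j: "j \<in> J"
      have "0 < emeasure (unused (\<mu> j) (\<gamma> j)) V"
        unfolding V_def by (rule support_ball_pos[OF p[OF j] r])
      moreover have "emeasure (unused (\<mu> j) (\<gamma> j)) V \<noteq> \<infinity>"
        using finite_measure.emeasure_finite[OF f(2)[OF j]] by simp
      ultimately show "\<exists>b. emeasure (unused (\<mu> j) (\<gamma> j)) V = ennreal b \<and> 0 < b"
        by (cases "emeasure (unused (\<mu> j) (\<gamma> j)) V" rule: ennreal_cases) auto
    qed
    then obtain b where "\<forall>j\<in>J. emeasure (unused (\<mu> j) (\<gamma> j)) V = ennreal (b j) \<and> 0 < b j"
      by (rule bchoice[THEN exE])
    then have b: "\<And>j. j \<in> J \<Longrightarrow> emeasure (unused (\<mu> j) (\<gamma> j)) V = ennreal (b j)" "\<And>j. j \<in> J \<Longrightarrow> 0 < b j"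
      by auto
    define \<epsilon> where "\<epsilon> = min 1 (Min (b ` J) / m)"
    have "0 < Min (b ` J)" using J b by (subst Min_gr_iff) auto
    then have \<epsilon>: "0 < \<epsilon>" "\<epsilon> \<le> 1" using m by (auto simp: \<epsilon>_def)
    have \<epsilon>b: "\<epsilon> * m \<le> b j" if "j \<in> J" for j
    proof -
      have "\<epsilon> * m \<le> Min (b ` J) / m * m"
        using m by (intro mult_right_mono) (auto simp: \<epsilon>_def)
      also have "\<dots> \<le> b j" using m J that by simp
      finally show ?thesis .
    qed
    define \<rho> where "\<rho> = add_measure (scale_measure (ennreal (1 - \<epsilon>)) \<nu>) (scale_measure (ennreal (\<epsilon> * m)) (return borel p))"
    have em_\<rho>: "emeasure \<rho> E = ennreal (1 - \<epsilon>) * emeasure \<nu> E + ennreal (\<epsilon> * m) * indicator E p" if "E \<in> sets borel" for E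
      using that by (simp add: \<rho>_def emeasure_add_measure \<nu>')
    have \<rho>s: "sets \<rho> = sets borel" by (simp add: \<rho>_def \<nu>')
    have \<rho>: "\<rho> \<in> measures_of_mass m"
    proof -
      have "total_mass \<rho> = ennreal m"
        using em_\<rho>[of UNIV] \<epsilon> m
        by (simp add: sets_borel_space[OF \<rho>s] \<nu>' ennreal_mult[symmetric] ennreal_plus[symmetric] left_diff_distrib del: ennreal_plus)
      moreover have "(\<integral>\<^sup>+x. ennreal ((norm x)\<^sup>2) \<partial>\<rho>) < \<infinity>"
      proof -
        have n: "(\<lambda>x. ennreal ((norm x)\<^sup>2)) \<in> borel_measurable M" if "sets M = sets borel" for M :: "(real^'n) measure"
          by (rule measurable_if_sets_borel[OF that norm_sq_borel_measurable])
        have "(\<integral>\<^sup>+x. ennreal ((norm x)\<^sup>2) \<partial>\<rho>) = ennreal (1 - \<epsilon>) * (\<integral>\<^sup>+x. ennreal ((norm x)\<^sup>2) \<partial>\<nu>) +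
            ennreal (\<epsilon> * m) * (\<integral>\<^sup>+x. ennreal ((norm x)\<^sup>2) \<partial>return borel p)"
          unfolding \<rho>_def
          by (subst nn_integral_add_measure) (simp_all add: \<nu>' n nn_integral_scale_measure del: borel_measurable_ennreal_iff)
        also have "(\<integral>\<^sup>+x. ennreal ((norm x)\<^sup>2) \<partial>return borel p) = ennreal ((norm p)\<^sup>2)"
          by (subst nn_integral_return) (simp_all add: n del: borel_measurable_ennreal_iff)
        also have "ennreal (1 - \<epsilon>) * (\<integral>\<^sup>+x. ennreal ((norm x)\<^sup>2) \<partial>\<nu>) + ennreal (\<epsilon> * m) * ennreal ((norm p)\<^sup>2) < \<infinity>"
          using \<nu>'(3) by (simp add: ennreal_mult_less_top)
        finally show ?thesis .
      qed
      ultimately show ?thesis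
        by (simp add: measures_of_mass_def finite_second_moment_def \<rho>s)
    qed
    have MK: "MK2_sq m (\<mu> j) \<rho> \<le> ennreal (1 - \<epsilon>) * transport_cost (\<gamma> j) + ennreal (\<epsilon> * m * r\<^sup>2)" if j: "j \<in> J" for j
    proof -
      define \<beta> where "\<beta> = scale_measure (ennreal (\<epsilon> * m / b j)) (density (unused (\<mu> j) (\<gamma> j)) (indicator V))"
      have \<beta>s: "sets \<beta> = sets borel" by (simp add: \<beta>_def f(1)[OF j])
      have em_\<beta>: "emeasure \<beta> E = ennreal (\<epsilon> * m / b j) * emeasure (unused (\<mu> j) (\<gamma> j)) (V \<inter> E)" if "E \<in> sets borel" for E
        using that V by (simp add: \<beta>_def emeasure_density_indicator f(1)[OF j])
      have \<beta>_mass: "total_mass \<beta> = ennreal (\<epsilon> * m)"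
        using em_\<beta>[of UNIV] b[OF j] \<epsilon> m by (simp add: sets_borel_space[OF \<beta>s] ennreal_mult[symmetric])
      have \<beta>_le: "emeasure \<beta> E \<le> emeasure (unused (\<mu> j) (\<gamma> j)) E" if E: "E \<in> sets borel" for E
      proof -
        have "emeasure \<beta> E \<le> 1 * emeasure (unused (\<mu> j) (\<gamma> j)) E"
          unfolding em_\<beta>[OF E] using \<epsilon>b[OF j] b(2)[OF j] E V
          by (intro mult_mono emeasure_mono) (auto simp: f(1)[OF j])
        then show ?thesis by simp
      qed
      have "AE x in \<beta>. x \<in> V"
        using V em_\<beta>[of "- V"] by (intro AE_I[of _ _ "- V"]) (auto simp: \<beta>s)
      then have "AE x in \<beta>. ennreal ((norm (x - p))\<^sup>2) \<le> ennreal (r\<^sup>2)"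
        by eventually_elim (auto simp: V_def dist_norm norm_minus_commute intro!: ennreal_leI power_mono)
      then have "(\<integral>\<^sup>+x. ennreal ((norm (x - p))\<^sup>2) \<partial>\<beta>) \<le> (\<integral>\<^sup>+x. ennreal (r\<^sup>2) \<partial>\<beta>)"
        by (rule nn_integral_mono_AE)
      also have "\<dots> = ennreal (\<epsilon> * m * r\<^sup>2)"
        using \<epsilon> m by (simp add: \<beta>_mass ennreal_mult[symmetric] mult.commute)
      finally have \<beta>_cost: "(\<integral>\<^sup>+x. ennreal ((norm (x - p))\<^sup>2) \<partial>\<beta>) \<le> ennreal (\<epsilon> * m * r\<^sup>2)" .
      define \<tau> where "\<tau> = distr \<beta> borel (\<lambda>x. (x, p))"
      note c = concentrated_plan[OF \<beta>s, where p=p, folded \<tau>_def]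
      define \<gamma>n where "\<gamma>n = add_measure (scale_measure (ennreal (1 - \<epsilon>)) (\<gamma> j)) \<tau>"
      have em: "emeasure \<gamma>n A = ennreal (1 - \<epsilon>) * emeasure (\<gamma> j) A + emeasure \<tau> A" for A
        by (simp add: \<gamma>n_def emeasure_add_measure c(1) \<gamma>'(1)[OF j])
      have "\<gamma>n \<in> mass_plans m (\<mu> j) \<rho>"
        unfolding mass_plans_iff[OF \<rho>]
      proof (intro conjI ballI)
        show "sets \<gamma>n = sets borel" by (simp add: \<gamma>n_def \<gamma>'(1)[OF j])
        fix E :: "(real^'n) set" assume E: "E \<in> sets borel"
        have "emeasure \<gamma>n (fst -` E) \<le> 1 * emeasure (\<gamma> j) (fst -` E) + emeasure (unused (\<mu> j) (\<gamma> j)) E"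
          unfolding em c(2)[OF E] using \<epsilon> by (intro add_mono mult_right_mono \<beta>_le E) auto
        also have "\<dots> = emeasure (\<mu> j) E"
          using f(3)[OF j E] by (simp add: add.commute)
        finally show "emeasure \<gamma>n (fst -` E) \<le> emeasure (\<mu> j) E" .
        have "emeasure (\<gamma> j) (snd -` E) = emeasure \<nu> E"
          using \<gamma>[OF j] E unfolding mass_plans_iff[OF \<nu>] by blast
        then show "emeasure \<gamma>n (snd -` E) = emeasure \<rho> E"
          unfolding em c(3)[OF E] em_\<rho>[OF E] \<beta>_mass by simp
      qed
      then have "MK2_sq m (\<mu> j) \<rho> \<le> transport_cost \<gamma>n" by (rule MK2_sq_le)
      also have "transport_cost \<gamma>n = ennreal (1 - \<epsilon>) * transport_cost (\<gamma> j) + transport_cost \<tau>"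
        unfolding transport_cost_def \<gamma>n_def
        using measurable_if_sets_borel[OF \<gamma>'(1)[OF j] cost_borel_measurable]
        by (subst nn_integral_add_measure)
          (simp_all add: c(1) \<gamma>'(1)[OF j] nn_integral_scale_measure measurable_cong_sets[OF sets_scale_measure refl] del: borel_measurable_ennreal_iff)
      also have "\<dots> \<le> ennreal (1 - \<epsilon>) * transport_cost (\<gamma> j) + ennreal (\<epsilon> * m * r\<^sup>2)"
        unfolding c(4) by (intro add_left_mono \<beta>_cost)
      finally show ?thesis .
    qed
    have "ennreal t \<le> (\<Sum>j\<in>J. MK2_sq m (\<mu> j) \<rho>)"
      using opt[OF \<rho>] by (simp add: t)
    also have "\<dots> \<le> (\<Sum>j\<in>J. ennreal (1 - \<epsilon>) * transport_cost (\<gamma> j) + ennreal (\<epsilon> * m * r\<^sup>2))"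
      by (rule sum_mono[OF MK])
    also have "\<dots> = ennreal (1 - \<epsilon>) * ennreal t + ennreal (real (card J)) * ennreal (\<epsilon> * m * r\<^sup>2)"
      by (simp add: sum.distrib sum_distrib_left[symmetric] t ennreal_of_nat_eq_real_of_nat)
    also have "\<dots> = ennreal ((1 - \<epsilon>) * t + real (card J) * (\<epsilon> * m * r\<^sup>2))"
      using \<epsilon> m t by (simp add: ennreal_mult[symmetric] ennreal_plus[symmetric] del: ennreal_plus)
    finally have "t \<le> (1 - \<epsilon>) * t + real (card J) * (\<epsilon> * m * r\<^sup>2)"
      using \<epsilon> m t by (subst (asm) ennreal_le_iff) (auto intro!: add_nonneg_nonneg)
    \<comment> \<open>The factor \<epsilon> depends on \<open>r\<close>, but it occurs on both sides
      and cancels, so the bound holds for every radius.\<close>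
    then have "\<epsilon> * t \<le> \<epsilon> * (real (card J) * m * r\<^sup>2)"
      by (simp add: algebra_simps)
    then show ?thesis using \<epsilon> by simp
  qed
  have "t \<le> 0"
  proof (rule ccontr)
    assume "\<not> t \<le> 0"
    define a where "a = real (card J) * m"
    have a: "0 < a" using J m by (simp add: a_def card_gt_0_iff)
    \<comment> \<open>This radius makes the bound equal to \<open>t / 2\<close>.\<close>
    define r where "r = sqrt (t / (2 * a))"
    have "0 < r" "r\<^sup>2 = t / (2 * a)" using \<open>\<not> t \<le> 0\<close> a by (auto simp: r_def)
    then have "t \<le> t / 2" using bound[of r] a by (simp add: a_def[symmetric])
    then show False using \<open>\<not> t \<le> 0\<close> by simp
  qed
  then show ?thesis using t by simp
qed

text \<open>Zero cost concentrates the plan on the diagonal, where both projections agree; the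
  target then equals the first marginal.\<close>

lemma zero_cost_plan_le:
  fixes \<mu> :: "(real^'n) measure"
  assumes \<nu>: "\<nu> \<in> measures_of_mass m" and \<gamma>: "\<gamma> \<in> mass_plans m \<mu> \<nu>"
    and cost: "transport_cost \<gamma> = 0" and E: "E \<in> sets borel"
  shows "emeasure \<nu> E \<le> emeasure \<mu> E"
proof -
  have \<gamma>s: "sets \<gamma> = sets borel" and fs: "emeasure \<gamma> (fst -` E) \<le> emeasure \<mu> E"
    and sn: "emeasure \<gamma> (snd -` E) = emeasure \<nu> E"
    using \<gamma> E unfolding mass_plans_iff[OF \<nu>] by blast+
  have "AE z in \<gamma>. ennreal ((norm (fst z - snd z))\<^sup>2) = 0"
    using cost measurable_if_sets_borel[OF \<gamma>s cost_borel_measurable]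
    by (simp only: transport_cost_def nn_integral_0_iff_AE)
  then have "AE z in \<gamma>. z \<in> snd -` E \<longleftrightarrow> z \<in> fst -` E"
    by eventually_elim (simp add: ennreal_eq_0_iff)
  then have "emeasure \<gamma> (snd -` E) = emeasure \<gamma> (fst -` E)"
    using vimage_fst_borel[OF E] vimage_snd_borel[OF E] by (intro emeasure_eq_AE) (simp_all only: \<gamma>s)
  with fs sn show ?thesis by simp
qed

text \<open>Any Borel set splits according to which of two densities is smaller, and on each piece
  the corresponding bound is the one for the minimum. Induction handles finitely many densities, and
  \<nu> itself is never represented by a density.\<close>

lemma le_density_Min:
  fixes g :: "'i \<Rightarrow> 'a::euclidean_space \<Rightarrow> ennreal"
  assumes J: "finite J" "J \<noteq> {}" and g: "\<And>j. j \<in> J \<Longrightarrow> g j \<in> borel_measurable borel"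
    and \<nu>: "sets \<nu> = sets borel"
    and le: "\<And>j E. j \<in> J \<Longrightarrow> E \<in> sets borel \<Longrightarrow> emeasure \<nu> E \<le> emeasure (density lborel (g j)) E"
    and E: "E \<in> sets borel"
  shows "(\<lambda>x. MIN j\<in>J. g j x) \<in> borel_measurable borel"
    and "emeasure \<nu> E \<le> emeasure (density lborel (\<lambda>x. MIN j\<in>J. g j x)) E"
proof -
  have "(\<lambda>x. MIN j\<in>J. g j x) \<in> borel_measurable borel \<and>
    (\<forall>E\<in>sets borel. emeasure \<nu> E \<le> emeasure (density lborel (\<lambda>x. MIN j\<in>J. g j x)) E)"
    using J g le
  proof (induction J rule: finite_ne_induct)
    case (singleton j)
    then show ?case by simp
  next
    case (insert i J)
    define h where "h x = (MIN j\<in>J. g j x)" for x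
    have "h \<in> borel_measurable borel \<and> (\<forall>E\<in>sets borel. emeasure \<nu> E \<le> emeasure (density lborel h) E)"
      unfolding h_def[abs_def] by (rule insert.IH) (use insert.prems in simp_all)
    then have h: "h \<in> borel_measurable borel" "\<And>E. E \<in> sets borel \<Longrightarrow> emeasure \<nu> E \<le> emeasure (density lborel h) E"
      by auto
    have gi: "g i \<in> borel_measurable borel" using insert.prems by simp
    have Min: "(\<lambda>x. MIN j\<in>insert i J. g j x) = (\<lambda>x. min (g i x) (h x))"
      using insert.hyps by (simp add: h_def)
    have meas: "(\<lambda>x. min (g i x) (h x)) \<in> borel_measurable borel"
      using gi h(1) by measurable
    have "emeasure \<nu> E \<le> emeasure (density lborel (\<lambda>x. min (g i x) (h x))) E" if E: "E \<in> sets borel" for E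
    proof -
      define A where "A = E \<inter> {x. g i x \<le> h x}"
      define B where "B = E \<inter> {x. h x < g i x}"
      have "{x \<in> space borel. g i x \<le> h x} \<in> sets borel" "{x \<in> space borel. h x < g i x} \<in> sets borel"
        using gi h(1) by measurable
      then have AB: "A \<in> sets borel" "B \<in> sets borel" using E by (auto simp: A_def B_def)
      have un: "E = A \<union> B" "A \<inter> B = {}" by (auto simp: A_def B_def)
      have "emeasure \<nu> A \<le> emeasure (density lborel (g i)) A"
        using insert.prems AB by simp
      also have "\<dots> = emeasure (density lborel (\<lambda>x. min (g i x) (h x))) A"
        using gi meas AB by (auto simp: emeasure_density A_def indicator_def intro!: nn_integral_cong)
      finally have 1: "emeasure \<nu> A \<le> emeasure (density lborel (\<lambda>x. min (g i x) (h x))) A" .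
      have "emeasure \<nu> B \<le> emeasure (density lborel h) B"
        using h(2) AB by simp
      also have "\<dots> = emeasure (density lborel (\<lambda>x. min (g i x) (h x))) B"
        using h(1) meas AB by (auto simp: emeasure_density B_def indicator_def min_def intro!: nn_integral_cong)
      finally have 2: "emeasure \<nu> B \<le> emeasure (density lborel (\<lambda>x. min (g i x) (h x))) B" .
      have "emeasure \<nu> E = emeasure \<nu> A + emeasure \<nu> B"
        unfolding un(1) using AB un(2) \<nu> by (subst plus_emeasure) auto
      also have "\<dots> \<le> emeasure (density lborel (\<lambda>x. min (g i x) (h x))) A + emeasure (density lborel (\<lambda>x. min (g i x) (h x))) B"
        by (intro add_mono 1 2)
      also have "\<dots> = emeasure (density lborel (\<lambda>x. min (g i x) (h x))) E"
        unfolding un(1) using AB un(2) by (subst plus_emeasure) auto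
      finally show ?thesis .
    qed
    then show ?case unfolding Min using meas by blast
  qed
  then show "(\<lambda>x. MIN j\<in>J. g j x) \<in> borel_measurable borel"
    "emeasure \<nu> E \<le> emeasure (density lborel (\<lambda>x. MIN j\<in>J. g j x)) E"
    using E by blast+
qed

text \<open>Equality of the finite sums leaves no slack in any term. This passes from optimality of
  the midpoint plans in total to optimality for each index.\<close>

lemma ennreal_sum_eq_imp_eq:
  fixes a b :: "'i \<Rightarrow> ennreal"
  assumes "finite J" and le: "\<And>j. j \<in> J \<Longrightarrow> a j \<le> b j" and sum: "sum b J \<le> sum a J" "sum b J < \<infinity>" and i: "i \<in> J"
  shows "a i = b i"
proof (rule antisym[OF le[OF i]])
  have "sum a (J - {i}) + b i \<le> sum b (J - {i}) + b i"
    by (intro add_right_mono sum_mono le) auto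
  also have "\<dots> = sum b J" using assms(1) i by (simp add: sum.remove add.commute)
  also have "\<dots> \<le> sum a J" by (rule sum)
  also have "\<dots> = sum a (J - {i}) + a i" using assms(1) i by (simp add: sum.remove add.commute)
  finally have *: "sum a (J - {i}) + b i \<le> sum a (J - {i}) + a i" .
  have "sum a (J - {i}) \<le> sum b J"
    using assms(1) by (intro order_trans[OF sum_mono2[of J "J - {i}" a] sum_mono[OF le]]) auto
  then have "sum a (J - {i}) \<noteq> \<infinity>" using sum(2) by (auto simp: top_unique)
  then show "b i \<le> a i" using * by (auto simp: ennreal_add_left_cancel_le)
qed

lemma barycenter_unique:
  fixes \<mu> :: "'i \<Rightarrow> (real^'n) measure"
  assumes J: "finite J" "J \<noteq> {}" and m: "0 < m"
    and \<mu>: "\<And>j. j \<in> J \<Longrightarrow> finite_second_moment (\<mu> j)" "\<And>j. j \<in> J \<Longrightarrow> finite_measure (\<mu> j)"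
      "\<And>j. j \<in> J \<Longrightarrow> absolutely_continuous lborel (\<mu> j)"
    and g: "\<And>j. j \<in> J \<Longrightarrow> g j \<in> borel_measurable borel" "\<And>j. j \<in> J \<Longrightarrow> \<mu> j = density lborel (g j)"
    and mass: "total_mass (density lborel (\<lambda>x. MIN j\<in>J. g j x)) \<le> ennreal m"
    and \<nu>1: "\<nu>1 \<in> measures_of_mass m"
      "\<And>\<nu>'. \<nu>' \<in> measures_of_mass m \<Longrightarrow> (\<Sum>j\<in>J. MK2_sq m (\<mu> j) \<nu>1) \<le> (\<Sum>j\<in>J. MK2_sq m (\<mu> j) \<nu>')"
    and \<nu>2: "\<nu>2 \<in> measures_of_mass m"
      "\<And>\<nu>'. \<nu>' \<in> measures_of_mass m \<Longrightarrow> (\<Sum>j\<in>J. MK2_sq m (\<mu> j) \<nu>2) \<le> (\<Sum>j\<in>J. MK2_sq m (\<mu> j) \<nu>')"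
    and fin: "(\<Sum>j\<in>J. MK2_sq m (\<mu> j) \<nu>1) < \<infinity>"
  shows "\<nu>1 = \<nu>2"
proof -
  define I where "I = (\<Sum>j\<in>J. MK2_sq m (\<mu> j) \<nu>1)"
  have I2: "I = (\<Sum>j\<in>J. MK2_sq m (\<mu> j) \<nu>2)"
    unfolding I_def by (intro antisym \<nu>1 \<nu>2)
  have Ifin: "I < \<infinity>" using fin by (simp add: I_def)
  have \<mu>s: "sets (\<mu> j) = sets borel" if "j \<in> J" for j
    using \<mu>(1)[OF that] by (simp add: finite_second_moment_def)
  have \<nu>s: "sets \<nu>1 = sets borel" "sets \<nu>2 = sets borel"
    using \<nu>1(1) \<nu>2(1) by (auto simp: measures_of_mass_def finite_second_moment_def)
  have plans: "\<exists>\<gamma>. \<forall>j\<in>J. \<gamma> j \<in> mass_plans m (\<mu> j) \<nu> \<and> transport_cost (\<gamma> j) = MK2_sq m (\<mu> j) \<nu>"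
    if \<nu>: "\<nu> \<in> measures_of_mass m" and eq: "I = (\<Sum>j\<in>J. MK2_sq m (\<mu> j) \<nu>)" for \<nu>
  proof (intro bchoice ballI)
    fix j assume j: "j \<in> J"
    have "MK2_sq m (\<mu> j) \<nu> \<le> I"
      unfolding eq by (rule member_le_sum[OF j]) (simp_all add: J)
    then have "MK2_sq m (\<mu> j) \<nu> < \<infinity>" using Ifin by (rule le_less_trans)
    then show "\<exists>\<gamma>. \<gamma> \<in> mass_plans m (\<mu> j) \<nu> \<and> transport_cost \<gamma> = MK2_sq m (\<mu> j) \<nu>"
      by (rule MK2_sq_attained[OF m \<nu> \<mu>(1)[OF j] \<mu>(2)[OF j]]) blast
  qed
  from plans[OF \<nu>1(1) I_def] obtain \<gamma>1 where "\<forall>j\<in>J. \<gamma>1 j \<in> mass_plans m (\<mu> j) \<nu>1 \<and> transport_cost (\<gamma>1 j) = MK2_sq m (\<mu> j) \<nu>1"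
    by (rule exE)
  then have \<gamma>1: "\<And>j. j \<in> J \<Longrightarrow> \<gamma>1 j \<in> mass_plans m (\<mu> j) \<nu>1" "\<And>j. j \<in> J \<Longrightarrow> transport_cost (\<gamma>1 j) = MK2_sq m (\<mu> j) \<nu>1"
    by auto
  from plans[OF \<nu>2(1) I2] obtain \<gamma>2 where "\<forall>j\<in>J. \<gamma>2 j \<in> mass_plans m (\<mu> j) \<nu>2 \<and> transport_cost (\<gamma>2 j) = MK2_sq m (\<mu> j) \<nu>2"
    by (rule exE)
  then have \<gamma>2: "\<And>j. j \<in> J \<Longrightarrow> \<gamma>2 j \<in> mass_plans m (\<mu> j) \<nu>2" "\<And>j. j \<in> J \<Longrightarrow> transport_cost (\<gamma>2 j) = MK2_sq m (\<mu> j) \<nu>2"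
    by auto
  define \<gamma> where "\<gamma> j = average (\<gamma>1 j) (\<gamma>2 j)" for j
  define \<nu> where "\<nu> = average \<nu>1 \<nu>2"
  have \<nu>: "\<nu> \<in> measures_of_mass m"
    unfolding \<nu>_def by (rule average_measures_of_mass[OF \<nu>1(1) \<nu>2(1)])
  have \<gamma>: "\<gamma> j \<in> mass_plans m (\<mu> j) \<nu>" "transport_cost (\<gamma> j) = (transport_cost (\<gamma>1 j) + transport_cost (\<gamma>2 j)) / 2"
    if "j \<in> J" for j
    unfolding \<gamma>_def \<nu>_def using average_mass_plans[OF \<nu>1(1) \<nu>2(1) \<gamma>1(1)[OF that] \<gamma>2(1)[OF that]] by auto
  have cost: "(\<Sum>j\<in>J. transport_cost (\<gamma> j)) = I"
  proof -
    have "(\<Sum>j\<in>J. transport_cost (\<gamma> j)) = (\<Sum>j\<in>J. (MK2_sq m (\<mu> j) \<nu>1 + MK2_sq m (\<mu> j) \<nu>2) / 2)"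
      using \<gamma>(2) \<gamma>1(2) \<gamma>2(2) by (intro sum.cong) auto
    also have "\<dots> = (I + I) / 2"
      by (simp add: divide_ennreal_def sum_distrib_right[symmetric] sum.distrib I_def[symmetric] I2[symmetric])
    finally show ?thesis by (simp only: half_double)
  qed
  have le_I: "I \<le> (\<Sum>j\<in>J. MK2_sq m (\<mu> j) \<nu>')" if "\<nu>' \<in> measures_of_mass m" for \<nu>'
    unfolding I_def by (rule \<nu>1(2)[OF that])
  have MK_le: "MK2_sq m (\<mu> j) \<nu> \<le> transport_cost (\<gamma> j)" if "j \<in> J" for j
    by (rule MK2_sq_le[OF \<gamma>(1)[OF that]])
  \<comment> \<open>The costs of the midpoint plans sum to the minimum \<open>I\<close>, while the
    infima at the midpoint \<nu> sum to at least \<open>I\<close>.\<close>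
  have opt: "transport_cost (\<gamma> j) = MK2_sq m (\<mu> j) \<nu>" if "j \<in> J" for j
    by (rule ennreal_sum_eq_imp_eq[OF J(1) _ _ _ that, symmetric])
      (use MK_le cost Ifin le_I[OF \<nu>] in auto)
  have opt_fin: "transport_cost (\<gamma> j) < \<infinity>" if "j \<in> J" for j
    using member_le_sum[OF that, of "\<lambda>j. transport_cost (\<gamma> j)"] J Ifin cost by (auto intro: le_less_trans)
  show ?thesis
  proof (cases "\<exists>p. \<forall>j\<in>J. p \<in> support (unused (\<mu> j) (\<gamma> j))")
    case True
    then obtain p where p: "\<And>j. j \<in> J \<Longrightarrow> p \<in> support (unused (\<mu> j) (\<gamma> j))" by blast
    have "(\<Sum>j\<in>J. transport_cost (\<gamma> j)) = 0"
      by (rule free_common_point_imp_zero_cost[OF J m \<mu>s \<mu>(2) \<nu> \<gamma>(1) _ _ p])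
        (use cost Ifin le_I in simp_all)
    then have I0: "I = 0" using cost by simp
    \<comment> \<open>A target reached at cost zero lies below every \<open>\<mu> j\<close>, hence
      below the measure with minimum density, whose mass is at most \<open>m\<close>; so they are
      equal.\<close>
    have eq: "\<nu>i = density lborel (\<lambda>x. MIN j\<in>J. g j x)"
      if \<nu>i: "\<nu>i \<in> measures_of_mass m" and \<gamma>i: "\<And>j. j \<in> J \<Longrightarrow> \<gamma>i j \<in> mass_plans m (\<mu> j) \<nu>i"
        "\<And>j. j \<in> J \<Longrightarrow> transport_cost (\<gamma>i j) = 0" for \<nu>i \<gamma>i
    proof (rule measure_eqI_if_le)
      have i_sets: "sets \<nu>i = sets borel" and i_mass: "total_mass \<nu>i = ennreal m"
        using \<nu>i by (auto simp: measures_of_mass_def finite_second_moment_def)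
      show "sets \<nu>i = sets (density lborel (\<lambda>x. MIN j\<in>J. g j x))" by (simp add: i_sets)
      show "emeasure \<nu>i A \<le> emeasure (density lborel (\<lambda>x. MIN j\<in>J. g j x)) A" if "A \<in> sets \<nu>i" for A
      proof (rule le_density_Min[OF J g(1) i_sets])
        show "A \<in> sets borel" using that i_sets by simp
        show "emeasure \<nu>i E \<le> emeasure (density lborel (g j)) E" if "j \<in> J" "E \<in> sets borel" for j E
          using zero_cost_plan_le[OF \<nu>i \<gamma>i(1)[OF that(1)] \<gamma>i(2)[OF that(1)] that(2)] g(2)[OF that(1)] by simp
      qed
      show "total_mass (density lborel (\<lambda>x. MIN j\<in>J. g j x)) \<le> total_mass \<nu>i"
        using mass by (simp add: i_mass)
      show "total_mass \<nu>i < \<infinity>" by (simp add: i_mass)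
    qed
    have "transport_cost (\<gamma>1 j) = 0" "transport_cost (\<gamma>2 j) = 0" if "j \<in> J" for j
      using I0 I_def I2 J that by (simp_all add: \<gamma>1(2) \<gamma>2(2))
    then show ?thesis
      using eq[OF \<nu>1(1) \<gamma>1(1)] eq[OF \<nu>2(1) \<gamma>2(1)] by simp
  next
    case False
    define S where "S j = support (unused (\<mu> j) (\<gamma> j))" for j
    have S: "closed (S j)" for j
      unfolding S_def by (rule closed_support)
    have off: "emeasure \<nu>1 E = emeasure \<nu>2 E" if "j \<in> J" "E \<in> sets borel" "E \<inter> S j = {}" for j E
      using targets_agree_off_unused[OF \<mu>s[OF that(1)] \<mu>(2)[OF that(1)] \<mu>(3)[OF that(1)] \<nu>1(1) \<nu>2(1)
          \<gamma>1(1)[OF that(1)] \<gamma>2(1)[OF that(1)] opt[OF that(1), unfolded \<gamma>_def \<nu>_def]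
          opt_fin[OF that(1), unfolded \<gamma>_def] that(2)] that(3)
      by (simp add: S_def \<gamma>_def)
    \<comment> \<open>Agreement off each single \<open>S j\<close> is glued by splitting a set along
      \<open>S i\<close>: the part inside avoids the remaining intersection, the part outside avoids
      \<open>S i\<close>.\<close>
    have agree: "emeasure \<nu>1 E = emeasure \<nu>2 E" if "K \<subseteq> J" "E \<in> sets borel" "E \<inter> (\<Inter>j\<in>K. S j) = {}" for K E
    proof -
      have "finite K" using that(1) J(1) by (rule finite_subset)
      then show ?thesis
        using that
      proof (induction K arbitrary: E)
        case empty
        \<comment> \<open>The intersection over no index is the whole space, so \<open>E\<close> is
          empty.\<close>
        then show ?case by simp
      next
        case (insert i K)
        have E: "E \<inter> S i \<in> sets borel" "E - S i \<in> sets borel"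
          using insert.prems(2) S[of i] by (auto intro: borel_closed)
        have E_split: "emeasure N E = emeasure N (E \<inter> S i) + emeasure N (E - S i)" if "sets N = sets borel" for N :: "(real^'n) measure"
          using E that by (subst plus_emeasure) (auto intro!: arg_cong[where f="emeasure N"])
        have "emeasure \<nu>1 (E \<inter> S i) = emeasure \<nu>2 (E \<inter> S i)"
          using insert.prems E by (intro insert.IH) auto
        moreover have "emeasure \<nu>1 (E - S i) = emeasure \<nu>2 (E - S i)"
          using insert.prems E by (intro off[of i]) auto
        ultimately show ?case
          by (simp add: E_split \<nu>s)
      qed
    qed
    have "(\<Inter>j\<in>J. S j) = {}"
      using False by (auto simp: S_def)
    then show ?thesis
      by (intro measure_eqI) (auto simp: \<nu>s intro!: agree[of J])
  qed
qed

text \<open>This settles the degenerate case \<open>m = 0\<close>, kept apart because the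
  compactness argument normalizes by \<open>m\<close>: a single candidate is trivially the unique
  minimizer.\<close>

lemma measures_of_mass_0: "measures_of_mass 0 = {null_measure (borel :: (real^'n) measure)}"
proof -
  have "\<nu> = null_measure borel" if "sets \<nu> = sets borel" "total_mass \<nu> = 0" for \<nu> :: "(real^'n) measure"
  proof (rule measure_eqI)
    fix A
    have "emeasure \<nu> A \<le> total_mass \<nu>" by (rule emeasure_space)
    then show "emeasure \<nu> A = emeasure (null_measure borel) A" using that by simp
  qed (simp add: that)
  moreover have "(\<integral>\<^sup>+x. ennreal ((norm x)\<^sup>2) \<partial>null_measure (borel :: (real^'n) measure)) = 0"
    by (subst nn_integral_0_iff_AE) (auto simp: norm_sq_borel_measurable AE_iff_null null_sets_def)
  ultimately show ?thesis
    by (auto simp: measures_of_mass_def finite_second_moment_def)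
qed

theorem theorem1p2:
  fixes \<mu> :: "nat \<Rightarrow> (real^'n) measure"
    and g :: "nat \<Rightarrow> real^'n \<Rightarrow> ennreal"
    and N :: nat and m :: real
  assumes "1 \<le> N"
    and "\<And>j. j \<in> {1..N} \<Longrightarrow> finite_second_moment (\<mu> j)"
    and "\<And>j. j \<in> {1..N} \<Longrightarrow> absolutely_continuous lborel (\<mu> j)"
    and "\<And>j. j \<in> {1..N} \<Longrightarrow> total_mass (\<mu> j) < \<infinity>"
    and "\<And>j. j \<in> {1..N} \<Longrightarrow> g j \<in> borel_measurable borel"
    and "\<And>j. j \<in> {1..N} \<Longrightarrow> \<mu> j = density lborel (g j)"
    and "0 \<le> m"
    and "total_mass (density lborel (\<lambda>x. MIN j\<in>{1..N}. g j x)) \<le> ennreal m"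
    and "ennreal m \<le> (MIN j\<in>{1..N}. total_mass (\<mu> j))"
  shows "\<exists>!\<nu>. is_arg_min (\<lambda>\<nu>. \<Sum>j=1..N. MK2_sq m (\<mu> j) \<nu>) (\<lambda>\<nu>. \<nu> \<in> measures_of_mass m) \<nu>"
proof (cases "m = 0")
  case True
  then show ?thesis by (auto simp: is_arg_min_def measures_of_mass_0)
next
  case False
  then have m: "0 < m" using assms(7) by simp
  have J: "finite {1..N}" "{1..N} \<noteq> {}" using assms(1) by auto
  have fm: "finite_measure (\<mu> j)" if "j \<in> {1..N}" for j
    using assms(4)[OF that] by (intro finite_measureI) simp
  have mass: "ennreal m \<le> total_mass (\<mu> j)" if "j \<in> {1..N}" for j
    using assms(9) J that by (subst (asm) Min_ge_iff) auto
  obtain \<nu> where \<nu>: "\<nu> \<in> measures_of_mass m" "(\<Sum>j=1..N. MK2_sq m (\<mu> j) \<nu>) < \<infinity>"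
    "\<And>\<nu>'. \<nu>' \<in> measures_of_mass m \<Longrightarrow> (\<Sum>j=1..N. MK2_sq m (\<mu> j) \<nu>) \<le> (\<Sum>j=1..N. MK2_sq m (\<mu> j) \<nu>')"
    by (rule barycenter_exists[OF J m assms(2) fm mass]) (assumption, assumption, assumption, rule that)
  show ?thesis
  proof (rule ex1I[of _ \<nu>])
    show "is_arg_min (\<lambda>\<nu>. \<Sum>j=1..N. MK2_sq m (\<mu> j) \<nu>) (\<lambda>\<nu>. \<nu> \<in> measures_of_mass m) \<nu>"
      using \<nu> by (auto simp: is_arg_min_linorder)
    fix \<nu>' assume "is_arg_min (\<lambda>\<nu>. \<Sum>j=1..N. MK2_sq m (\<mu> j) \<nu>) (\<lambda>\<nu>. \<nu> \<in> measures_of_mass m) \<nu>'"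
    then have \<nu>': "\<nu>' \<in> measures_of_mass m"
      "\<And>\<rho>. \<rho> \<in> measures_of_mass m \<Longrightarrow> (\<Sum>j=1..N. MK2_sq m (\<mu> j) \<nu>') \<le> (\<Sum>j=1..N. MK2_sq m (\<mu> j) \<rho>)"
      by (auto simp: is_arg_min_linorder)
    show "\<nu>' = \<nu>"
      by (rule sym, rule barycenter_unique[where J="{1..N}" and \<mu>=\<mu> and g=g, OF J m assms(2) fm assms(3) assms(5) assms(6) assms(8) \<nu>(1,3) \<nu>' \<nu>(2)])
  qed
qed

end
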